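(* Let $T$ be a fixed tree with $t\ge 2$ vertices. There is a constant $\epsilon_0>0$ such that the following holds. Let $\epsilon=\epsilon(n)\in(0,\epsilon_0]$ and $p=p(n)\in(0,1]$ satisfy $\epsilon^{6}np^4 \gg \log^3 n$. Then for all sufficiently large $n$ that are multiples of $t$, every $(\epsilon,p)$-regular graph $G$ on $n$ vertices contains a collection of pairwise edge-disjoint $T$-factors which together cover all but at most a $2\epsilon^{1/3}$-fraction of the edges of $G$.
   Context: Graphs are finite and simple. A graph $G$ on $n$ vertices is called $(\epsilon,p)$-regular if (i) $d(v)\ge(1-\epsilon)np$ for every vertex $v$, and (ii) $d(u,v)\le(1+\epsilon)np^2$ for every pair of distinct vertices $u,v$. Here $d(v)$ is the degree of $v$ and $d(u,v)$ is the co-degree, i.e. the number of common neighbors of $u$ and $v$. For a graph $H$ with $t$ vertices and a graph $G$ with $n$ vertices, $t\mid n$, an $H$-factor of $G$ is a collection of $n/t$ vertex-disjoint (not necessarily induced) subgraphs of $G$, each isomorphic to $H$ (so they cover all vertices of $G$). $A_n\gg B_n$ means $A_n/B_n\to\infty$ as $n\to\infty$. Logarithms are natural. *)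

theory Defs
  imports Complex_Main "Graph_Theory.Graph_Theory"
begin

text \<open>
  A finite simple graph is a \<^locale>\<open>pair_graph\<close>: each undirected edge is represented by its
  two opposite arcs. Edges are counted, and edge-disjointness is stated, in terms of
  unordered pairs.
\<close>

definition edges :: "'a pair_pre_digraph \<Rightarrow> 'a set set" where
  "edges G = {{u, v} | u v. (u, v) \<in> parcs G}"

text \<open>In a \<^locale>\<open>pair_graph\<close> the out-degree is the number of neighbours.\<close>

definition degree :: "'a pair_pre_digraph \<Rightarrow> 'a \<Rightarrow> nat" where
  "degree G v = out_degree (with_proj G) v"

definition codegree :: "'a pair_pre_digraph \<Rightarrow> 'a \<Rightarrow> 'a \<Rightarrow> nat" where
  "codegree G u v = card {w \<in> pverts G. (u, w) \<in> parcs G \<and> (v, w) \<in> parcs G}"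

definition eps_p_regular :: "real \<Rightarrow> real \<Rightarrow> 'a pair_pre_digraph \<Rightarrow> bool" where
  "eps_p_regular \<epsilon> p G \<longleftrightarrow>
     (\<forall>v \<in> pverts G. real (degree G v) \<ge> (1 - \<epsilon>) * real (card (pverts G)) * p) \<and>
     (\<forall>u \<in> pverts G. \<forall>v \<in> pverts G. u \<noteq> v \<longrightarrow>
        real (codegree G u v) \<le> (1 + \<epsilon>) * real (card (pverts G)) * p ^ 2)"

text \<open>
  The library predicate \<^const>\<open>Digraph_Component.tree\<close> is not usable for symmetric digraphs:
  there \<open>u, v, u\<close> counts as a cycle, so it fails for every graph with an edge. Cycles of length
  at least 3 in a \<^locale>\<open>pair_graph\<close> are exactly the cycles of the undirected graph.
  The qualified name below is graph connectedness, not the topological notion of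
  \<^theory>\<open>Complex_Main\<close>.
\<close>

definition undirected_tree :: "'a pair_pre_digraph \<Rightarrow> bool" where
  "undirected_tree T \<longleftrightarrow> pair_graph T \<and> Digraph_Component.connected (with_proj T) \<and>
     \<not> (\<exists>c. pre_digraph.cycle (with_proj T) c \<and> 3 \<le> length c)"

text \<open>The cardinality clause says that \<open>F\<close> has \<open>n / t\<close> members.\<close>

definition graph_factor ::
    "'b pair_pre_digraph \<Rightarrow> 'a pair_pre_digraph \<Rightarrow> 'a pair_pre_digraph set \<Rightarrow> bool" where
  "graph_factor H G F \<longleftrightarrow>
     (\<forall>K \<in> F. pair_graph K \<and> subgraph (with_proj K) (with_proj G) \<and>
              digraph_iso (with_proj H) (with_proj K)) \<and>
     (\<forall>K \<in> F. \<forall>L \<in> F. K \<noteq> L \<longrightarrow> pverts K \<inter> pverts L = {}) \<and>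
     card F * card (pverts H) = card (pverts G)"

definition factor_edges :: "'a pair_pre_digraph set \<Rightarrow> 'a set set" where
  "factor_edges F = (\<Union>K \<in> F. edges K)"

end

theory Submission
  imports Defs "HOL-Probability.Probability" "HOL-Number_Theory.Cong"
begin

text \<open>
  Divide the vertices into blocks of \<open>t\<close> vertices and label every block with \<open>0, \<dots>, t - 1\<close>, up
  to a random cyclic shift; this makes all \<open>t\<close> label classes equally large. Take about
  \<open>log n / \<epsilon>\<^sup>2\<close> independent such labellings. Identifying labels with vertices of \<open>T\<close>, every pair of
  vertices from different blocks is placed on an edge of \<open>T\<close> by roughly the same number of
  labellings, and each edge of \<open>G\<close> picks one of these labellings at random. By Chernoff bounds, for
  every labelling and every edge of \<open>T\<close> the edges of \<open>G\<close> kept between the two classes form a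
  bipartite graph whose degrees and co-degrees are those of a random graph of density \<open>q\<close>.

  Such a bipartite graph contains a \<open>k\<close>-factor for \<open>k\<close> almost as large as \<open>mq\<close>, with \<open>m\<close> the class
  size: by Hall's theorem it suffices that \<open>e(X, Y) \<ge> k(|X| + |Y| - m)\<close>, which follows from the
  Cauchy--Schwarz inequality and the co-degree bound. A \<open>k\<close>-factor splits into \<open>k\<close> perfect
  matchings, and one perfect matching for each edge of \<open>T\<close> makes a \<open>T\<close>-factor since \<open>T\<close> is a tree.
\<close>

section \<open>Chernoff bounds\<close>

text \<open>The classes must have exactly equal size because every labelling has to yield perfect
  matchings. Shifting whole blocks achieves this and keeps enough independence: a label occurs once
  in each block, so its count in any set is a sum of independent indicators, one per block. The
  price is the pairs inside a block, fewer than \<open>t\<close> per vertex, which are given up. One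
  labelling reaches only a proportion \<open>\<rho> / r\<close> of the edges, hence many labellings.
  A pair lies on a tree edge in about \<open>\<rho>\<close> of them, and \<open>\<rho>\<close> of
  order \<open>log n / \<epsilon>^2\<close> gives relative error \<open>\<epsilon>\<close> at all
  pairs simultaneously. Then \<open>q = p / \<rho>\<close>, and the co-degrees, of order
  \<open>n q^2\<close>, must exceed \<open>log n / \<epsilon>^2\<close>; this is where
  \<open>\<epsilon>^6\<close> and \<open>log^3 n\<close> come from. The matchings lose a proportion
  of order \<open>sqrt \<epsilon>\<close>, the root being due to Cauchy--Schwarz. Regularity bounds
  degrees only from below, so the number of edges of \<open>G\<close> must also be bounded from
  above, again by Cauchy--Schwarz and the co-degrees.\<close>

lemma expectation_prod_one_plus:
  fixes P :: "'a pmf" and A :: "'w \<Rightarrow> 'a set" and c :: real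
  assumes "finite (set_pmf P)" "finite W"
    and indep: "\<And>U. U \<subseteq> W \<Longrightarrow> measure_pmf.prob P (\<Inter>w\<in>U. A w) = (\<Prod>w\<in>U. q w)"
  shows "measure_pmf.expectation P (\<lambda>x. \<Prod>w\<in>W. 1 + c * indicator (A w) x) = (\<Prod>w\<in>W. 1 + c * q w)"
proof -
  have int: "integrable (measure_pmf P) f" for f :: "'a \<Rightarrow> real"
    using assms(1) by (rule integrable_measure_pmf_finite)
  have ind: "(\<Prod>w\<in>U. indicator (A w) x) = (indicator (\<Inter>w\<in>U. A w) x :: real)" if "finite U" for U x
    using that by (induction U) (auto simp: indicator_def)
  \<comment> \<open>Expanding over subsets \<open>U\<close> of \<open>W\<close> turns every term
    into the indicator of an intersection, so the product rule \<open>indep\<close> for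
    intersections is all the independence that enters.\<close>
  have expand: "(\<Prod>w\<in>W. 1 + c * f w) = (\<Sum>U\<in>Pow W. c ^ card U * (\<Prod>w\<in>U. f w))" for f :: "'w \<Rightarrow> real"
  proof -
    have "(\<Prod>w\<in>W. 1 + c * f w) = (\<Prod>w\<in>W. c * f w + 1)" by (simp add: add.commute)
    also have "\<dots> = (\<Sum>U\<in>Pow W. (\<Prod>w\<in>U. c * f w) * (\<Prod>w\<in>W - U. 1))"
      by (rule prod_add[OF \<open>finite W\<close>])
    finally show ?thesis by (simp add: prod.distrib)
  qed
  have "measure_pmf.expectation P (\<lambda>x. \<Prod>w\<in>W. 1 + c * indicator (A w) x)
      = (\<Sum>U\<in>Pow W. measure_pmf.expectation P (\<lambda>x. c ^ card U * indicator (\<Inter>w\<in>U. A w) x))"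
  proof -
    have "(\<Prod>w\<in>W. 1 + c * indicator (A w) x) = (\<Sum>U\<in>Pow W. c ^ card U * indicator (\<Inter>w\<in>U. A w) x)" for x
      unfolding expand using finite_subset[OF _ \<open>finite W\<close>] by (intro sum.cong) (auto simp: ind)
    then show ?thesis
      by (simp add: Bochner_Integration.integral_sum[OF int] del: integral_mult_right_zero)
  qed
  also have "\<dots> = (\<Sum>U\<in>Pow W. c ^ card U * (\<Prod>w\<in>U. q w))"
    by (intro sum.cong) (auto simp: indep)
  finally show ?thesis by (simp add: expand)
qed

text \<open>A second-order bound for both signs of \<open>x\<close>, so that one moment estimate
  serves both tails. For negative \<open>x\<close>, \<open>exp x \<le> 1 / (1 - x)\<close> is
  compared with the quadratic through
  \<open>(1 + x + x^2) (1 - x) = 1 - x^3 \<ge> 1\<close>.\<close>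

lemma exp_minus_one_le:
  fixes x :: real
  assumes "\<bar>x\<bar> \<le> 1"
  shows "exp x - 1 \<le> x + x\<^sup>2"
proof (cases "x \<ge> 0")
  case True
  then show ?thesis using exp_bound[of x] assms by auto
next
  case False
  have "exp (- x) \<ge> 1 - x" using exp_ge_add_one_self[of "-x"] by simp
  then have "exp x \<le> 1 / (1 - x)"
    using False by (simp add: exp_minus field_simps)
  also have "\<dots> \<le> 1 + x + x\<^sup>2"
  proof -
    have "(1 + x + x\<^sup>2) * (1 - x) = 1 - x ^ 3" by (simp add: algebra_simps power2_eq_square power3_eq_cube)
    moreover have "x ^ 3 \<le> 0" using False by (simp add: power_le_zero_eq)
    ultimately show ?thesis using False by (simp add: divide_le_eq)
  qed
  finally show ?thesis by simp
qed

text \<open>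
  Both Chernoff bounds below follow by Markov's inequality, with \<open>x = \<delta>/2\<close> and \<open>x = -\<delta>/2\<close>.
\<close>

lemma expectation_exp_count_le:
  fixes P :: "'a pmf" and A :: "'w \<Rightarrow> 'a set" and x :: real
  assumes "finite (set_pmf P)" "finite W"
    and indep: "\<And>U. U \<subseteq> W \<Longrightarrow> measure_pmf.prob P (\<Inter>w\<in>U. A w) = (\<Prod>w\<in>U. q w)"
    and q: "\<And>w. w \<in> W \<Longrightarrow> 0 \<le> q w \<and> q w \<le> 1"
  shows "measure_pmf.expectation P (\<lambda>\<omega>. exp (x * real (card {w \<in> W. \<omega> \<in> A w})))
    \<le> exp ((exp x - 1) * sum q W)"
proof -
  have *: "exp (x * real (card {w \<in> W. \<omega> \<in> A w})) = (\<Prod>w\<in>W. 1 + (exp x - 1) * indicator (A w) \<omega>)" for \<omega>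
  proof -
    have "x * real (card {w \<in> W. \<omega> \<in> A w}) = (\<Sum>w\<in>W. if \<omega> \<in> A w then x else 0)"
      using \<open>finite W\<close> by (subst sum.inter_filter[symmetric]) auto
    also have "exp \<dots> = (\<Prod>w\<in>W. exp (if \<omega> \<in> A w then x else 0))"
      by (rule exp_sum[OF \<open>finite W\<close>])
    also have "\<dots> = (\<Prod>w\<in>W. 1 + (exp x - 1) * indicator (A w) \<omega>)"
      by (intro prod.cong) auto
    finally show ?thesis .
  qed
  have "measure_pmf.expectation P (\<lambda>\<omega>. exp (x * real (card {w \<in> W. \<omega> \<in> A w})))
    = (\<Prod>w\<in>W. 1 + (exp x - 1) * q w)"
    unfolding * by (rule expectation_prod_one_plus[OF assms(1-3)])
  also have "\<dots> \<le> (\<Prod>w\<in>W. exp ((exp x - 1) * q w))"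
  proof (intro prod_mono conjI)
    fix w assume w: "w \<in> W"
    have "0 \<le> (1 - q w) + exp x * q w" using q[OF w] by simp
    then show "0 \<le> 1 + (exp x - 1) * q w" by (simp add: algebra_simps)
  qed (use exp_ge_add_one_self in auto)
  also have "\<dots> = exp ((exp x - 1) * sum q W)"
    by (simp add: exp_sum[OF \<open>finite W\<close>] sum_distrib_left)
  finally show ?thesis .
qed

lemma chernoff_upper:
  fixes P :: "'a pmf" and A :: "'w \<Rightarrow> 'a set" and \<delta> M :: real
  assumes "finite (set_pmf P)" "finite W"
    and indep: "\<And>U. U \<subseteq> W \<Longrightarrow> measure_pmf.prob P (\<Inter>w\<in>U. A w) = (\<Prod>w\<in>U. q w)"
    and q: "\<And>w. w \<in> W \<Longrightarrow> 0 \<le> q w \<and> q w \<le> 1"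
    and \<delta>: "0 < \<delta>" "\<delta> \<le> 1" and M: "sum q W \<le> M"
  shows "measure_pmf.prob P {\<omega>. real (card {w \<in> W. \<omega> \<in> A w}) > (1 + \<delta>) * M} \<le> exp (- (\<delta>\<^sup>2 * M / 4))"
proof -
  define X where "X \<omega> = real (card {w \<in> W. \<omega> \<in> A w})" for \<omega>
  have M0: "0 \<le> M" using M q by (meson order_trans sum_nonneg)
  have "measure_pmf.prob P {\<omega>. X \<omega> > (1 + \<delta>) * M}
      \<le> measure_pmf.prob P {\<omega> \<in> space (measure_pmf P). exp (\<delta>/2 * X \<omega>) \<ge> exp (\<delta>/2 * ((1 + \<delta>) * M))}"
    using \<delta> by (intro measure_pmf.finite_measure_mono) (auto simp: less_imp_le)
  also have "\<dots> \<le> measure_pmf.expectation P (\<lambda>\<omega>. exp (\<delta>/2 * X \<omega>)) / exp (\<delta>/2 * ((1 + \<delta>) * M))"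
    by (intro integral_Markov_inequality_measure[where A="{}"])
       (auto intro: integrable_measure_pmf_finite assms(1))
  also have "\<dots> \<le> exp ((exp (\<delta>/2) - 1) * sum q W) / exp (\<delta>/2 * ((1 + \<delta>) * M))"
    unfolding X_def by (intro divide_right_mono expectation_exp_count_le[OF assms(1-4)]) auto
  also have "\<dots> = exp ((exp (\<delta>/2) - 1) * sum q W - \<delta>/2 * ((1 + \<delta>) * M))"
    by (simp add: exp_diff)
  \<comment> \<open>The factor \<open>exp (\<delta>/2) - 1\<close> is positive, so the upper bound
    \<open>M\<close> may replace the mean.\<close>
  also have "\<dots> \<le> exp ((\<delta>/2 + (\<delta>/2)\<^sup>2) * M - \<delta>/2 * ((1 + \<delta>) * M))"
    using exp_minus_one_le[of "\<delta>/2"] \<delta> M M0 q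
    by (auto intro!: mult_mono sum_nonneg)
  also have "(\<delta>/2 + (\<delta>/2)\<^sup>2) * M - \<delta>/2 * ((1 + \<delta>) * M) = - (\<delta>\<^sup>2 * M / 4)"
    by (simp add: field_simps power2_eq_square)
  finally show ?thesis unfolding X_def .
qed

lemma chernoff_lower:
  fixes P :: "'a pmf" and A :: "'w \<Rightarrow> 'a set" and \<delta> M :: real
  assumes "finite (set_pmf P)" "finite W"
    and indep: "\<And>U. U \<subseteq> W \<Longrightarrow> measure_pmf.prob P (\<Inter>w\<in>U. A w) = (\<Prod>w\<in>U. q w)"
    and q: "\<And>w. w \<in> W \<Longrightarrow> 0 \<le> q w \<and> q w \<le> 1"
    and \<delta>: "0 < \<delta>" "\<delta> \<le> 1" and M: "0 \<le> M" "M \<le> sum q W"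
  shows "measure_pmf.prob P {\<omega>. real (card {w \<in> W. \<omega> \<in> A w}) < (1 - \<delta>) * M} \<le> exp (- (\<delta>\<^sup>2 * M / 4))"
proof -
  define X where "X \<omega> = real (card {w \<in> W. \<omega> \<in> A w})" for \<omega>
  have "measure_pmf.prob P {\<omega>. X \<omega> < (1 - \<delta>) * M}
      \<le> measure_pmf.prob P {\<omega> \<in> space (measure_pmf P). exp (-\<delta>/2 * X \<omega>) \<ge> exp (-\<delta>/2 * ((1 - \<delta>) * M))}"
    using \<delta> by (intro measure_pmf.finite_measure_mono) (auto simp: less_imp_le)
  also have "\<dots> \<le> measure_pmf.expectation P (\<lambda>\<omega>. exp (-\<delta>/2 * X \<omega>)) / exp (-\<delta>/2 * ((1 - \<delta>) * M))"
    by (intro integral_Markov_inequality_measure[where A="{}"])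
       (auto intro: integrable_measure_pmf_finite assms(1))
  also have "\<dots> \<le> exp ((exp (-\<delta>/2) - 1) * sum q W) / exp (-\<delta>/2 * ((1 - \<delta>) * M))"
    unfolding X_def by (intro divide_right_mono expectation_exp_count_le[OF assms(1-4)]) auto
  also have "\<dots> = exp ((exp (-\<delta>/2) - 1) * sum q W + \<delta>/2 * ((1 - \<delta>) * M))"
    by (simp add: exp_diff[symmetric])
  also have "\<dots> \<le> exp ((-\<delta>/2 + (\<delta>/2)\<^sup>2) * M + \<delta>/2 * ((1 - \<delta>) * M))"
  proof -
    \<comment> \<open>Here the factor is negative, so a lower bound \<open>M\<close> on the mean
      gives an upper bound on the product.\<close>
    have "(exp (-\<delta>/2) - 1) * sum q W \<le> (exp (-\<delta>/2) - 1) * M"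
      using \<delta> M by (intro mult_left_mono_neg) auto
    also have "\<dots> \<le> (-\<delta>/2 + (\<delta>/2)\<^sup>2) * M"
      using exp_minus_one_le[of "-\<delta>/2"] \<delta> M by (intro mult_right_mono) (auto simp: power2_eq_square)
    finally show ?thesis by simp
  qed
  also have "(-\<delta>/2 + (\<delta>/2)\<^sup>2) * M + \<delta>/2 * ((1 - \<delta>) * M) = - (\<delta>\<^sup>2 * M / 4)"
    by (simp add: field_simps power2_eq_square)
  finally show ?thesis unfolding X_def .
qed

section \<open>Random labellings and random assignments\<close>

lemma prob_Pi_pmf_on_subset:
  assumes "finite I" "U \<subseteq> I"
  shows "measure_pmf.prob (Pi_pmf I d p) {\<omega>. \<forall>i\<in>U. \<omega> i \<in> B i} = (\<Prod>i\<in>U. measure_pmf.prob (p i) (B i))"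
proof -
  define B' where "B' i = (if i \<in> U then B i else UNIV)" for i
  have "{\<omega>. \<forall>i\<in>U. \<omega> i \<in> B i} = Pi I B'"
    using assms(2) by (auto simp: B'_def Pi_def)
  then have "measure_pmf.prob (Pi_pmf I d p) {\<omega>. \<forall>i\<in>U. \<omega> i \<in> B i} = (\<Prod>i\<in>I. measure_pmf.prob (p i) (B' i))"
    by (simp add: measure_Pi_pmf_Pi assms(1))
  also have "\<dots> = (\<Prod>i\<in>U. measure_pmf.prob (p i) (B i))"
    using assms by (intro prod.mono_neutral_cong_right) (auto simp: B'_def)
  finally show ?thesis .
qed

lemma finite_set_Pi_pmf:
  assumes "finite I" "\<And>i. i \<in> I \<Longrightarrow> finite (set_pmf (p i))"
  shows "finite (set_pmf (Pi_pmf I d p))"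
  using assms by (auto simp: set_Pi_pmf)

text \<open>The union bound. The outcome is taken from the support, since a random assignment must
  also respect its sets of admissible values.\<close>

lemma avoid_bad_events:
  fixes P :: "'a pmf"
  assumes "finite J" "\<And>B. B \<in> J \<Longrightarrow> measure_pmf.prob P B \<le> b" "real (card J) * b < 1"
  shows "\<exists>\<omega>\<in>set_pmf P. \<forall>B\<in>J. \<omega> \<notin> B"
proof (rule ccontr)
  assume no: "\<not> ?thesis"
  have "1 = measure_pmf.prob P (\<Union>J)"
    by (rule sym, subst measure_pmf.prob_eq_1) (use no in \<open>auto simp: AE_measure_pmf_iff\<close>)
  also have "\<dots> \<le> (\<Sum>B\<in>J. measure_pmf.prob P B)"
    using measure_pmf.finite_measure_subadditive_finite[of J "\<lambda>B. B" P] assms(1) by simp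
  also have "\<dots> \<le> real (card J) * b" using assms(2) by (intro sum_bounded_above)
  finally show False using assms(3) by simp
qed

lemma shift_mod_iff:
  fixes x y i t :: nat
  assumes "x < t" "y < t" "i < t"
  shows "(x + y) mod t = i \<longleftrightarrow> y = (i + t - x) mod t"
  using assms by (cases "x + y < t"; cases "x \<le> i") (auto simp: mod_if)

text \<open>\<open>fst (\<beta> v)\<close> is the block of \<open>v\<close> and
  \<open>snd (\<beta> v)\<close> its label before shifting; there are \<open>m\<close> blocks of
  \<open>t\<close> vertices.\<close>

locale block_shifts =
  fixes V :: "'a set" and \<beta> :: "'a \<Rightarrow> nat \<times> nat" and m t :: nat
  assumes bij_\<beta>: "bij_betw \<beta> V ({..<m} \<times> {..<t})" and t_pos: "0 < t"
begin

definition label :: "(nat \<Rightarrow> nat) \<Rightarrow> 'a \<Rightarrow> nat" where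
  "label a v = (snd (\<beta> v) + a (fst (\<beta> v))) mod t"

definition shifts :: "(nat \<Rightarrow> nat) pmf" where
  "shifts = Pi_pmf {..<m} 0 (\<lambda>_. pmf_of_set {..<t})"

lemma label_less: "label a v < t"
  using t_pos by (simp add: label_def)

lemma \<beta>_in: "v \<in> V \<Longrightarrow> fst (\<beta> v) < m" "v \<in> V \<Longrightarrow> snd (\<beta> v) < t"
  using bij_betwE[OF bij_\<beta>] by (auto simp: mem_Times_iff)

lemma finite_V: "finite V"
  using bij_betw_finite[OF bij_\<beta>] by simp

lemma finite_shifts: "finite (set_pmf shifts)"
  unfolding shifts_def using t_pos by (intro finite_set_Pi_pmf) (auto simp: lessThan_empty_iff)

lemma label_eq_imp_eq:
  assumes "v \<in> V" "w \<in> V" "fst (\<beta> v) = fst (\<beta> w)" "label a v = label a w"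
  shows "v = w"
proof -
  have "[snd (\<beta> v) + a (fst (\<beta> w)) = snd (\<beta> w) + a (fst (\<beta> w))] (mod t)"
    using assms by (simp add: label_def cong_def)
  then have "[snd (\<beta> v) = snd (\<beta> w)] (mod t)" by (simp only: cong_add_rcancel_nat)
  then have "\<beta> v = \<beta> w" using assms \<beta>_in by (intro prod_eqI) (auto simp: cong_def)
  then show ?thesis using bij_\<beta> assms by (auto simp: bij_betw_def inj_on_def)
qed

text \<open>A label occurs at most once in a block, so vertices may be counted by their blocks. The
  right side counts events each depending on the shift of one block only; these are independent,
  which the labels of single vertices are not.\<close>

lemma count_label:
  assumes "W \<subseteq> V"
  shows "card {w \<in> W. label a w = i}
    = card {c \<in> {..<m}. \<exists>w\<in>W. fst (\<beta> w) = c \<and> (snd (\<beta> w) + a c) mod t = i}"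
proof (rule bij_betw_same_card[of "\<lambda>w. fst (\<beta> w)"], unfold bij_betw_def, intro conjI)
  show "inj_on (\<lambda>w. fst (\<beta> w)) {w \<in> W. label a w = i}"
    using assms by (intro inj_onI label_eq_imp_eq[of _ _ a]) auto
  show "(\<lambda>w. fst (\<beta> w)) ` {w \<in> W. label a w = i}
    = {c \<in> {..<m}. \<exists>w\<in>W. fst (\<beta> w) = c \<and> (snd (\<beta> w) + a c) mod t = i}"
    using assms \<beta>_in by (auto simp: label_def)
qed

lemma card_label_class:
  assumes "i < t"
  shows "card {v \<in> V. label a v = i} = m"
proof -
  have "\<exists>w\<in>V. fst (\<beta> w) = c \<and> (snd (\<beta> w) + a c) mod t = i" if c: "c < m" for c
  proof -
    \<comment> \<open>The position that the shift \<open>a c\<close> carries to label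
      \<open>i\<close>.\<close>
    define x where "x = (i + t - a c mod t) mod t"
    have x: "x < t" using t_pos by (simp add: x_def)
    have "(a c mod t + x) mod t = i"
      using shift_mod_iff[of "a c mod t" t x i] x t_pos assms by (simp add: x_def)
    then have "(x + a c) mod t = i" by (simp add: mod_simps add.commute)
    moreover obtain w where "w \<in> V" "\<beta> w = (c, x)"
      using bij_\<beta> c x by (auto simp: bij_betw_def image_iff set_eq_iff) metis
    ultimately show ?thesis by force
  qed
  then have "{c \<in> {..<m}. \<exists>w\<in>V. fst (\<beta> w) = c \<and> (snd (\<beta> w) + a c) mod t = i} = {..<m}" by auto
  then show ?thesis by (simp add: count_label)
qed

text \<open>Each vertex of \<open>W\<close> in block \<open>c\<close> is sent to \<open>i\<close> by
  exactly one shift, and different vertices need different shifts.\<close>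

lemma prob_shift_in_block:
  assumes "W \<subseteq> V" "i < t"
  shows "measure_pmf.prob (pmf_of_set {..<t}) {y. \<exists>w\<in>W. fst (\<beta> w) = c \<and> (snd (\<beta> w) + y) mod t = i}
    = real (card {w \<in> W. fst (\<beta> w) = c}) / real t"
proof -
  let ?Q = "{y. \<exists>w\<in>W. fst (\<beta> w) = c \<and> (snd (\<beta> w) + y) mod t = i}"
  have 1: "{..<t} \<inter> ?Q = (\<lambda>w. (i + t - snd (\<beta> w)) mod t) ` {w \<in> W. fst (\<beta> w) = c}"
  proof -
    have "(snd (\<beta> w) + y) mod t = i \<longleftrightarrow> y = (i + t - snd (\<beta> w)) mod t" if "w \<in> W" "y < t" for w y
      using that assms \<beta>_in by (intro shift_mod_iff) auto
    then show ?thesis using t_pos by auto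
  qed
  have "inj_on (\<lambda>w. (i + t - snd (\<beta> w)) mod t) {w \<in> W. fst (\<beta> w) = c}"
  proof (rule inj_onI)
    fix v w assume vw: "v \<in> {w \<in> W. fst (\<beta> w) = c}" "w \<in> {w \<in> W. fst (\<beta> w) = c}"
      and eq: "(i + t - snd (\<beta> v)) mod t = (i + t - snd (\<beta> w)) mod t"
    \<comment> \<open>If two vertices needed the same shift, applying it to every block would give
      both the label \<open>i\<close>, against injectivity of labels within a block.\<close>
    have lab: "label (\<lambda>_. (i + t - snd (\<beta> u)) mod t) u = i" if "u \<in> V" for u
      unfolding label_def using that assms \<beta>_in t_pos by (subst shift_mod_iff) auto
    have V: "v \<in> V" "w \<in> V" using vw assms by auto
    then have "label (\<lambda>_. (i + t - snd (\<beta> v)) mod t) v = label (\<lambda>_. (i + t - snd (\<beta> v)) mod t) w"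
      using lab[OF V(1)] lab[OF V(2)] eq by simp
    then show "v = w" using V vw by (intro label_eq_imp_eq) auto
  qed
  then have "card ({..<t} \<inter> ?Q) = card {w \<in> W. fst (\<beta> w) = c}"
    by (simp add: 1 card_image)
  then show ?thesis using t_pos by (subst measure_pmf_of_set) (auto simp: lessThan_empty_iff)
qed

lemma prob_block_events:
  assumes "U \<subseteq> {..<m}" "W \<subseteq> V" "i < t"
  shows "measure_pmf.prob shifts
      (\<Inter>c\<in>U. {a. \<exists>w\<in>W. fst (\<beta> w) = c \<and> (snd (\<beta> w) + a c) mod t = i})
    = (\<Prod>c\<in>U. real (card {w \<in> W. fst (\<beta> w) = c}) / real t)"
proof -
  have "(\<Inter>c\<in>U. {a. \<exists>w\<in>W. fst (\<beta> w) = c \<and> (snd (\<beta> w) + a c) mod t = i})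
    = {a. \<forall>c\<in>U. a c \<in> {y. \<exists>w\<in>W. fst (\<beta> w) = c \<and> (snd (\<beta> w) + y) mod t = i}}" by auto
  then show ?thesis
    unfolding shifts_def using assms by (simp only: prob_Pi_pmf_on_subset[OF finite_lessThan assms(1)] prob_shift_in_block)
qed

lemma sum_block_cards:
  assumes "W \<subseteq> V"
  shows "(\<Sum>c<m. real (card {w \<in> W. fst (\<beta> w) = c}) / real t) = real (card W) / real t"
proof -
  have "(\<Sum>c<m. card {w \<in> W. fst (\<beta> w) = c}) = card (\<Union>c<m. {w \<in> W. fst (\<beta> w) = c})"
    using finite_subset[OF assms finite_V] by (intro card_UN_disjoint[symmetric]) auto
  also have "(\<Union>c<m. {w \<in> W. fst (\<beta> w) = c}) = W" using assms \<beta>_in by auto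
  finally show ?thesis by (simp add: sum_divide_distrib[symmetric] flip: of_nat_sum)
qed

text \<open>The quotient is a probability by \<open>prob_shift_in_block\<close>, here for label
  \<open>0\<close>.\<close>

lemma block_card_le:
  assumes "W \<subseteq> V"
  shows "real (card {w \<in> W. fst (\<beta> w) = c}) / real t \<le> 1"
  using prob_shift_in_block[OF assms t_pos, of c, symmetric] by simp

lemma prob_label_count_high:
  assumes "W \<subseteq> V" "i < t" "0 < \<delta>" "\<delta> \<le> 1" "real (card W) \<le> real t * M"
  shows "measure_pmf.prob shifts {a. (1 + \<delta>) * M < real (card {w \<in> W. label a w = i})} \<le> exp (- (\<delta>\<^sup>2 * M / 4))"
proof -
  have "(\<Sum>c<m. real (card {w \<in> W. fst (\<beta> w) = c}) / real t) \<le> M"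
    using assms(5) t_pos by (simp add: sum_block_cards[OF assms(1)] divide_le_eq mult.commute)
  from chernoff_upper[OF finite_shifts finite_lessThan prob_block_events[OF _ assms(1,2)] _ assms(3,4) this]
  show ?thesis using block_card_le[OF assms(1)] by (simp add: count_label[OF assms(1)])
qed

lemma prob_label_count_low:
  assumes "W \<subseteq> V" "i < t" "0 < \<delta>" "\<delta> \<le> 1" "0 \<le> M" "real t * M \<le> real (card W)"
  shows "measure_pmf.prob shifts {a. real (card {w \<in> W. label a w = i}) < (1 - \<delta>) * M} \<le> exp (- (\<delta>\<^sup>2 * M / 4))"
proof -
  have "M \<le> (\<Sum>c<m. real (card {w \<in> W. fst (\<beta> w) = c}) / real t)"
    using assms(6) t_pos by (simp add: sum_block_cards[OF assms(1)] le_divide_eq mult.commute)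
  from chernoff_lower[OF finite_shifts finite_lessThan prob_block_events[OF _ assms(1,2)] _ assms(3-5) this]
  show ?thesis using block_card_le[OF assms(1)] by (simp add: count_label[OF assms(1)])
qed

text \<open>Different blocks have independent shifts, so the pair of labels is uniform on all
  \<open>t^2\<close> pairs. Within one block the two labels keep a fixed difference, hence the
  assumption \<open>ne\<close>. Later \<open>R\<close> is the arc set of the tree.\<close>

lemma prob_two_labels:
  assumes u: "u \<in> V" and v: "v \<in> V" and ne: "fst (\<beta> u) \<noteq> fst (\<beta> v)" and R: "R \<subseteq> {..<t} \<times> {..<t}"
  shows "measure_pmf.prob shifts {a. (label a u, label a v) \<in> R} = real (card R) / (real t)\<^sup>2"
proof -
  have fin: "finite R" using R finite_subset by blast
  have one: "measure_pmf.prob (pmf_of_set {..<t}) {y. (snd (\<beta> w) + y) mod t = i} = 1 / real t"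
    if "w \<in> V" "i < t" for w i
  proof -
    have "{x \<in> {w}. fst (\<beta> x) = fst (\<beta> w)} = {w}" by auto
    then show ?thesis
      using prob_shift_in_block[of "{w}" i "fst (\<beta> w)"] that by (simp del: singleton_iff)
  qed
  have ij: "measure_pmf.prob shifts {a. (label a u, label a v) = z} = 1 / (real t)\<^sup>2" if z: "z \<in> R" for z
  proof -
    define Q where "Q c = (if c = fst (\<beta> u) then {y. (snd (\<beta> u) + y) mod t = fst z}
      else {y. (snd (\<beta> v) + y) mod t = snd z})" for c
    have "{a. (label a u, label a v) = z} = {a. \<forall>c\<in>{fst (\<beta> u), fst (\<beta> v)}. a c \<in> Q c}"
      using ne by (auto simp: label_def Q_def prod_eq_iff)
    then have "measure_pmf.prob shifts {a. (label a u, label a v) = z}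
        = (\<Prod>c\<in>{fst (\<beta> u), fst (\<beta> v)}. measure_pmf.prob (pmf_of_set {..<t}) (Q c))"
      unfolding shifts_def using \<beta>_in u v by (simp only:) (rule prob_Pi_pmf_on_subset, auto)
    also have "\<dots> = 1 / (real t)\<^sup>2"
      using ne z R u v by (auto simp: Q_def one power2_eq_square)
    finally show ?thesis .
  qed
  have "{a. (label a u, label a v) \<in> R} = (\<Union>z\<in>R. {a. (label a u, label a v) = z})" by auto
  then have "measure_pmf.prob shifts {a. (label a u, label a v) \<in> R}
      = (\<Sum>z\<in>R. measure_pmf.prob shifts {a. (label a u, label a v) = z})"
    using fin by (simp only:) (rule measure_pmf.finite_measure_finite_Union, auto simp: disjoint_family_on_def)
  then show ?thesis by (simp add: ij)
qed

text \<open>Later \<open>D1\<close> consists of neighbourhoods and \<open>D2\<close> of common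
  neighbourhoods. Concentration is used in two directions: over the blocks of one labelling for
  label counts, and over the \<open>r\<close> independent labellings for the number of times that a
  pair lands in \<open>R\<close>.\<close>

lemma random_labellings:
  fixes D1 D2 :: "'a set set" and R :: "(nat \<times> nat) set" and M1 M2 \<delta> b \<rho> :: real
  assumes R: "R \<subseteq> {..<t} \<times> {..<t}" and \<delta>: "0 < \<delta>" "\<delta> \<le> 1"
    and D1: "finite D1" "\<And>W. W \<in> D1 \<Longrightarrow> W \<subseteq> V" "\<And>W. W \<in> D1 \<Longrightarrow> real t * M1 \<le> real (card W)"
    and D2: "finite D2" "\<And>W. W \<in> D2 \<Longrightarrow> W \<subseteq> V" "\<And>W. W \<in> D2 \<Longrightarrow> real (card W) \<le> real t * M2"
    and \<rho>: "\<rho> = real r * real (card R) / (real t)\<^sup>2" and M1: "0 \<le> M1"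
    and b: "exp (- (\<delta>\<^sup>2 * M1 / 4)) \<le> b" "exp (- (\<delta>\<^sup>2 * M2 / 4)) \<le> b" "exp (- (\<delta>\<^sup>2 * \<rho> / 4)) \<le> b"
    and small: "(real r * real t * (real (card D1) + real (card D2)) + 2 * (real (card V))\<^sup>2) * b < 1"
  shows "\<exists>lab :: nat \<Rightarrow> 'a \<Rightarrow> nat.
     (\<forall>s v. lab s v < t) \<and> (\<forall>s. \<forall>i<t. card {v\<in>V. lab s v = i} = m) \<and>
     (\<forall>s<r. \<forall>i<t. \<forall>W\<in>D1. (1 - \<delta>) * M1 \<le> real (card {w\<in>W. lab s w = i})) \<and>
     (\<forall>s<r. \<forall>i<t. \<forall>W\<in>D2. real (card {w\<in>W. lab s w = i}) \<le> (1 + \<delta>) * M2) \<and>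
     (\<forall>u\<in>V. \<forall>v\<in>V. fst (\<beta> u) \<noteq> fst (\<beta> v) \<longrightarrow>
        (1 - \<delta>) * \<rho> \<le> real (card {s\<in>{..<r}. (lab s u, lab s v) \<in> R}) \<and>
        real (card {s\<in>{..<r}. (lab s u, lab s v) \<in> R}) \<le> (1 + \<delta>) * \<rho>)"
proof -
  define P where "P = Pi_pmf {..<r} (\<lambda>_. 0 :: nat) (\<lambda>_. shifts)"
  have finP: "finite (set_pmf P)" unfolding P_def by (intro finite_set_Pi_pmf finite_shifts finite_lessThan)
  define B1 where "B1 = (\<lambda>(s, i, W). {\<omega> :: nat \<Rightarrow> nat \<Rightarrow> nat. real (card {w\<in>W. label (\<omega> s) w = i}) < (1 - \<delta>) * M1})"
  define B2 where "B2 = (\<lambda>(s, i, W). {\<omega> :: nat \<Rightarrow> nat \<Rightarrow> nat. (1 + \<delta>) * M2 < real (card {w\<in>W. label (\<omega> s) w = i})})"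
  define X where "X u v \<omega> = card {s\<in>{..<r}. (label (\<omega> s) u, label (\<omega> s) v) \<in> R}" for u v and \<omega> :: "nat \<Rightarrow> nat \<Rightarrow> nat"
  define B3 where "B3 = (\<lambda>(u, v). {\<omega>. real (X u v \<omega>) < (1 - \<delta>) * \<rho>})"
  define B4 where "B4 = (\<lambda>(u, v). {\<omega>. (1 + \<delta>) * \<rho> < real (X u v \<omega>)})"
  define J1 where "J1 = B1 ` ({..<r} \<times> {..<t} \<times> D1)"
  define J2 where "J2 = B2 ` ({..<r} \<times> {..<t} \<times> D2)"
  define VV where "VV = {(u, v) \<in> V \<times> V. fst (\<beta> u) \<noteq> fst (\<beta> v)}"
  define J3 where "J3 = B3 ` VV"
  define J4 where "J4 = B4 ` VV"
  have finVV: "finite VV" using finite_V by (auto simp: VV_def intro: finite_subset[of _ "V \<times> V"])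
  have one: "measure_pmf.prob P {\<omega>. \<omega> s \<in> A} = measure_pmf.prob shifts A" if "s < r" for s A
    using prob_Pi_pmf_on_subset[of "{..<r}" "{s}" "\<lambda>_. 0" "\<lambda>_. shifts" "\<lambda>_. A"] that by (simp add: P_def)
  have indep: "measure_pmf.prob P (\<Inter>s\<in>U. {\<omega>. (label (\<omega> s) u, label (\<omega> s) v) \<in> R})
      = (\<Prod>s\<in>U. real (card R) / (real t)\<^sup>2)" if "U \<subseteq> {..<r}" "(u, v) \<in> VV" for U u v
  proof -
    have "(\<Inter>s\<in>U. {\<omega>. (label (\<omega> s) u, label (\<omega> s) v) \<in> R})
      = {\<omega>. \<forall>s\<in>U. \<omega> s \<in> {a. (label a u, label a v) \<in> R}}" by auto
    then show ?thesis
      unfolding P_def using that R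
      by (simp only: prob_Pi_pmf_on_subset[OF finite_lessThan that(1)]) (auto simp: prob_two_labels VV_def)
  qed
  have q: "real (card R) / (real t)\<^sup>2 \<le> 1"
  proof -
    have "card R \<le> t * t" using card_mono[OF _ R] by (simp add: card_cartesian_product)
    then have "real (card R) \<le> real t * real t" by (metis of_nat_le_iff of_nat_mult)
    then show ?thesis using t_pos by (simp add: power2_eq_square)
  qed
  have \<rho>_sum: "(\<Sum>s<r. real (card R) / (real t)\<^sup>2) = \<rho>" using \<rho> by simp
  have "\<exists>\<omega>\<in>set_pmf P. \<forall>B\<in>(J1 \<union> J2) \<union> (J3 \<union> J4). \<omega> \<notin> B"
  proof (rule avoid_bad_events[where b=b])
    show "finite ((J1 \<union> J2) \<union> (J3 \<union> J4))"
      using D1 D2 finVV by (simp add: J1_def J2_def J3_def J4_def)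
    show "measure_pmf.prob P B \<le> b" if "B \<in> (J1 \<union> J2) \<union> (J3 \<union> J4)" for B
    proof -
      from that consider (1) s i W where "s < r" "i < t" "W \<in> D1" "B = B1 (s, i, W)"
        | (2) s i W where "s < r" "i < t" "W \<in> D2" "B = B2 (s, i, W)"
        | (3) u v where "(u, v) \<in> VV" "B = B3 (u, v)" | (4) u v where "(u, v) \<in> VV" "B = B4 (u, v)"
        by (auto simp: J1_def J2_def J3_def J4_def)
      then show ?thesis
      proof cases
        case 1
        then show ?thesis
          using one[of s "{a. real (card {w\<in>W. label a w = i}) < (1 - \<delta>) * M1}"]
            prob_label_count_low[OF D1(2) _ \<delta> M1 D1(3), of W i] b(1) by (simp add: B1_def)
      next
        case 2
        then show ?thesis
          using one[of s "{a. (1 + \<delta>) * M2 < real (card {w\<in>W. label a w = i})}"]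
            prob_label_count_high[OF D2(2) _ \<delta> D2(3), of W i] b(2) by (simp add: B2_def)
      next
        case 3
        have "measure_pmf.prob P {\<omega>. real (card {s\<in>{..<r}. \<omega> \<in> {\<omega>. (label (\<omega> s) u, label (\<omega> s) v) \<in> R}}) < (1 - \<delta>) * \<rho>}
          \<le> exp (- (\<delta>\<^sup>2 * \<rho> / 4))"
          by (rule chernoff_lower[OF finP finite_lessThan indep _ \<delta>]) (use 3 q \<rho>_sum \<rho> in auto)
        then show ?thesis using 3 b(3) by (simp add: B3_def X_def)
      next
        case 4
        have "measure_pmf.prob P {\<omega>. (1 + \<delta>) * \<rho> < real (card {s\<in>{..<r}. \<omega> \<in> {\<omega>. (label (\<omega> s) u, label (\<omega> s) v) \<in> R}})}
          \<le> exp (- (\<delta>\<^sup>2 * \<rho> / 4))"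
          by (rule chernoff_upper[OF finP finite_lessThan indep _ \<delta>]) (use 4 q \<rho>_sum in auto)
        then show ?thesis using 4 b(3) by (simp add: B4_def X_def)
      qed
    qed
    have b0: "0 \<le> b" using b(1) exp_ge_zero order_trans by blast
    have c1: "card J1 \<le> r * (t * card D1)" "card J2 \<le> r * (t * card D2)"
      unfolding J1_def J2_def using D1(1) D2(1)
      by (auto intro!: order_trans[OF card_image_le] simp: card_cartesian_product)
    have "card VV \<le> card V * card V"
      unfolding card_cartesian_product[symmetric] using finite_V by (intro card_mono) (auto simp: VV_def)
    then have c2: "card J3 \<le> card V * card V" "card J4 \<le> card V * card V"
      unfolding J3_def J4_def using finVV card_image_le order_trans by blast+
    have "card ((J1 \<union> J2) \<union> (J3 \<union> J4)) \<le> (card J1 + card J2) + (card J3 + card J4)"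
      by (meson add_mono card_Un_le order_trans)
    also have "\<dots> \<le> (r * (t * card D1) + r * (t * card D2)) + (card V * card V + card V * card V)"
      by (intro add_mono c1 c2)
    finally have "real (card ((J1 \<union> J2) \<union> (J3 \<union> J4)))
        \<le> real ((r * (t * card D1) + r * (t * card D2)) + (card V * card V + card V * card V))"
      by (simp only: of_nat_le_iff)
    also have "\<dots> = real r * real t * (real (card D1) + real (card D2)) + 2 * (real (card V))\<^sup>2"
      by (simp add: algebra_simps power2_eq_square)
    finally show "real (card ((J1 \<union> J2) \<union> (J3 \<union> J4))) * b < 1"
      using small b0 by (meson mult_right_mono order_le_less_trans)
  qed
  then obtain \<omega> where \<omega>: "\<And>B. B \<in> J1 \<Longrightarrow> \<omega> \<notin> B" "\<And>B. B \<in> J2 \<Longrightarrow> \<omega> \<notin> B"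
    "\<And>B. B \<in> J3 \<Longrightarrow> \<omega> \<notin> B" "\<And>B. B \<in> J4 \<Longrightarrow> \<omega> \<notin> B" by blast
  show ?thesis
  proof (intro exI[of _ "\<lambda>s. label (\<omega> s)"] conjI allI impI ballI)
    show "label (\<omega> s) v < t" for s v by (rule label_less)
    show "card {v \<in> V. label (\<omega> s) v = i} = m" if "i < t" for s i using card_label_class that .
  next
    fix s i W assume "s < r" "i < t" "W \<in> D1"
    then show "(1 - \<delta>) * M1 \<le> real (card {w\<in>W. label (\<omega> s) w = i})"
      using \<omega>(1)[of "B1 (s, i, W)"] by (force simp: J1_def B1_def)
  next
    fix s i W assume "s < r" "i < t" "W \<in> D2"
    then show "real (card {w\<in>W. label (\<omega> s) w = i}) \<le> (1 + \<delta>) * M2"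
      using \<omega>(2)[of "B2 (s, i, W)"] by (force simp: J2_def B2_def)
  next
    fix u v assume uv: "u \<in> V" "v \<in> V" "fst (\<beta> u) \<noteq> fst (\<beta> v)"
    then have "(u, v) \<in> VV" by (simp add: VV_def)
    then show "(1 - \<delta>) * \<rho> \<le> real (card {s\<in>{..<r}. (label (\<omega> s) u, label (\<omega> s) v) \<in> R})"
      "real (card {s\<in>{..<r}. (label (\<omega> s) u, label (\<omega> s) v) \<in> R}) \<le> (1 + \<delta>) * \<rho>"
      using \<omega>(3)[of "B3 (u, v)"] \<omega>(4)[of "B4 (u, v)"] by (force simp: J3_def J4_def B3_def B4_def X_def)+
  qed
qed

end

text \<open>Every edge \<open>e\<close> picks an index from \<open>S e\<close> uniformly, so a given
  admissible index has probability between \<open>1 / hi\<close> and \<open>1 / lo\<close>.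
  \<open>L1\<close> will hold stars, whose counts must not be low, and \<open>L2\<close> cherries,
  given as pairs of edges whose counts must not be high. The condition that no edge lies in two
  pairs of the same \<open>F\<close> makes the events of these pairs independent.\<close>

lemma random_assignment:
  fixes I :: "'e set" and S :: "'e \<Rightarrow> nat set"
    and L1 :: "(nat \<times> 'e set) set" and L2 :: "(nat \<times> ('e \<times> 'e) set) set"
    and lo hi M1 M2 \<delta> b :: real
  assumes I: "finite I" "\<And>e. e \<in> I \<Longrightarrow> finite (S e)"
    and S: "\<And>e. e \<in> I \<Longrightarrow> lo \<le> real (card (S e))" "\<And>e. e \<in> I \<Longrightarrow> real (card (S e)) \<le> hi"
    and lo: "0 < lo" and hi: "0 < hi" and \<delta>: "0 < \<delta>" "\<delta> \<le> 1"
    and L1: "finite L1" "\<And>s D. (s, D) \<in> L1 \<Longrightarrow> D \<subseteq> I"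
      "\<And>s D e. (s, D) \<in> L1 \<Longrightarrow> e \<in> D \<Longrightarrow> s \<in> S e"
      "\<And>s D. (s, D) \<in> L1 \<Longrightarrow> M1 * hi \<le> real (card D)"
    and L2: "finite L2" "\<And>s F. (s, F) \<in> L2 \<Longrightarrow> F \<subseteq> I \<times> I"
      "\<And>s F e e'. (s, F) \<in> L2 \<Longrightarrow> (e, e') \<in> F \<Longrightarrow> s \<in> S e \<and> s \<in> S e'"
      "\<And>s F. (s, F) \<in> L2 \<Longrightarrow> inj_on fst F \<and> inj_on snd F \<and> fst ` F \<inter> snd ` F = {}"
      "\<And>s F. (s, F) \<in> L2 \<Longrightarrow> real (card F) \<le> M2 * lo\<^sup>2"
    and M1: "0 \<le> M1"
    and b: "exp (- (\<delta>\<^sup>2 * M1 / 4)) \<le> b" "exp (- (\<delta>\<^sup>2 * M2 / 4)) \<le> b"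
    and small: "(real (card L1) + real (card L2)) * b < 1"
  shows "\<exists>\<sigma>. (\<forall>e\<in>I. \<sigma> e \<in> S e) \<and>
     (\<forall>(s, D)\<in>L1. (1 - \<delta>) * M1 \<le> real (card {e\<in>D. \<sigma> e = s})) \<and>
     (\<forall>(s, F)\<in>L2. real (card {z\<in>F. \<sigma> (fst z) = s \<and> \<sigma> (snd z) = s}) \<le> (1 + \<delta>) * M2)"
proof -
  have ne: "S e \<noteq> {}" if "e \<in> I" for e using S(1)[OF that] lo by auto
  define P where "P = Pi_pmf I 0 (\<lambda>e. pmf_of_set (S e))"
  have finP: "finite (set_pmf P)" unfolding P_def using I ne by (intro finite_set_Pi_pmf) auto
  define B1 where "B1 = (\<lambda>(s, D). {\<sigma> :: 'e \<Rightarrow> nat. real (card {e\<in>D. \<sigma> e = s}) < (1 - \<delta>) * M1})"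
  define B2 where "B2 = (\<lambda>(s, F). {\<sigma> :: 'e \<Rightarrow> nat. (1 + \<delta>) * M2 < real (card {z\<in>F. \<sigma> (fst z) = s \<and> \<sigma> (snd z) = s})})"
  define q where "q e = 1 / real (card (S e))" for e
  have one: "measure_pmf.prob (pmf_of_set (S e)) {s} = q e" if "e \<in> I" "s \<in> S e" for e s
    using that I ne by (simp add: measure_pmf_of_set q_def)
  have q: "0 \<le> q e" "q e \<le> 1" "q e \<le> 1 / lo" "1 / hi \<le> q e" if "e \<in> I" for e
  proof -
    have "0 < card (S e)" using I ne that by (simp add: card_gt_0_iff)
    then show "0 \<le> q e" "q e \<le> 1" "q e \<le> 1 / lo" "1 / hi \<le> q e"
      using S[OF that] lo by (auto simp: q_def field_simps)
  qed
  have prob: "measure_pmf.prob P {\<sigma>. \<forall>e\<in>U. \<sigma> e \<in> {s}} = (\<Prod>e\<in>U. q e)"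
    if "U \<subseteq> I" "\<And>e. e \<in> U \<Longrightarrow> s \<in> S e" for U s
    unfolding P_def prob_Pi_pmf_on_subset[OF I(1) that(1)]
    using that by (intro prod.cong one) auto
  have "\<exists>\<sigma>\<in>set_pmf P. \<forall>B\<in>B1 ` L1 \<union> B2 ` L2. \<sigma> \<notin> B"
  proof (rule avoid_bad_events[where b=b])
    show "finite (B1 ` L1 \<union> B2 ` L2)" using L1(1) L2(1) by simp
    show "measure_pmf.prob P B \<le> b" if "B \<in> B1 ` L1 \<union> B2 ` L2" for B
      using that
    proof
      assume "B \<in> B1 ` L1"
      then obtain s D where D: "(s, D) \<in> L1" "B = B1 (s, D)" by auto
      have DI: "D \<subseteq> I" and finD: "finite D" using L1(2)[OF D(1)] I(1) finite_subset by auto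
      have "measure_pmf.prob P {\<sigma>. real (card {e \<in> D. \<sigma> \<in> {\<sigma>. \<sigma> e = s}}) < (1 - \<delta>) * M1} \<le> exp (- (\<delta>\<^sup>2 * M1 / 4))"
      proof (rule chernoff_lower[OF finP finD _ _ \<delta> M1])
        fix U assume U: "U \<subseteq> D"
        have "(\<Inter>e\<in>U. {\<sigma>. \<sigma> e = s}) = {\<sigma>. \<forall>e\<in>U. \<sigma> e \<in> {s}}" by auto
        then show "measure_pmf.prob P (\<Inter>e\<in>U. {\<sigma>. \<sigma> e = s}) = (\<Prod>e\<in>U. q e)"
          using prob[of U s] U DI L1(3)[OF D(1)] by (simp add: subset_iff)
      next
        show "M1 \<le> sum q D"
        proof -
          have "M1 \<le> real (card D) * (1 / hi)" using L1(4)[OF D(1)] hi by (simp add: field_simps)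
          also have "\<dots> \<le> sum q D" using q(4) DI by (intro sum_bounded_below) auto
          finally show ?thesis .
        qed
      qed (use q DI in auto)
      then show ?thesis using b(1) D by (simp add: B1_def)
    next
      assume "B \<in> B2 ` L2"
      then obtain s F where F: "(s, F) \<in> L2" "B = B2 (s, F)" by auto
      have FI: "F \<subseteq> I \<times> I" and finF: "finite F" using L2(2)[OF F(1)] I(1) finite_subset by auto
      have "measure_pmf.prob P {\<sigma>. (1 + \<delta>) * M2 < real (card {z \<in> F. \<sigma> \<in> {\<sigma>. \<sigma> (fst z) = s \<and> \<sigma> (snd z) = s}})}
          \<le> exp (- (\<delta>\<^sup>2 * M2 / 4))"
      proof (rule chernoff_upper[OF finP finF, where q="\<lambda>z. q (fst z) * q (snd z)"])
        fix U assume U: "U \<subseteq> F"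
        have finU: "finite U" using U finF finite_subset by blast
        have inj: "inj_on fst U" "inj_on snd U" "fst ` U \<inter> snd ` U = {}"
          using L2(4)[OF F(1)] U by (auto intro: inj_on_subset)
        \<comment> \<open>The event is one condition per edge in the two projections of
          \<open>U\<close>; these are injective with disjoint images, so the product over edges
          regroups into a product over pairs.\<close>
        have "(\<Inter>z\<in>U. {\<sigma>. \<sigma> (fst z) = s \<and> \<sigma> (snd z) = s}) = {\<sigma>. \<forall>e\<in>fst ` U \<union> snd ` U. \<sigma> e \<in> {s}}" by auto
        then have "measure_pmf.prob P (\<Inter>z\<in>U. {\<sigma>. \<sigma> (fst z) = s \<and> \<sigma> (snd z) = s}) = (\<Prod>e\<in>fst ` U \<union> snd ` U. q e)"
          using prob[of "fst ` U \<union> snd ` U" s] U FI L2(3)[OF F(1)] by force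
        also have "\<dots> = (\<Prod>e\<in>fst ` U. q e) * (\<Prod>e\<in>snd ` U. q e)"
          using inj finU by (intro prod.union_disjoint) auto
        also have "\<dots> = (\<Prod>z\<in>U. q (fst z) * q (snd z))"
          using inj by (simp add: prod.reindex prod.distrib)
        finally show "measure_pmf.prob P (\<Inter>z\<in>U. {\<sigma>. \<sigma> (fst z) = s \<and> \<sigma> (snd z) = s}) = (\<Prod>z\<in>U. q (fst z) * q (snd z))" .
      next
        fix z assume "z \<in> F"
        then have "fst z \<in> I" "snd z \<in> I" using FI by auto
        then show "0 \<le> q (fst z) * q (snd z) \<and> q (fst z) * q (snd z) \<le> 1" by (simp add: q mult_le_one)
      next
        have "(\<Sum>z\<in>F. q (fst z) * q (snd z)) \<le> (\<Sum>z\<in>F. (1 / lo) * (1 / lo))"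
          using FI q lo by (intro sum_mono mult_mono) auto
        also have "\<dots> = real (card F) / lo\<^sup>2" by (simp add: power2_eq_square)
        also have "\<dots> \<le> M2" using L2(5)[OF F(1)] lo by (simp add: field_simps)
        finally show "(\<Sum>z\<in>F. q (fst z) * q (snd z)) \<le> M2" .
      qed (use \<delta> in auto)
      then show ?thesis using b(2) F by (simp add: B2_def)
    qed
    have b0: "0 \<le> b" using b(1) exp_ge_zero order_trans by blast
    have "card (B1 ` L1 \<union> B2 ` L2) \<le> card L1 + card L2"
      using card_Un_le card_image_le[OF L1(1)] card_image_le[OF L2(1)] by (meson add_mono order_trans)
    then have "real (card (B1 ` L1 \<union> B2 ` L2)) \<le> real (card L1) + real (card L2)" by linarith
    then show "real (card (B1 ` L1 \<union> B2 ` L2)) * b < 1"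
      using small b0 by (meson mult_right_mono order_le_less_trans)
  qed
  then obtain \<sigma> where \<sigma>P: "\<sigma> \<in> set_pmf P" and good: "\<forall>B\<in>B1 ` L1 \<union> B2 ` L2. \<sigma> \<notin> B" ..
  have \<sigma>: "\<And>z. z \<in> L1 \<Longrightarrow> \<sigma> \<notin> B1 z" "\<And>z. z \<in> L2 \<Longrightarrow> \<sigma> \<notin> B2 z"
    using good by simp_all
  have "\<sigma> e \<in> S e" if "e \<in> I" for e
    using \<sigma>P that I ne unfolding P_def by (auto simp: set_Pi_pmf PiE_dflt_def)
  moreover have "(1 - \<delta>) * M1 \<le> real (card {e\<in>D. \<sigma> e = s})" if "(s, D) \<in> L1" for s D
    using \<sigma>(1)[OF that] by (simp add: B1_def)
  moreover have "real (card {z\<in>F. \<sigma> (fst z) = s \<and> \<sigma> (snd z) = s}) \<le> (1 + \<delta>) * M2" if "(s, F) \<in> L2" for s F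
    using \<sigma>(2)[OF that] by (simp add: B2_def)
  ultimately show ?thesis by (intro exI[of _ \<sigma>]) auto
qed

section \<open>Disjoint perfect matchings in pseudo-random bipartite graphs\<close>

text \<open>A system of distinct representatives.\<close>

definition sdr :: "'i set \<Rightarrow> ('i \<Rightarrow> 'b set) \<Rightarrow> ('i \<Rightarrow> 'b) \<Rightarrow> bool" where
  "sdr I N f \<longleftrightarrow> inj_on f I \<and> (\<forall>i\<in>I. f i \<in> N i)"

text \<open>Induction on the number of sets. If some proper nonempty subfamily is tight, represent
  it first and the others outside its union \<open>U\<close>. Otherwise every proper nonempty
  subfamily has an element to spare, so one representative can be chosen arbitrarily.\<close>

lemma hall:
  fixes N :: "'i \<Rightarrow> 'b set"
  assumes "finite I" "\<And>i. i \<in> I \<Longrightarrow> finite (N i)"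
    and "\<And>J. J \<subseteq> I \<Longrightarrow> card J \<le> card (\<Union>i\<in>J. N i)"
  shows "\<exists>f. sdr I N f"
  using assms
proof (induction "card I" arbitrary: I N rule: less_induct)
  case less
  note fin = less.prems(1) and finN = less.prems(2) and H = less.prems(3)
  show ?case
  proof (cases "I = {}")
    case True
    then show ?thesis by (auto simp: sdr_def)
  next
    case ne: False
    show ?thesis
    proof (cases "\<exists>J. J \<subset> I \<and> J \<noteq> {} \<and> card (\<Union>i\<in>J. N i) = card J")
      case True
      then obtain J where J: "J \<subset> I" "J \<noteq> {}" "card (\<Union>i\<in>J. N i) = card J" by blast
      have finJ: "finite J" using J fin finite_subset by blast
      define U where "U = (\<Union>i\<in>J. N i)"
      have finU: "finite U" unfolding U_def using finJ finN J by auto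
      have "\<exists>f. sdr J N f"
      proof (rule less.hyps)
        show "card J < card I" using J fin by (simp add: psubset_card_mono)
      qed (use J finJ finN H in auto)
      then obtain f where f: "sdr J N f" by blast
      have "\<exists>g. sdr (I - J) (\<lambda>i. N i - U) g"
      proof (rule less.hyps)
        show "card (I - J) < card I"
          using J fin by (intro psubset_card_mono) auto
        fix K assume K: "K \<subseteq> I - J"
        have finK: "finite K" using K fin finite_subset by blast
        \<comment> \<open>Hall's condition survives the removal of \<open>U\<close>: apply the old
          condition to \<open>K \<union> J\<close> and subtract the tight \<open>J\<close>.\<close>
        have "card K + card J = card (K \<union> J)"
          using K finK finJ by (intro card_Un_disjoint[symmetric]) auto
        also have "\<dots> \<le> card (\<Union>i\<in>K \<union> J. N i)" using K J by (intro H) auto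
        also have "(\<Union>i\<in>K \<union> J. N i) = (\<Union>i\<in>K. N i - U) \<union> U" by (auto simp: U_def)
        also have "card \<dots> \<le> card (\<Union>i\<in>K. N i - U) + card U" by (rule card_Un_le)
        finally show "card K \<le> card (\<Union>i\<in>K. N i - U)" using J by (simp add: U_def)
      qed (use fin finN in auto)
      then obtain g where g: "sdr (I - J) (\<lambda>i. N i - U) g" by blast
      define h where "h i = (if i \<in> J then f i else g i)" for i
      have "sdr I N h"
        unfolding sdr_def
      proof
        show "inj_on h I"
        proof (rule inj_onI)
          fix x y assume xy: "x \<in> I" "y \<in> I" "h x = h y"
          have fU: "f x \<in> U" if "x \<in> J" for x using f that unfolding sdr_def U_def by blast
          have gU: "g x \<notin> U" if "x \<in> I" "x \<notin> J" for x using g that unfolding sdr_def by blast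
          have "x \<in> J \<longleftrightarrow> y \<in> J" using xy fU[of x] fU[of y] gU[of x] gU[of y] unfolding h_def by metis
          then show "x = y" using f g xy inj_onD[of f J x y] inj_onD[of g "I - J" x y]
            unfolding sdr_def h_def by (cases "x \<in> J") simp_all
        qed
        show "\<forall>i\<in>I. h i \<in> N i" using f g by (auto simp: sdr_def h_def)
      qed
      then show ?thesis by blast
    next
      case tight: False
      obtain i where i: "i \<in> I" using ne by blast
      have "N i \<noteq> {}" using H[of "{i}"] i by auto
      then obtain x where x: "x \<in> N i" by blast
      have "\<exists>g. sdr (I - {i}) (\<lambda>j. N j - {x}) g"
      proof (rule less.hyps)
        show "card (I - {i}) < card I" using i fin by (intro psubset_card_mono) auto
        fix K assume K: "K \<subseteq> I - {i}"
        have finK: "finite K" using K fin finite_subset by blast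
        show "card K \<le> card (\<Union>j\<in>K. N j - {x})"
        proof (cases "K = {}")
          case False
          \<comment> \<open>Without tight subfamilies the inequality for \<open>K\<close> is strict,
            which pays for the removal of \<open>x\<close>.\<close>
          moreover have "K \<subset> I" using K i by blast
          ultimately have "card (\<Union>i\<in>K. N i) \<noteq> card K" using tight by blast
          then have "card K < card (\<Union>i\<in>K. N i)"
            using H[of K] \<open>K \<subset> I\<close> by auto
          moreover have "card (\<Union>j\<in>K. N j) - 1 \<le> card ((\<Union>j\<in>K. N j) - {x})"
            using diff_card_le_card_Diff[of "{x}" "\<Union>j\<in>K. N j"] by simp
          moreover have eq: "(\<Union>j\<in>K. N j - {x}) = (\<Union>j\<in>K. N j) - {x}" by auto
          ultimately show ?thesis unfolding eq by linarith
        qed auto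
      qed (use fin finN in auto)
      then obtain g where g: "sdr (I - {i}) (\<lambda>j. N j - {x}) g" by blast
      have "sdr I N (g(i := x))"
        using g x unfolding sdr_def inj_on_def by auto
      then show ?thesis by blast
    qed
  qed
qed

text \<open>
  The gadget turns \<open>k\<close>-factors into systems of distinct representatives: the elements to be
  represented are \<open>k\<close> copies of each vertex on the left together with all edges. An edge is
  represented either by itself, which means that it is not in the factor, or by a copy of its
  right endpoint.
\<close>

lemma bipartite_factor:
  fixes A :: "'a set" and B :: "'b set" and R :: "('a \<times> 'b) set" and k m :: nat
  assumes fin: "finite A" "finite B" and card: "card A = m" "card B = m"
    and R: "R \<subseteq> A \<times> B"
    and H: "\<And>X Y. X \<subseteq> A \<Longrightarrow> Y \<subseteq> B \<Longrightarrow> k * (card X + card Y) \<le> card (R \<inter> X \<times> Y) + k * m"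
  shows "\<exists>S\<subseteq>R. (\<forall>x\<in>A. card {y. (x, y) \<in> S} = k) \<and> (\<forall>y\<in>B. card {x. (x, y) \<in> S} = k)"
proof -
  have finR: "finite R" using R fin by (meson finite_SigmaI finite_subset)
  define I :: "('a \<times> nat + 'a \<times> 'b) set" where "I = A \<times> {..<k} <+> R"
  define D :: "('a \<times> 'b + 'b \<times> nat) set" where "D = R <+> B \<times> {..<k}"
  define N :: "('a \<times> nat + 'a \<times> 'b) \<Rightarrow> ('a \<times> 'b + 'b \<times> nat) set" where
    "N i = (case i of Inl (x, _) \<Rightarrow> Inl ` {e \<in> R. fst e = x}
                    | Inr e \<Rightarrow> insert (Inl e) (Inr ` ({snd e} \<times> {..<k})))" for i
  have "\<exists>f. sdr I N f"
  proof (rule hall)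
    show "finite I" using fin finR by (simp add: I_def)
    show "finite (N i)" if "i \<in> I" for i
      using finR by (auto simp: N_def split: sum.split)
    fix J assume J: "J \<subseteq> I"
    \<comment> \<open>\<open>X\<close> holds the left vertices with a copy in \<open>J\<close>,
      \<open>F\<close> the edges in \<open>J\<close>, and \<open>Y\<close> the right vertices that
      \<open>F\<close> misses. The neighbourhood of \<open>J\<close> has at least
      \<open>e(X, Y) + |F| + k (m - |Y|)\<close> elements, and \<open>H\<close> bounds this below by
      \<open>k |X| + |F| \<ge> |J|\<close>.\<close>
    define F where "F = {e. Inr e \<in> J}"
    define X where "X = {x. \<exists>c. Inl (x, c) \<in> J}"
    define Y where "Y = B - snd ` F"
    have F: "F \<subseteq> R" and X: "X \<subseteq> A" using J by (auto simp: F_def X_def I_def)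
    have finF: "finite F" and finX: "finite X" using F X finR fin finite_subset by blast+
    have sndF: "snd ` F \<subseteq> B" using F R by auto
    have "J \<subseteq> (X \<times> {..<k}) <+> F"
    proof
      fix i assume "i \<in> J"
      then show "i \<in> (X \<times> {..<k}) <+> F" using J by (cases i) (auto simp: F_def X_def I_def)
    qed
    then have cardJ: "card J \<le> k * card X + card F"
      using card_mono[of "(X \<times> {..<k}) <+> F" J] finX finF by (simp add: card_Plus card_cartesian_product mult.commute)
    have fin1: "finite ((R \<inter> X \<times> UNIV) \<union> F)" using finR finF by auto
    have "((R \<inter> X \<times> UNIV) \<union> F) <+> (snd ` F \<times> {..<k}) \<subseteq> (\<Union>i\<in>J. N i)"
    proof (intro subsetI)
      fix z :: "'a \<times> 'b + 'b \<times> nat"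
      assume z: "z \<in> ((R \<inter> X \<times> UNIV) \<union> F) <+> (snd ` F \<times> {..<k})"
      show "z \<in> (\<Union>i\<in>J. N i)"
      proof (cases z)
        case (Inl e)
        then consider "e \<in> R" "fst e \<in> X" | "e \<in> F" using z by auto
        then show ?thesis
        proof cases
          case 1
          then obtain c where "Inl (fst e, c) \<in> J" by (auto simp: X_def)
          then show ?thesis using Inl 1 by (intro UN_I[of "Inl (fst e, c)"]) (auto simp: N_def)
        next
          case 2
          then show ?thesis using Inl by (intro UN_I[of "Inr e"]) (auto simp: N_def F_def)
        qed
      next
        case (Inr w)
        then obtain e where "e \<in> F" "fst w = snd e" "snd w < k" using z by auto
        then show ?thesis using Inr by (intro UN_I[of "Inr e"]) (auto simp: N_def F_def image_iff prod_eq_iff)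
      qed
    qed
    moreover have "finite (\<Union>i\<in>J. N i)"
      using finite_subset[OF J \<open>finite I\<close>] finR by (auto simp: N_def split: sum.split)
    ultimately have "card (((R \<inter> X \<times> UNIV) \<union> F) <+> (snd ` F \<times> {..<k})) \<le> card (\<Union>i\<in>J. N i)"
      by (intro card_mono)
    then have 1: "card ((R \<inter> X \<times> UNIV) \<union> F) + k * card (snd ` F) \<le> card (\<Union>i\<in>J. N i)"
      using fin1 finF by (simp add: card_Plus card_cartesian_product mult.commute)
    have "card ((R \<inter> X \<times> Y) \<union> F) \<le> card ((R \<inter> X \<times> UNIV) \<union> F)"
      using fin1 by (intro card_mono) auto
    moreover have "card ((R \<inter> X \<times> Y) \<union> F) = card (R \<inter> X \<times> Y) + card F"
      using finR finF by (intro card_Un_disjoint) (force simp: Y_def)+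
    moreover have "card Y + card (snd ` F) = m"
      using sndF fin card card_Diff_subset[of "snd ` F" B] card_mono[of B "snd ` F"] finF by (simp add: Y_def)
    then have "k * card Y + k * card (snd ` F) = k * m" by (metis add_mult_distrib2)
    moreover have "k * (card X + card Y) \<le> card (R \<inter> X \<times> Y) + k * m"
      by (rule H) (use X Y_def in auto)
    ultimately show "card J \<le> card (\<Union>i\<in>J. N i)" using cardJ 1 by (simp add: algebra_simps)
  qed
  then obtain f where f: "inj_on f I" "\<And>i. i \<in> I \<Longrightarrow> f i \<in> N i" by (auto simp: sdr_def)
  have fD: "f ` I \<subseteq> D" 
  proof safe
    fix i assume i: "i \<in> I"
    show "f i \<in> D"
    proof (cases i)
      case (Inl w)
      then show ?thesis using f(2)[OF i] by (auto simp: D_def N_def split: prod.splits)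
    next
      case (Inr e)
      then have "snd e \<in> B" using i R by (auto simp: I_def)
      then show ?thesis using f(2)[OF i] Inr i by (auto simp: D_def N_def I_def)
    qed
  qed
  \<comment> \<open>Both sides of the gadget have \<open>k m + |R|\<close> elements, so
    \<open>f\<close> is onto \<open>D\<close>. Surjectivity turns the degree bounds into
    equalities.\<close>
  have "card (f ` I) = card D"
    using f(1) fin finR card by (simp add: card_image I_def D_def card_Plus card_cartesian_product)
  then have fI: "f ` I = D"
    using fD fin finR by (intro card_subset_eq) (auto simp: D_def)
  define S where "S = {e \<in> R. f (Inr e) \<noteq> Inl e}"
  have S: "S \<subseteq> R" by (auto simp: S_def)
  have "card {y. (x, y) \<in> S} = k" if x: "x \<in> A" for x
  proof -
    have "bij_betw (\<lambda>c. f (Inl (x, c))) {..<k} (Inl ` {e \<in> S. fst e = x})"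
      unfolding bij_betw_def
    proof
      show "inj_on (\<lambda>c. f (Inl (x, c))) {..<k}"
        using f(1) x by (auto simp: inj_on_def I_def)
      show "(\<lambda>c. f (Inl (x, c))) ` {..<k} = Inl ` {e \<in> S. fst e = x}"
      proof (intro equalityI subsetI)
        fix z assume "z \<in> (\<lambda>c. f (Inl (x, c))) ` {..<k}"
        then obtain c where c: "c < k" "z = f (Inl (x, c))" by blast
        then have cI: "Inl (x, c) \<in> I" using x by (auto simp: I_def)
        from f(2)[OF cI] obtain e where e: "e \<in> R" "fst e = x" "z = Inl e"
          using c by (auto simp: N_def)
        \<comment> \<open>\<open>Inl e\<close> is already taken by a copy of \<open>x\<close>, so
          \<open>e\<close> cannot represent itself.\<close>
        have "f (Inr e) \<noteq> Inl e"
          using inj_onD[OF f(1), of "Inr e" "Inl (x, c)"] cI e c by (auto simp: I_def)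
        then show "z \<in> Inl ` {e \<in> S. fst e = x}" using e by (auto simp: S_def)
      next
        fix z assume "z \<in> (Inl ` {e \<in> S. fst e = x} :: ('a \<times> 'b + 'b \<times> nat) set)"
        then obtain e where e: "e \<in> S" "fst e = x" "z = Inl e" by blast
        \<comment> \<open>\<open>Inl e\<close> is a value of \<open>f\<close>. It is not taken at
          \<open>Inr e\<close> because \<open>e \<in> S\<close>, so it is taken at a copy of
          \<open>x\<close>.\<close>
        then have "Inl e \<in> f ` I" unfolding fI by (auto simp: D_def S_def)
        then obtain i where i: "i \<in> I" "f i = Inl e" by auto
        obtain c where "i = Inl (x, c)" "c < k"
          using f(2)[OF i(1)] i e by (auto simp: I_def N_def S_def)
        then show "z \<in> (\<lambda>c. f (Inl (x, c))) ` {..<k}" using i e by (intro image_eqI[of _ _ c]) auto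
      qed
    qed
    then have "card (Inl ` {e \<in> S. fst e = x} :: ('a \<times> 'b + 'b \<times> nat) set) = k"
      by (simp add: bij_betw_same_card[symmetric])
    moreover have "{e \<in> S. fst e = x} = Pair x ` {y. (x, y) \<in> S}" by force
    ultimately show ?thesis by (simp add: card_image inj_on_def)
  qed
  moreover have "card {x. (x, y) \<in> S} = k" if y: "y \<in> B" for y
  proof -
    have "bij_betw (\<lambda>x. f (Inr (x, y))) {x. (x, y) \<in> S} (Inr ` ({y} \<times> {..<k}))"
      unfolding bij_betw_def
    proof
      show "inj_on (\<lambda>x. f (Inr (x, y))) {x. (x, y) \<in> S}"
        using f(1) by (auto simp: inj_on_def I_def S_def)
      show "(\<lambda>x. f (Inr (x, y))) ` {x. (x, y) \<in> S} = Inr ` ({y} \<times> {..<k})"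
      proof (intro equalityI subsetI)
        fix z assume "z \<in> (\<lambda>x. f (Inr (x, y))) ` {x. (x, y) \<in> S}"
        then obtain x where x: "(x, y) \<in> S" "z = f (Inr (x, y))" by blast
        then show "z \<in> Inr ` ({y} \<times> {..<k})"
          using f(2)[of "Inr (x, y)"] by (auto simp: N_def S_def I_def)
      next
        fix z assume "z \<in> (Inr ` ({y} \<times> {..<k}) :: ('a \<times> 'b + 'b \<times> nat) set)"
        then obtain c where c: "c < k" "z = Inr (y, c)" by blast
        then have "z \<in> f ` I" unfolding fI using y by (auto simp: D_def)
        then obtain i where i: "i \<in> I" "f i = z" by auto
        then obtain e where e: "e \<in> R" "i = Inr e" "snd e = y"
          using f(2)[OF i(1)] c by (auto simp: I_def N_def)
        then have "(fst e, y) \<in> S" using i c by (auto simp: S_def)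
        then show "z \<in> (\<lambda>x. f (Inr (x, y))) ` {x. (x, y) \<in> S}" using i e by (intro image_eqI[of _ _ "fst e"]) auto
      qed
    qed
    from bij_betw_same_card[OF this] show ?thesis
      by (simp add: card_image card_cartesian_product)
  qed
  ultimately show ?thesis using S by blast
qed

text \<open>A regular bipartite graph of positive degree has a perfect matching by Hall's theorem;
  removing it lowers all degrees by one.\<close>

lemma regular_bipartite_matchings:
  fixes A :: "'a set" and B :: "'b set"
  assumes "finite A" "finite B" "card A = card B" "S \<subseteq> A \<times> B"
    and "\<And>x. x \<in> A \<Longrightarrow> card {y. (x, y) \<in> S} = k" "\<And>y. y \<in> B \<Longrightarrow> card {x. (x, y) \<in> S} = k"
  shows "\<exists>M. (\<forall>l<k. bij_betw (M l) A B \<and> (\<forall>x\<in>A. (x, M l x) \<in> S)) \<and>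
             (\<forall>l<k. \<forall>l'<k. l \<noteq> l' \<longrightarrow> (\<forall>x\<in>A. M l x \<noteq> M l' x))"
  using assms
proof (induction k arbitrary: S)
  case 0
  then show ?case by auto
next
  case (Suc k)
  note fin = Suc.prems(1,2) and cardAB = Suc.prems(3) and S = Suc.prems(4)
    and dA = Suc.prems(5) and dB = Suc.prems(6)
  have "\<exists>f. sdr A (\<lambda>x. {y. (x, y) \<in> S}) f"
  proof (rule hall)
    show "finite {y. (x, y) \<in> S}" for x using S fin(2) by (elim finite_subset[rotated]) auto
    fix X assume X: "X \<subseteq> A"
    define Y where "Y = (\<Union>x\<in>X. {y. (x, y) \<in> S})"
    have Y: "Y \<subseteq> B" using S by (auto simp: Y_def)
    have finX: "finite X" and finY: "finite Y" using X Y fin finite_subset by blast+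
    have finr: "finite {x. (x, y) \<in> S}" for y using S fin(1) by (elim finite_subset[rotated]) auto
    have finl: "finite {y. (x, y) \<in> S}" for x using S fin(2) by (elim finite_subset[rotated]) auto
    \<comment> \<open>Double counting: the edges leaving \<open>X\<close> all end in
      \<open>Y\<close>, where each vertex receives at most \<open>Suc k\<close> of them.\<close>
    have "card X * Suc k = (\<Sum>x\<in>X. card {y. (x, y) \<in> S})"
      using dA X by (subst sum.cong[OF refl, of X _ "\<lambda>_. Suc k"]) auto
    also have "\<dots> = card (SIGMA x:X. {y. (x, y) \<in> S})" using finX finl by simp
    also have "\<dots> = card ((SIGMA x:X. {y. (x, y) \<in> S})\<inverse>)" by simp
    also have "\<dots> \<le> card (SIGMA y:Y. {x. (x, y) \<in> S})"
      using finY finr by (intro card_mono) (auto simp: Y_def)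
    also have "\<dots> = (\<Sum>y\<in>Y. card {x. (x, y) \<in> S})" using finY finr by simp
    also have "\<dots> = card Y * Suc k"
      using dB Y by (subst sum.cong[OF refl, of Y _ "\<lambda>_. Suc k"]) auto
    finally show "card X \<le> card (\<Union>x\<in>X. {y. (x, y) \<in> S})"
      unfolding Y_def by (metis mult_le_cancel2 zero_less_Suc)
  qed (use fin in auto)
  then obtain f where f: "inj_on f A" "\<And>x. x \<in> A \<Longrightarrow> (x, f x) \<in> S" by (auto simp: sdr_def)
  have "f ` A = B"
    using f S cardAB fin by (intro card_subset_eq) (auto simp: card_image)
  then have bij: "bij_betw f A B" using f by (simp add: bij_betw_def)
  define S' where "S' = S - {(x, f x) | x. x \<in> A}"
  have "\<exists>M. (\<forall>l<k. bij_betw (M l) A B \<and> (\<forall>x\<in>A. (x, M l x) \<in> S')) \<and>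
             (\<forall>l<k. \<forall>l'<k. l \<noteq> l' \<longrightarrow> (\<forall>x\<in>A. M l x \<noteq> M l' x))"
  proof (rule Suc.IH)
    show "S' \<subseteq> A \<times> B" using S by (auto simp: S'_def)
    fix x assume x: "x \<in> A"
    have "{y. (x, y) \<in> S'} = {y. (x, y) \<in> S} - {f x}" using x by (auto simp: S'_def)
    then show "card {y. (x, y) \<in> S'} = k" using dA[OF x] f(2)[OF x] by (simp add: card_Diff_singleton_if)
  next
    fix y assume y: "y \<in> B"
    then obtain x where x: "x \<in> A" "f x = y" using \<open>f ` A = B\<close> by blast
    have "{x. (x, y) \<in> S'} = {x. (x, y) \<in> S} - {x}"
      using x f(1) S by (auto simp: S'_def inj_on_def)
    then show "card {x. (x, y) \<in> S'} = k" using dB[OF y] f(2)[OF x(1)] x by (simp add: card_Diff_singleton_if)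
  qed (use fin cardAB in auto)
  then obtain M where M: "\<And>l. l < k \<Longrightarrow> bij_betw (M l) A B" "\<And>l x. l < k \<Longrightarrow> x \<in> A \<Longrightarrow> (x, M l x) \<in> S'"
    "\<And>l l' x. l < k \<Longrightarrow> l' < k \<Longrightarrow> l \<noteq> l' \<Longrightarrow> x \<in> A \<Longrightarrow> M l x \<noteq> M l' x" by blast
  have ne: "M l x \<noteq> f x" if "l < k" "x \<in> A" for l x
    using M(2)[OF that] that by (auto simp: S'_def)
  show ?case
  proof (intro exI[of _ "M(k := f)"] conjI allI impI ballI)
    fix l x assume l: "l < Suc k" and x: "x \<in> A"
    show "(x, (M(k := f)) l x) \<in> S"
      using M(2)[of l x] f(2)[OF x] l x by (auto simp: less_Suc_eq S'_def)
  next
    fix l l' x assume l: "l < Suc k" "l' < Suc k" "l \<noteq> l'" and x: "x \<in> A"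
    show "(M(k := f)) l x \<noteq> (M(k := f)) l' x"
      using M(3)[of l l' x] ne[of l x] ne[of l' x] l x by (auto simp: less_Suc_eq)
  qed (use M(1) bij in \<open>auto simp: less_Suc_eq\<close>)
qed

text \<open>A second moment argument: degrees and co-degrees force the number \<open>D y\<close> of
  neighbours in \<open>X\<close> to be close to \<open>a q\<close> for most \<open>y\<close>. When
  \<open>X\<close> is too small for this, the edges from \<open>X\<close> that miss \<open>Y\<close>
  are few by trivial counting.\<close>

lemma pseudo_random_edge_count:
  fixes A :: "'a set" and B :: "'b set" and \<delta> q :: real
  assumes fin: "finite A" "finite B" and card: "card A = m" "card B = m" and R: "R \<subseteq> A \<times> B"
    and q: "0 < q" and \<delta>: "0 < \<delta>" "4 * sqrt \<delta> \<le> 1/3" and large: "1 \<le> real m * q\<^sup>2 * \<delta>\<^sup>2"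
    and deg: "\<And>x. x \<in> A \<Longrightarrow> (1 - \<delta>) * real m * q \<le> real (card {y. (x, y) \<in> R})"
    and codeg: "\<And>x x'. x \<in> A \<Longrightarrow> x' \<in> A \<Longrightarrow> x \<noteq> x' \<Longrightarrow>
        real (card {y. (x, y) \<in> R \<and> (x', y) \<in> R}) \<le> (1 + \<delta>) * real m * q\<^sup>2"
    and X: "X \<subseteq> A" and Y: "Y \<subseteq> B" and XY: "card X \<le> card Y" "m \<le> card X + card Y"
  shows "(1 - 4 * sqrt \<delta>) * real m * q * (real (card X) + real (card Y) - real m) \<le> real (card (R \<inter> X \<times> Y))"
proof -
  define \<xi> :: "'a \<Rightarrow> 'b \<Rightarrow> real" where "\<xi> x y = of_bool ((x, y) \<in> R)" for x y
  define \<eta> where "\<eta> = 4 * sqrt \<delta>"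
  define a where "a = real (card X)"
  define b where "b = real (card Y)"
  define M where "M = real m"
  define D where "D y = (\<Sum>x\<in>X. \<xi> x y)" for y
  define E where "E = (\<Sum>y\<in>B. D y)"
  have finX: "finite X" and finY: "finite Y" using X Y fin finite_subset by blast+
  have \<eta>2: "\<eta>\<^sup>2 = 16 * \<delta>" using \<delta> by (simp add: \<eta>_def power_mult_distrib)
  have \<eta>: "0 < \<eta>" "\<eta> \<le> 1/3" using \<delta> by (auto simp: \<eta>_def)
  have "16 * \<delta> \<le> \<eta> * (1/3)" unfolding \<eta>2[symmetric] power2_eq_square using \<eta> by (intro mult_left_mono) auto
  then have \<delta>\<eta>: "48 * \<delta> \<le> \<eta>" by simp
  have \<delta>1: "\<delta> < 1" using \<delta>\<eta> \<eta> by linarith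
  have Mpos: "0 < M" using large \<delta> q by (cases m) (auto simp: M_def)
  have ab: "a \<le> b" "M \<le> a + b" "b \<le> M" "0 \<le> a"
    using XY card_mono[OF fin(2) Y] card by (auto simp: a_def b_def M_def)
  have degX: "(1 - \<delta>) * M * q \<le> (\<Sum>y\<in>B. \<xi> x y)" if "x \<in> X" for x
  proof -
    have "(\<Sum>y\<in>B. \<xi> x y) = real (card (B \<inter> {y. (x, y) \<in> R}))"
      using fin by (simp add: \<xi>_def Int_def)
    also have "B \<inter> {y. (x, y) \<in> R} = {y. (x, y) \<in> R}" using R by auto
    finally show ?thesis using deg[of x] that X by (auto simp: M_def)
  qed
  have EX: "E = (\<Sum>x\<in>X. \<Sum>y\<in>B. \<xi> x y)" unfolding E_def D_def by (rule sum.swap)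
  have E_ge: "a * ((1 - \<delta>) * M * q) \<le> E"
    using sum_mono[of X "\<lambda>_. (1 - \<delta>) * M * q", OF degX] by (simp add: EX a_def)
  have count: "real (card (R \<inter> X \<times> Y)) = (\<Sum>y\<in>Y. D y)"
  proof -
    have "(\<Sum>y\<in>Y. D y) = (\<Sum>x\<in>X. \<Sum>y\<in>Y. \<xi> x y)" unfolding D_def by (rule sum.swap)
    also have "\<dots> = (\<Sum>z\<in>X \<times> Y. of_bool (z \<in> R))"
      by (simp add: sum.cartesian_product \<xi>_def case_prod_unfold)
    also have "\<dots> = real (card (X \<times> Y \<inter> R))" using finX finY by simp
    finally show ?thesis by (simp add: Int_commute)
  qed
  \<comment> \<open>The threshold fits both sides. Below it, the at most
    \<open>(M - b) a \<le> a^2\<close> edges missing \<open>Y\<close> fit into the gap between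
    \<open>1 - \<delta>\<close> and \<open>1 - \<eta>\<close>; above it, \<open>a q\<close> is large
    enough to absorb the diagonal of the second moment.\<close>
  consider (small) "a \<le> (\<eta> - \<delta>) * M * q" | (big) "(\<eta> - \<delta>) * M * q < a" by linarith
  then have "(1 - \<eta>) * M * q * (a + b - M) \<le> (\<Sum>y\<in>Y. D y)"
  proof cases
    case small
    have "(\<Sum>y\<in>Y. D y) = E - (\<Sum>y\<in>B - Y. D y)"
      unfolding E_def using sum.subset_diff[OF Y fin(2), of D] by simp
    moreover have "(\<Sum>y\<in>B - Y. D y) \<le> real (card (B - Y)) * a"
      unfolding a_def D_def by (intro sum_bounded_above order_trans[OF sum_bounded_above[where K=1]]) (auto simp: \<xi>_def)
    moreover have "real (card (B - Y)) = M - b"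
      using card_Diff_subset[OF finY Y] card card_mono[OF fin(2) Y] by (simp add: M_def b_def of_nat_diff)
    ultimately have "a * ((1 - \<delta>) * M * q) - (M - b) * a \<le> (\<Sum>y\<in>Y. D y)" using E_ge by simp
    moreover have "(M - b) * a \<le> a * a" using ab by (intro mult_right_mono) auto
    moreover have "a * a \<le> a * ((\<eta> - \<delta>) * M * q)" using small ab by (intro mult_left_mono) auto
    moreover have "(1 - \<eta>) * M * q * (a + b - M) \<le> (1 - \<eta>) * M * q * a"
      using ab \<eta> q Mpos by (intro mult_left_mono) auto
    ultimately show ?thesis by (simp add: algebra_simps)
  next
    case big
    have big2: "1 \<le> \<delta> * (a * q)"
    proof -
      have "1 \<le> M * q\<^sup>2 * \<delta>\<^sup>2" using large by (simp add: M_def)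
      also have "\<dots> \<le> M * q\<^sup>2 * (\<delta> * (\<eta> - \<delta>))"
        using \<delta>\<eta> \<delta> Mpos by (intro mult_left_mono) (auto simp: power2_eq_square)
      also have "\<dots> = \<delta> * ((\<eta> - \<delta>) * M * q * q)" by (simp add: power2_eq_square)
      also have "\<dots> \<le> \<delta> * (a * q)" using big q \<delta> by (intro mult_left_mono mult_right_mono) auto
      finally show ?thesis .
    qed
    have aq: "1 \<le> a * q"
      using big2 \<delta>1 \<delta> ab q mult_left_le_one_le[of "a * q" \<delta>] by auto
    \<comment> \<open>The sum of squares counts pairs \<open>x, x'\<close> in \<open>X\<close> with
      a common neighbour. The diagonal contributes \<open>E\<close>, each other pair at most the
      co-degree bound.\<close>
    have sq: "(\<Sum>y\<in>B. (D y)\<^sup>2) \<le> E + a\<^sup>2 * ((1 + \<delta>) * M * q\<^sup>2)"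
    proof -
      have "(\<Sum>y\<in>B. (D y)\<^sup>2) = (\<Sum>y\<in>B. \<Sum>x\<in>X. \<Sum>x'\<in>X. \<xi> x y * \<xi> x' y)"
        unfolding D_def power2_eq_square by (simp add: sum_product)
      also have "\<dots> = (\<Sum>x\<in>X. \<Sum>x'\<in>X. \<Sum>y\<in>B. \<xi> x y * \<xi> x' y)"
        by (subst sum.swap, intro sum.cong refl sum.swap)
      also have "\<dots> \<le> (\<Sum>x\<in>X. \<Sum>x'\<in>X. (if x' = x then (\<Sum>y\<in>B. \<xi> x y) else 0) + (1 + \<delta>) * M * q\<^sup>2)"
      proof (intro sum_mono)
        fix x x' assume x: "x \<in> X" "x' \<in> X"
        show "(\<Sum>y\<in>B. \<xi> x y * \<xi> x' y) \<le> (if x' = x then (\<Sum>y\<in>B. \<xi> x y) else 0) + (1 + \<delta>) * M * q\<^sup>2"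
        proof (cases "x = x'")
          case True
          have "(\<Sum>y\<in>B. \<xi> x y * \<xi> x y) = (\<Sum>y\<in>B. \<xi> x y)" by (intro sum.cong) (auto simp: \<xi>_def)
          then show ?thesis using True \<delta> Mpos by simp
        next
          case False
          have "(\<Sum>y\<in>B. \<xi> x y * \<xi> x' y) = (\<Sum>y\<in>B. of_bool ((x, y) \<in> R \<and> (x', y) \<in> R))"
            by (intro sum.cong) (auto simp: \<xi>_def)
          also have "\<dots> = real (card (B \<inter> {y. (x, y) \<in> R \<and> (x', y) \<in> R}))" using fin by simp
          also have "B \<inter> {y. (x, y) \<in> R \<and> (x', y) \<in> R} = {y. (x, y) \<in> R \<and> (x', y) \<in> R}" using R by auto
          also have "real (card \<dots>) \<le> (1 + \<delta>) * M * q\<^sup>2"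
            unfolding M_def using False x X by (intro codeg) auto
          finally show ?thesis using False by simp
        qed
      qed
      also have "\<dots> = E + a\<^sup>2 * ((1 + \<delta>) * M * q\<^sup>2)"
        using finX by (simp add: sum.distrib EX a_def power2_eq_square)
      finally show ?thesis .
    qed
    have var: "(\<Sum>y\<in>B. (D y - a * q)\<^sup>2) \<le> 4 * \<delta> * a\<^sup>2 * M * q\<^sup>2"
    proof -
      have "(\<Sum>y\<in>B. (D y - a * q)\<^sup>2) = (\<Sum>y\<in>B. (D y)\<^sup>2 - 2 * (a * q) * D y + (a * q)\<^sup>2)"
        by (intro sum.cong) (auto simp: power2_eq_square algebra_simps)
      also have "\<dots> = (\<Sum>y\<in>B. (D y)\<^sup>2) - 2 * (a * q) * E + M * (a * q)\<^sup>2"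
        by (simp add: sum.distrib sum_subtractf E_def sum_distrib_left card M_def)
      also have "\<dots> \<le> a\<^sup>2 * ((1 + \<delta>) * M * q\<^sup>2) + M * (a * q)\<^sup>2 - (2 * (a * q) - 1) * E"
        using sq by (simp add: algebra_simps)
      \<comment> \<open>Because \<open>a q \<ge> 1\<close>, the coefficient of \<open>E\<close> is
        negative and only the lower bound on degrees is required.\<close>
      also have "\<dots> \<le> a\<^sup>2 * ((1 + \<delta>) * M * q\<^sup>2) + M * (a * q)\<^sup>2 - (2 * (a * q) - 1) * (a * ((1 - \<delta>) * M * q))"
        using E_ge aq by (intro diff_left_mono mult_left_mono) auto
      also have "\<dots> = 3 * \<delta> * a\<^sup>2 * M * q\<^sup>2 + a * M * q * (1 - \<delta>)"
        by (simp add: algebra_simps power2_eq_square)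
      also have "a * M * q * (1 - \<delta>) \<le> a * M * q * (\<delta> * (a * q))"
        using big2 \<delta> ab Mpos q by (intro mult_left_mono) auto
      finally show ?thesis by (simp add: algebra_simps power2_eq_square)
    qed
    define Z where "Z = (\<Sum>y\<in>Y. a * q - D y)"
    have "Z\<^sup>2 \<le> b * (\<Sum>y\<in>Y. (a * q - D y)\<^sup>2)"
      using sum_squared_le_sum_of_squares[of "\<lambda>y. a * q - D y" Y] finY
      unfolding Z_def b_def by (simp add: mult.commute)
    also have "\<dots> \<le> M * (\<Sum>y\<in>B. (D y - a * q)\<^sup>2)"
      using ab fin Y by (intro mult_mono) (auto simp: power2_commute intro!: sum_mono2 sum_nonneg)
    also have "\<dots> \<le> M * (4 * \<delta> * a\<^sup>2 * M * q\<^sup>2)" using var Mpos by (intro mult_left_mono) auto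
    \<comment> \<open>The origin of \<open>\<eta> = 4 * sqrt \<delta>\<close>: the variance factor
      \<open>4 * \<delta>\<close> equals \<open>(\<eta> / 2)^2\<close>.\<close>
    also have "\<dots> = (\<eta> / 2 * a * M * q)\<^sup>2"
      using \<eta>2 by (simp add: power_mult_distrib power_divide field_simps power2_eq_square)
    finally have "Z \<le> \<eta> / 2 * a * M * q"
      by (rule power2_le_imp_le) (use \<eta> ab Mpos q in simp)
    moreover have "Z = a * b * q - (\<Sum>y\<in>Y. D y)"
      by (simp add: Z_def sum_subtractf b_def)
    ultimately have 1: "a * b * q - \<eta> / 2 * a * M * q \<le> (\<Sum>y\<in>Y. D y)" by simp
    \<comment> \<open>By \<open>a b = M (a + b - M) + (M - a) (M - b)\<close>, this is what is
      missing to pass from \<open>a b q\<close> to the claim.\<close>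
    have "\<eta> / 2 * a * M \<le> (M - a) * (M - b) + \<eta> * M * (a + b - M)"
    proof (cases "a \<le> M * (1 - \<eta>)")
      case True
      then have "\<eta> * M * (M - b) \<le> (M - a) * (M - b)"
        using ab by (intro mult_right_mono) (auto simp: algebra_simps)
      moreover have "0 \<le> \<eta> * a * M" using \<eta> ab Mpos by auto
      ultimately show ?thesis by (simp add: algebra_simps)
    next
      case False
      have "\<eta> * M \<le> M / 3" using \<eta> Mpos by (simp add: field_simps)
      \<comment> \<open>Here \<open>b \<ge> a > 2 M / 3\<close>, so
        \<open>a / 2 + b \<ge> M\<close>; this uses that \<open>X\<close> is the smaller
        set.\<close>
      then have "a / 2 \<le> a + b - M" using False ab by (simp add: algebra_simps)
      then have "\<eta> * M * (a / 2) \<le> \<eta> * M * (a + b - M)" using \<eta> Mpos by (intro mult_left_mono) auto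
      moreover have "0 \<le> (M - a) * (M - b)" using ab by auto
      ultimately show ?thesis by (simp add: algebra_simps)
    qed
    then have "q * (\<eta> / 2 * a * M) \<le> q * ((M - a) * (M - b) + \<eta> * M * (a + b - M))"
      using q by (intro mult_left_mono) auto
    with 1 show ?thesis by (simp add: algebra_simps)
  qed
  then show ?thesis unfolding count by (simp add: \<eta>_def M_def a_def b_def)
qed

text \<open>The factor condition is trivial for \<open>|X| + |Y| \<le> m\<close>. Otherwise the edge
  count is applied to \<open>R\<close> or to its converse, depending on which of \<open>X\<close>
  and \<open>Y\<close> is smaller; hence degree and co-degree bounds are assumed on both
  sides.\<close>

lemma pseudo_random_bipartite_matchings:
  fixes A :: "'a set" and B :: "'b set" and \<delta> q :: real
  assumes fin: "finite A" "finite B" and card: "card A = m" "card B = m" and R: "R \<subseteq> A \<times> B"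
    and q: "0 < q" and \<delta>: "0 < \<delta>" "4 * sqrt \<delta> \<le> 1/3" and large: "1 \<le> real m * q\<^sup>2 * \<delta>\<^sup>2"
    and degA: "\<And>x. x \<in> A \<Longrightarrow> (1 - \<delta>) * real m * q \<le> real (card {y. (x, y) \<in> R})"
    and degB: "\<And>y. y \<in> B \<Longrightarrow> (1 - \<delta>) * real m * q \<le> real (card {x. (x, y) \<in> R})"
    and codegA: "\<And>x x'. x \<in> A \<Longrightarrow> x' \<in> A \<Longrightarrow> x \<noteq> x' \<Longrightarrow>
        real (card {y. (x, y) \<in> R \<and> (x', y) \<in> R}) \<le> (1 + \<delta>) * real m * q\<^sup>2"
    and codegB: "\<And>y y'. y \<in> B \<Longrightarrow> y' \<in> B \<Longrightarrow> y \<noteq> y' \<Longrightarrow>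
        real (card {x. (x, y) \<in> R \<and> (x, y') \<in> R}) \<le> (1 + \<delta>) * real m * q\<^sup>2"
    and k: "real k \<le> (1 - 4 * sqrt \<delta>) * real m * q"
  shows "\<exists>M. (\<forall>l<k. bij_betw (M l) A B \<and> (\<forall>x\<in>A. (x, M l x) \<in> R)) \<and>
             (\<forall>l<k. \<forall>l'<k. l \<noteq> l' \<longrightarrow> (\<forall>x\<in>A. M l x \<noteq> M l' x))"
proof -
  have "\<exists>S\<subseteq>R. (\<forall>x\<in>A. card {y. (x, y) \<in> S} = k) \<and> (\<forall>y\<in>B. card {x. (x, y) \<in> S} = k)"
  proof (rule bipartite_factor[OF fin card R])
    fix X Y assume X: "X \<subseteq> A" and Y: "Y \<subseteq> B"
    show "k * (card X + card Y) \<le> card (R \<inter> X \<times> Y) + k * m"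
    proof (cases "m \<le> card X + card Y")
      case False
      then have "k * (card X + card Y) \<le> k * m" by (intro mult_le_mono2) simp
      then show ?thesis by linarith
    next
      case True
      have "(1 - 4 * sqrt \<delta>) * real m * q * (real (card X) + real (card Y) - real m) \<le> real (card (R \<inter> X \<times> Y))"
      proof (cases "card X \<le> card Y")
        case le: True
        show ?thesis
          by (rule pseudo_random_edge_count[OF fin card R q \<delta> large degA codegA X Y le True])
      next
        case False
        have R': "R\<inverse> \<subseteq> B \<times> A" using R by auto
        have "(1 - 4 * sqrt \<delta>) * real m * q * (real (card Y) + real (card X) - real m) \<le> real (card (R\<inverse> \<inter> Y \<times> X))"
          by (rule pseudo_random_edge_count[OF fin(2,1) card(2,1) R' q \<delta> large])
             (use degB codegB X Y False True in auto)
        moreover have "R\<inverse> \<inter> Y \<times> X = (R \<inter> X \<times> Y)\<inverse>" by auto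
        ultimately show ?thesis by (simp add: add.commute)
      qed
      moreover have "real k * (real (card X) + real (card Y) - real m)
          \<le> (1 - 4 * sqrt \<delta>) * real m * q * (real (card X) + real (card Y) - real m)"
        using True by (intro mult_right_mono k) auto
      ultimately have "real k * (real (card X) + real (card Y)) \<le> real (card (R \<inter> X \<times> Y)) + real k * real m"
        by (simp add: algebra_simps)
      then have "real (k * (card X + card Y)) \<le> real (card (R \<inter> X \<times> Y) + k * m)" by simp
      then show ?thesis by (simp only: of_nat_le_iff)
    qed
  qed
  then obtain S where S: "S \<subseteq> R" "\<And>x. x \<in> A \<Longrightarrow> card {y. (x, y) \<in> S} = k" "\<And>y. y \<in> B \<Longrightarrow> card {x. (x, y) \<in> S} = k"
    by blast
  obtain M where "\<And>l. l < k \<Longrightarrow> bij_betw (M l) A B" "\<And>l x. l < k \<Longrightarrow> x \<in> A \<Longrightarrow> (x, M l x) \<in> S"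
    "\<And>l l' x. l < k \<Longrightarrow> l' < k \<Longrightarrow> l \<noteq> l' \<Longrightarrow> x \<in> A \<Longrightarrow> M l x \<noteq> M l' x"
    using regular_bipartite_matchings[OF fin _ _ S(2,3)] card S(1) R by (metis order_trans)
  then show ?thesis using S(1) by blast
qed

section \<open>Tree factors from perfect matchings\<close>

text \<open>Pairing a vertex list with its tail gives the arc list of the walk, the form in which
  cycles are defined.\<close>

lemma awalk_zip:
  assumes "successively (\<lambda>a b. (a, b) \<in> parcs T) (v # vs)"
  shows "pcas v (zip (v # vs) vs) (last (v # vs)) \<and> set (zip (v # vs) vs) \<subseteq> parcs T
    \<and> pawalk_verts v (zip (v # vs) vs) = v # vs"
  using assms by (induction vs arbitrary: v) auto

text \<open>Simple paths as vertex lists, which are easy to extend and to reverse.\<close>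

definition path_in :: "'b pair_pre_digraph \<Rightarrow> 'b set \<Rightarrow> 'b \<Rightarrow> 'b \<Rightarrow> 'b list \<Rightarrow> bool" where
  "path_in T S u v vs \<longleftrightarrow> vs \<noteq> [] \<and> hd vs = u \<and> last vs = v \<and> distinct vs \<and> set vs \<subseteq> S \<and>
     successively (\<lambda>a b. (a, b) \<in> parcs T) vs"

lemma path_in_snoc:
  assumes "path_in T S u v vs" "(v, w) \<in> parcs T" "w \<notin> S"
  shows "path_in T (insert w S) u w (vs @ [w])"
  using assms by (auto simp: path_in_def successively_append_iff)

lemma path_in_rev:
  assumes "pair_graph T" "path_in T S u v vs"
  shows "path_in T S v u (rev vs)"
proof -
  interpret pair_graph T by fact
  have "successively (\<lambda>a b. (b, a) \<in> parcs T) vs"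
    by (rule successively_mono[where P="\<lambda>a b. (a, b) \<in> parcs T"])
       (use assms(2) in \<open>auto simp: path_in_def dest: arcs_symmetric\<close>)
  then show ?thesis using assms(2)
    unfolding path_in_def by (simp add: hd_rev last_rev)
qed

text \<open>The path from \<open>u\<close> to \<open>v\<close> closes up through \<open>w\<close> to
  a cycle. Since \<open>u \<noteq> v\<close>, it has length at least 3 and is not the degenerate
  cycle along a single edge.\<close>

lemma tree_no_two_neighbours:
  assumes tree: "undirected_tree T" and path: "path_in T S u v vs" and "u \<noteq> v"
    and w: "w \<notin> S" "(u, w) \<in> parcs T" "(v, w) \<in> parcs T"
  shows False
proof -
  interpret pair_graph T using tree by (simp add: undirected_tree_def)
  obtain vs' where vs: "vs = u # vs'" using path by (cases vs) (auto simp: path_in_def)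
  have "vs' \<noteq> []" using path vs \<open>u \<noteq> v\<close> by (auto simp: path_in_def)
  define c where "c = zip (w # vs @ [w]) (vs @ [w])"
  have "successively (\<lambda>a b. (a, b) \<in> parcs T) (w # vs @ [w])"
    using path w arcs_symmetric[OF w(2)] by (simp add: path_in_def successively_append_iff successively_Cons)
  from awalk_zip[OF this] have c: "pcas w c w" "set c \<subseteq> parcs T" "pawalk_verts w c = w # vs @ [w]"
    by (auto simp: c_def)
  have "cycle c"
    unfolding cycle_def
    using c path w by (intro exI[of _ w]) (auto simp: awalk_def path_in_def c_def dest: wellformed')
  moreover have "3 \<le> length c" using \<open>vs' \<noteq> []\<close> vs by (cases vs') (auto simp: c_def)
  ultimately show False using tree by (auto simp: undirected_tree_def)
qed

lemma connected_exit_arc: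
  assumes "pair_graph T" "Digraph_Component.connected (with_proj T)" "r \<in> S" "S \<subset> pverts T"
  shows "\<exists>u\<in>S. \<exists>w\<in>pverts T - S. (u, w) \<in> parcs T"
proof (rule ccontr)
  interpret pair_graph T by fact
  assume no: "\<not> ?thesis"
  obtain w where w: "w \<in> pverts T" "w \<notin> S" using assms(4) by blast
  have "(r, w) \<in> rtrancl_on (pverts T) (symcl (parcs T))"
    using assms w by (auto simp: connected_conv)
  then have "w \<in> S"
  proof (induction rule: rtrancl_on_induct)
    case (step y z)
    then have "(y, z) \<in> parcs T" by (auto simp: symcl_def dest: arcs_symmetric)
    then show ?case using step no by auto
  qed (use assms in auto)
  then show False using w by simp
qed

lemma tree_arc_exists:
  assumes "undirected_tree T" "card (pverts T) \<ge> 2"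
  shows "parcs T \<noteq> {}"
proof -
  obtain r where r: "r \<in> pverts T" using assms(2) by (cases "pverts T = {}") auto
  have "pverts T \<noteq> {r}" using assms(2) by auto
  then have "{r} \<subset> pverts T" using r by auto
  then show ?thesis
    using connected_exit_arc[of T r "{r}"] assms(1) by (auto simp: undirected_tree_def)
qed

text \<open>
  Bijections prescribed along the edges of a tree fit together, because a set of vertices
  that induces a subtree can be enlarged by a vertex which has only one neighbour in it.
\<close>

lemma tree_compatible_bijections:
  fixes C :: "'b \<Rightarrow> 'a set" and \<mu> :: "'b \<Rightarrow> 'b \<Rightarrow> 'a \<Rightarrow> 'a"
  assumes tree: "undirected_tree T" and r: "r \<in> pverts T"
    and bij: "\<And>i j. (i, j) \<in> parcs T \<Longrightarrow> bij_betw (\<mu> i j) (C i) (C j)"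
    and inv: "\<And>i j x. (i, j) \<in> parcs T \<Longrightarrow> x \<in> C i \<Longrightarrow> \<mu> j i (\<mu> i j x) = x"
  shows "\<exists>\<phi>. (\<forall>i\<in>pverts T. bij_betw (\<phi> i) (C r) (C i)) \<and>
             (\<forall>i j. (i, j) \<in> parcs T \<longrightarrow> (\<forall>x\<in>C r. \<mu> i j (\<phi> i x) = \<phi> j x))"
proof -
  have pg: "pair_graph T" and conn: "Digraph_Component.connected (with_proj T)"
    using tree by (auto simp: undirected_tree_def)
  interpret pair_graph T by fact
  \<comment> \<open>Besides the bijections, a good set must have a path inside it between any two of
    its vertices. This makes a second neighbour of an added vertex close a cycle. A maximal good set
    is then shown to be everything.\<close>
  define good where "good S \<longleftrightarrow> S \<subseteq> pverts T \<and> r \<in> S \<and> (\<forall>u\<in>S. \<forall>v\<in>S. \<exists>vs. path_in T S u v vs) \<and>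
    (\<exists>\<phi>. (\<forall>i\<in>S. bij_betw (\<phi> i) (C r) (C i)) \<and>
       (\<forall>i\<in>S. \<forall>j\<in>S. (i, j) \<in> parcs T \<longrightarrow> (\<forall>x\<in>C r. \<mu> i j (\<phi> i x) = \<phi> j x)))" for S
  have "good {r}"
    unfolding good_def
  proof (intro conjI exI[of _ "\<lambda>_ x. x"] ballI)
    show "\<exists>vs. path_in T {r} u v vs" if "u \<in> {r}" "v \<in> {r}" for u v
      using that by (intro exI[of _ "[r]"]) (auto simp: path_in_def)
  qed (use r no_loops' in \<open>auto simp: bij_betw_def\<close>)
  moreover have "finite {S. good S}"
    using pair_finite_verts by (rule_tac finite_subset[of _ "Pow (pverts T)"]) (auto simp: good_def)
  ultimately obtain S where S: "good S" and max: "\<And>S'. good S' \<Longrightarrow> S \<subseteq> S' \<Longrightarrow> S' = S"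
    using finite_has_maximal[of "{S. good S}"] by auto
  obtain \<phi> where \<phi>: "\<And>i. i \<in> S \<Longrightarrow> bij_betw (\<phi> i) (C r) (C i)"
    "\<And>i j x. i \<in> S \<Longrightarrow> j \<in> S \<Longrightarrow> (i, j) \<in> parcs T \<Longrightarrow> x \<in> C r \<Longrightarrow> \<mu> i j (\<phi> i x) = \<phi> j x"
    using S unfolding good_def by blast
  have "S = pverts T"
  proof (rule ccontr)
    assume "S \<noteq> pverts T"
    then have "S \<subset> pverts T" using S by (auto simp: good_def)
    then obtain u w where uw: "u \<in> S" "w \<in> pverts T" "w \<notin> S" "(u, w) \<in> parcs T"
      using connected_exit_arc[OF pg conn, of r S] S by (auto simp: good_def)
    have only: "v = u" if v: "v \<in> S" "(v, w) \<in> parcs T" for v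
    proof (rule ccontr)
      assume "v \<noteq> u"
      obtain vs where "path_in T S v u vs" using S v(1) uw(1) unfolding good_def by blast
      then show False using tree_no_two_neighbours[OF tree] uw v \<open>v \<noteq> u\<close> by blast
    qed
    have paths: "\<exists>vs. path_in T (insert w S) a b vs" if "a \<in> insert w S" "b \<in> insert w S" for a b
    proof -
      have in_S: "\<exists>vs. path_in T (insert w S) a b vs" if "a \<in> S" "b \<in> S" for a b
        using S that unfolding good_def path_in_def by (metis subset_insertI2)
      have to_w: "\<exists>vs. path_in T (insert w S) a w vs" if "a \<in> S" for a
        using S that uw path_in_snoc unfolding good_def by metis
      have ww: "path_in T (insert w S) w w [w]" by (auto simp: path_in_def)
      show ?thesis
        using that in_S to_w ww path_in_rev[OF pg] by (metis insertE)
    qed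
    \<comment> \<open>The new bijection is forced by the only arc joining \<open>w\<close> to
      \<open>S\<close>.\<close>
    define \<psi> where "\<psi> = \<phi>(w := \<mu> u w \<circ> \<phi> u)"
    have "good (insert w S)"
      unfolding good_def
    proof (intro conjI exI[of _ \<psi>] ballI impI)
      fix i assume i: "i \<in> insert w S"
      show "bij_betw (\<psi> i) (C r) (C i)"
        using i \<phi>(1) bij_betw_trans[OF \<phi>(1)[OF uw(1)] bij[OF uw(4)]] by (auto simp: \<psi>_def)
    next
      fix i j x assume ij: "i \<in> insert w S" "j \<in> insert w S" "(i, j) \<in> parcs T" and x: "x \<in> C r"
      have "i \<noteq> j" using ij(3) no_loops' by blast
      then consider "i \<in> S" "j \<in> S" "i \<noteq> w" "j \<noteq> w" | "i = u" "j = w" | "i = w" "j = u"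
        using ij uw only by (metis arcs_symmetric insertE)
      then show "\<mu> i j (\<psi> i x) = \<psi> j x"
      proof cases
        case 3
        have "\<phi> u x \<in> C u" using \<phi>(1)[OF uw(1)] x by (auto simp: bij_betw_def)
        then show ?thesis using inv[OF uw(4)] uw 3 by (auto simp: \<psi>_def)
      qed (use \<phi>(2) ij x uw in \<open>auto simp: \<psi>_def\<close>)
    qed (use S uw paths in \<open>auto simp: good_def\<close>)
    then show False using max[of "insert w S"] uw by auto
  qed
  then show ?thesis using \<phi> wellformed' by (intro exI[of _ \<phi>]) metis
qed

text \<open>Each \<open>x\<close> in the root class carries the copy of \<open>T\<close> with
  vertices \<open>\<phi> i x\<close>. Disjoint classes and injective maps make the copies disjoint,
  and equal class sizes make them cover \<open>G\<close>.\<close>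

lemma tree_factor_of_bijections:
  fixes C :: "'b \<Rightarrow> 'a set"
  assumes T: "pair_graph T" and G: "pair_graph G" and r: "r \<in> pverts T"
    and C: "(\<Union>i\<in>pverts T. C i) = pverts G" "\<And>i j. i \<in> pverts T \<Longrightarrow> j \<in> pverts T \<Longrightarrow> i \<noteq> j \<Longrightarrow> C i \<inter> C j = {}"
    and bij: "\<And>i. i \<in> pverts T \<Longrightarrow> bij_betw (\<phi> i) (C r) (C i)"
    and arcs: "\<And>i j x. (i, j) \<in> parcs T \<Longrightarrow> x \<in> C r \<Longrightarrow> (\<phi> i x, \<phi> j x) \<in> parcs G"
  shows "\<exists>F. graph_factor T G F \<and> factor_edges F = {{\<phi> i x, \<phi> j x} | i j x. (i, j) \<in> parcs T \<and> x \<in> C r}"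
proof -
  interpret T: pair_graph T by fact
  interpret G: pair_graph G by fact
  define K where "K x = \<lparr>pverts = (\<lambda>i. \<phi> i x) ` pverts T, parcs = (\<lambda>(i, j). (\<phi> i x, \<phi> j x)) ` parcs T\<rparr>" for x
  define F where "F = K ` C r"
  have mem: "\<phi> i x \<in> C i" if "i \<in> pverts T" "x \<in> C r" for i x using bij[of i] that by (auto simp: bij_betw_def)
  have eqD: "i = j \<and> x = y" if "i \<in> pverts T" "j \<in> pverts T" "x \<in> C r" "y \<in> C r" "\<phi> i x = \<phi> j y" for i j x y
  proof -
    have "i = j" using mem[of i x] mem[of j y] that C(2)[of i j] by force
    then show ?thesis using bij[of i] that by (auto simp: bij_betw_def inj_on_def)
  qed
  have disj: "pverts (K x) \<inter> pverts (K y) = {}" if "x \<in> C r" "y \<in> C r" "x \<noteq> y" for x y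
    using eqD that by (fastforce simp: K_def)
  have pgK: "pair_graph (K x)" if x: "x \<in> C r" for x
  proof
    show "finite (pverts (K x))" "finite (parcs (K x))"
      using T.pair_finite_verts T.pair_finite_arcs by (auto simp: K_def)
    show "symmetric (with_proj (K x))"
      unfolding symmetric_def by (auto simp: K_def intro!: symI dest: T.arcs_symmetric)
    fix e assume e: "e \<in> parcs (K x)"
    then show "fst e \<in> pverts (K x)" "snd e \<in> pverts (K x)"
      by (auto simp: K_def dest: T.wellformed')
    show "fst e \<noteq> snd e"
      using e arcs[OF _ x] G.no_loops' by (fastforce simp: K_def)
  qed
  have sub: "subgraph (with_proj (K x)) (with_proj G)" if x: "x \<in> C r" for x
  proof -
    interpret K: pair_graph "K x" using pgK[OF x] .
    have "pverts (K x) \<subseteq> pverts G" using mem[OF _ x] C(1) by (auto simp: K_def)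
    moreover have "parcs (K x) \<subseteq> parcs G" using arcs[OF _ x] by (auto simp: K_def)
    ultimately show ?thesis
      unfolding subgraph_def compatible_def by (simp add: G.wf_digraph_axioms K.wf_digraph_axioms)
  qed
  have iso: "digraph_iso (with_proj T) (with_proj (K x))" if x: "x \<in> C r" for x
    unfolding digraph_iso_def
  proof (intro exI conjI)
    define h :: "('b, 'b \<times> 'b, 'a, 'a \<times> 'a) digraph_isomorphism" where
      "h = \<lparr>iso_verts = \<lambda>i. \<phi> i x, iso_arcs = \<lambda>(i, j). (\<phi> i x, \<phi> j x), iso_head = snd, iso_tail = fst\<rparr>"
    show "pre_digraph.digraph_isomorphism (with_proj T) h"
      unfolding pre_digraph.digraph_isomorphism_def
      using eqD[OF _ _ x x] by (auto simp: h_def inj_on_def T.wf_digraph_axioms dest: T.wellformed')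
    show "with_proj (K x) = app_iso h (with_proj T)"
      by (simp add: app_iso_def h_def K_def with_proj_def)
  qed
  have inj: "inj_on K (C r)"
  proof (rule inj_onI)
    fix x y assume xy: "x \<in> C r" "y \<in> C r" "K x = K y"
    have "\<phi> r x \<in> pverts (K x)" using r by (auto simp: K_def)
    then show "x = y" using disj[of x y] xy by auto
  qed
  have finC: "finite (C i)" if "i \<in> pverts T" for i
    using C(1) that G.pair_finite_verts by (metis UN_upper finite_subset)
  have "card F * card (pverts T) = card (pverts G)"
  proof -
    have "card (pverts G) = (\<Sum>i\<in>pverts T. card (C i))"
      unfolding C(1)[symmetric] using T.pair_finite_verts finC C(2) by (intro card_UN_disjoint) auto
    also have "\<dots> = (\<Sum>i\<in>pverts T. card (C r))"
      by (intro sum.cong refl bij_betw_same_card[OF bij, symmetric])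
    finally show ?thesis by (simp add: F_def card_image[OF inj])
  qed
  then have "graph_factor T G F"
    unfolding graph_factor_def using pgK sub iso disj unfolding F_def by blast
  moreover have "factor_edges F = {{\<phi> i x, \<phi> j x} | i j x. (i, j) \<in> parcs T \<and> x \<in> C r}"
    unfolding factor_edges_def edges_def F_def K_def by fastforce
  ultimately show ?thesis by blast
qed

lemma card_sym_rel:
  assumes "finite O'" "sym O'" "irrefl O'"
  shows "card O' = 2 * card ((\<lambda>(a, b). {a, b}) ` O')"
proof -
  let ?f = "\<lambda>(a, b). {a, b}"
  have "card O' = (\<Sum>e\<in>?f ` O'. card {z \<in> O'. ?f z = e})"
    unfolding card_eq_sum by (rule sum.image_gen[OF assms(1)])
  also have "\<dots> = (\<Sum>e\<in>?f ` O'. 2)"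
  proof (intro sum.cong refl)
    fix e assume "e \<in> ?f ` O'"
    then obtain a b where ab: "(a, b) \<in> O'" "e = {a, b}" by auto
    have "a \<noteq> b" "(b, a) \<in> O'" using ab assms by (auto simp: irrefl_def dest: symD)
    then have "{z \<in> O'. ?f z = e} = {(a, b), (b, a)}" using ab by (auto simp: doubleton_eq_iff)
    then show "card {z \<in> O'. ?f z = e} = 2" using \<open>a \<noteq> b\<close> by simp
  qed
  finally show ?thesis by simp
qed

lemma edges_eq_image: "edges G = (\<lambda>(a, b). {a, b}) ` parcs G"
  by (auto simp: edges_def)

lemma sym_irrefl_parcs:
  assumes "pair_graph G"
  shows "sym (parcs G)" "irrefl (parcs G)" "finite (parcs G)" "parcs G \<subseteq> pverts G \<times> pverts G"
proof -
  interpret pair_graph G by fact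
  show "sym (parcs G)" "irrefl (parcs G)" "finite (parcs G)" "parcs G \<subseteq> pverts G \<times> pverts G"
    using pair_finite_arcs by (auto intro!: symI irreflI dest: arcs_symmetric no_loops' wellformed')
qed

text \<open>Between the classes of every two adjacent tree vertices there are \<open>k\<close>
  disjoint perfect matchings inside \<open>Q\<close>; the \<open>l\<close>-th matchings of all tree
  edges together form the \<open>l\<close>-th factor.\<close>

lemma tree_factors_of_labelling:
  fixes T :: "'b pair_pre_digraph" and G :: "'a pair_pre_digraph" and \<delta> q :: real
    and h :: "'b \<Rightarrow> nat" and lab :: "'a \<Rightarrow> nat" and t m k :: nat
  assumes tree: "undirected_tree T" and h: "bij_betw h (pverts T) {..<t}" and t: "0 < t"
    and G: "pair_graph G" and lab: "\<And>v. lab v < t" "\<And>i. i < t \<Longrightarrow> card {v \<in> pverts G. lab v = i} = m"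
    and Q: "Q \<subseteq> parcs G" "sym Q"
    and q: "0 < q" and \<delta>: "0 < \<delta>" "4 * sqrt \<delta> \<le> 1/3" and large: "1 \<le> real m * q\<^sup>2 * \<delta>\<^sup>2"
    and deg: "\<And>i j v. (i, j) \<in> parcs T \<Longrightarrow> v \<in> pverts G \<Longrightarrow> lab v = h i \<Longrightarrow>
        (1 - \<delta>) * real m * q \<le> real (card {w. (v, w) \<in> Q \<and> lab w = h j})"
    and codeg: "\<And>i j u v. (i, j) \<in> parcs T \<Longrightarrow> u \<in> pverts G \<Longrightarrow> v \<in> pverts G \<Longrightarrow> lab u = h i \<Longrightarrow> lab v = h i \<Longrightarrow>
        u \<noteq> v \<Longrightarrow> real (card {w. (u, w) \<in> Q \<and> (v, w) \<in> Q \<and> lab w = h j}) \<le> (1 + \<delta>) * real m * q\<^sup>2"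
    and k: "real k \<le> (1 - 4 * sqrt \<delta>) * real m * q"
  shows "\<exists>F. \<forall>l<k. graph_factor T G (F l) \<and> factor_edges (F l) \<subseteq> (\<lambda>(x, y). {x, y}) ` Q \<and>
     2 * card (factor_edges (F l)) = card (parcs T) * m \<and>
     (\<forall>l'<k. l \<noteq> l' \<longrightarrow> factor_edges (F l) \<inter> factor_edges (F l') = {})"
proof -
  have pgT: "pair_graph T" using tree by (simp add: undirected_tree_def)
  interpret T: pair_graph T by fact
  interpret G: pair_graph G by fact
  define C where "C i = {v \<in> pverts G. lab v = h i}" for i
  have hinj: "i = j" if "i \<in> pverts T" "j \<in> pverts T" "h i = h j" for i j
    using h that by (auto simp: bij_betw_def inj_on_def)
  have hless: "h i < t" if "i \<in> pverts T" for i using h that by (auto simp: bij_betw_def)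
  have finC: "finite (C i)" for i using G.pair_finite_verts by (simp add: C_def)
  have cardC: "card (C i) = m" if "i \<in> pverts T" for i using lab(2) hless that by (simp add: C_def)
  have Cdisj: "i = j" if "v \<in> C i" "v \<in> C j" "i \<in> pverts T" "j \<in> pverts T" for i j v
    using that hinj by (auto simp: C_def)
  have verts: "i \<in> pverts T" "j \<in> pverts T" "i \<noteq> j" "h i \<noteq> h j" if "(i, j) \<in> parcs T" for i j
    using that T.wellformed' T.no_loops' hinj by blast+
  have Qv: "x \<in> pverts G" "y \<in> pverts G" if "(x, y) \<in> Q" for x y
    using that Q(1) G.wellformed' by blast+
  have "\<exists>M. (\<forall>l<k. bij_betw (M l) (C i) (C j) \<and> (\<forall>x\<in>C i. (x, M l x) \<in> Q)) \<and>
             (\<forall>l<k. \<forall>l'<k. l \<noteq> l' \<longrightarrow> (\<forall>x\<in>C i. M l x \<noteq> M l' x))" if ij: "(i, j) \<in> parcs T" for i j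
  proof -
    have ji: "(j, i) \<in> parcs T" using ij by (rule T.arcs_symmetric)
    have left: "{y. (x, y) \<in> Q \<inter> C i \<times> C j} = {w. (x, w) \<in> Q \<and> lab w = h j}" if "x \<in> C i" for x
      using that Qv by (auto simp: C_def)
    have right: "{x. (x, y) \<in> Q \<inter> C i \<times> C j} = {w. (y, w) \<in> Q \<and> lab w = h i}" if "y \<in> C j" for y
      using that Qv Q(2) by (auto simp: C_def dest: symD)
    have "\<exists>M. (\<forall>l<k. bij_betw (M l) (C i) (C j) \<and> (\<forall>x\<in>C i. (x, M l x) \<in> Q \<inter> C i \<times> C j)) \<and>
             (\<forall>l<k. \<forall>l'<k. l \<noteq> l' \<longrightarrow> (\<forall>x\<in>C i. M l x \<noteq> M l' x))"
    proof (rule pseudo_random_bipartite_matchings[OF finC finC cardC cardC _ q \<delta> large _ _ _ _ k])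
      show "i \<in> pverts T" "j \<in> pverts T" using verts ij by blast+
      show "(1 - \<delta>) * real m * q \<le> real (card {y. (x, y) \<in> Q \<inter> C i \<times> C j})" if "x \<in> C i" for x
        using deg[OF ij, of x] that by (simp only: left) (simp add: C_def)
      show "(1 - \<delta>) * real m * q \<le> real (card {x. (x, y) \<in> Q \<inter> C i \<times> C j})" if "y \<in> C j" for y
        using deg[OF ji, of y] that by (simp only: right) (simp add: C_def)
    next
      fix x x' assume x: "x \<in> C i" "x' \<in> C i" "x \<noteq> x'"
      have "{y. (x, y) \<in> Q \<inter> C i \<times> C j \<and> (x', y) \<in> Q \<inter> C i \<times> C j} = {w. (x, w) \<in> Q \<and> (x', w) \<in> Q \<and> lab w = h j}"
        using left[OF x(1)] left[OF x(2)] by blast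
      then show "real (card {y. (x, y) \<in> Q \<inter> C i \<times> C j \<and> (x', y) \<in> Q \<inter> C i \<times> C j}) \<le> (1 + \<delta>) * real m * q\<^sup>2"
        using codeg[OF ij, of x x'] x by (simp add: C_def)
    next
      fix y y' assume y: "y \<in> C j" "y' \<in> C j" "y \<noteq> y'"
      have "{x. (x, y) \<in> Q \<inter> C i \<times> C j \<and> (x, y') \<in> Q \<inter> C i \<times> C j} = {w. (y, w) \<in> Q \<and> (y', w) \<in> Q \<and> lab w = h i}"
        using right[OF y(1)] right[OF y(2)] by blast
      then show "real (card {x. (x, y) \<in> Q \<inter> C i \<times> C j \<and> (x, y') \<in> Q \<inter> C i \<times> C j}) \<le> (1 + \<delta>) * real m * q\<^sup>2"
        using codeg[OF ji, of y y'] y by (simp add: C_def)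
    qed auto
    then show ?thesis by blast
  qed
  then obtain M where M: "\<And>i j. (i, j) \<in> parcs T \<Longrightarrow> (\<forall>l<k. bij_betw (M i j l) (C i) (C j) \<and> (\<forall>x\<in>C i. (x, M i j l x) \<in> Q)) \<and>
             (\<forall>l<k. \<forall>l'<k. l \<noteq> l' \<longrightarrow> (\<forall>x\<in>C i. M i j l x \<noteq> M i j l' x))"
    by metis
  have M1: "bij_betw (M i j l) (C i) (C j)" if "(i, j) \<in> parcs T" "l < k" for i j l using M that by blast
  have M2: "(x, M i j l x) \<in> Q" if "(i, j) \<in> parcs T" "l < k" "x \<in> C i" for i j l x using M that by blast
  have M3: "M i j l x \<noteq> M i j l' x" if "(i, j) \<in> parcs T" "l < k" "l' < k" "l \<noteq> l'" "x \<in> C i" for i j l l' x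
    using M that by blast
  \<comment> \<open>The matchings for the arcs \<open>(i, j)\<close> and \<open>(j, i)\<close> were
    chosen separately. The order of labels selects one of them, and its inverse serves the opposite
    arc.\<close>
  define \<mu> where "\<mu> l i j = (if h i < h j then M i j l else inv_into (C j) (M j i l))" for l i j
  have bij: "bij_betw (\<mu> l i j) (C i) (C j)" if "(i, j) \<in> parcs T" "l < k" for l i j
    using M1[of i j l] M1[of j i l] that T.arcs_symmetric[OF that(1)] by (auto simp: \<mu>_def bij_betw_inv_into)
  have inv: "\<mu> l j i (\<mu> l i j x) = x" if "(i, j) \<in> parcs T" "l < k" "x \<in> C i" for l i j x
    using M1[OF that(1,2)] M1[OF T.arcs_symmetric[OF that(1)] that(2)] that(3) verts(4)[OF that(1)]
    by (cases "h i < h j") (simp_all add: \<mu>_def bij_betw_inv_into_left bij_betw_inv_into_right)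
  have \<mu>Q: "(x, \<mu> l i j x) \<in> Q" if a: "(i, j) \<in> parcs T" "l < k" "x \<in> C i" for l i j x
  proof (cases "h i < h j")
    case True
    then show ?thesis using M2 a by (simp add: \<mu>_def)
  next
    case False
    have ji: "(j, i) \<in> parcs T" using a(1) by (rule T.arcs_symmetric)
    have "inv_into (C j) (M j i l) x \<in> C j" using bij_betw_inv_into[OF M1[OF ji a(2)]] a(3) by (auto simp: bij_betw_def)
    from M2[OF ji a(2) this] have "(inv_into (C j) (M j i l) x, x) \<in> Q"
      using bij_betw_inv_into_right[OF M1[OF ji a(2)] a(3)] by simp
    then show ?thesis using Q(2) False by (auto simp: \<mu>_def dest: symD)
  qed
  have \<mu>C: "\<mu> l i j x \<in> C j" if "(i, j) \<in> parcs T" "l < k" "x \<in> C i" for l i j x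
    using bij[OF that(1,2)] that(3) by (auto simp: bij_betw_def)
  have \<mu>ne: "\<mu> l i j x \<noteq> \<mu> l' i j x" if a: "(i, j) \<in> parcs T" "l < k" "l' < k" "l \<noteq> l'" "x \<in> C i" for l l' i j x
  proof (cases "h i < h j")
    case True
    then show ?thesis using M3 a by (simp add: \<mu>_def)
  next
    case False
    then have lt: "h j < h i" using verts(4)[OF a(1)] by simp
    have ji: "(j, i) \<in> parcs T" using a(1) by (rule T.arcs_symmetric)
    show ?thesis
    proof
      assume eq: "\<mu> l i j x = \<mu> l' i j x"
      \<comment> \<open>If two inverse matchings agree at \<open>x\<close>, the matchings themselves
        agree at the common value.\<close>
      have "\<mu> l j i (\<mu> l i j x) = \<mu> l' j i (\<mu> l i j x)" 
        using inv[OF a(1,2,5)] inv[OF a(1,3,5)] by (simp only: eq)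
      then show False using M3[OF ji a(2-4) \<mu>C[OF a(1,2,5)]] lt by (simp add: \<mu>_def)
    qed
  qed
  obtain r where r: "r \<in> pverts T" using h t by (auto simp: bij_betw_def)
  have UN: "(\<Union>i\<in>pverts T. C i) = pverts G"
  proof -
    have "\<exists>i\<in>pverts T. lab v = h i" for v using lab(1)[of v] h by (auto simp: bij_betw_def image_iff set_eq_iff)
    then show ?thesis by (auto simp: C_def)
  qed
  \<comment> \<open>The arcs of the \<open>l\<close>-th factor in both orientations, expressed by
    the matchings alone; disjointness and size are then seen without the maps
    \<open>\<phi>\<close>.\<close>
  define O' where "O' l = {(x, \<mu> l i j x) | i j x. (i, j) \<in> parcs T \<and> x \<in> C i}" for l
  have "\<exists>F. graph_factor T G F \<and> factor_edges F = (\<lambda>(x, y). {x, y}) ` O' l" if l: "l < k" for l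
  proof -
    obtain \<phi> where \<phi>: "\<And>i. i \<in> pverts T \<Longrightarrow> bij_betw (\<phi> i) (C r) (C i)"
      "\<And>i j x. (i, j) \<in> parcs T \<Longrightarrow> x \<in> C r \<Longrightarrow> \<mu> l i j (\<phi> i x) = \<phi> j x"
      using tree_compatible_bijections[OF tree r, of "\<mu> l" C] bij inv l by metis
    have \<phi>C: "\<phi> i x \<in> C i" if "i \<in> pverts T" "x \<in> C r" for i x
      using \<phi>(1)[OF that(1)] that(2) by (auto simp: bij_betw_def)
    have "\<exists>F. graph_factor T G F \<and> factor_edges F = {{\<phi> i x, \<phi> j x} | i j x. (i, j) \<in> parcs T \<and> x \<in> C r}"
    proof (rule tree_factor_of_bijections[OF pgT G r UN _ \<phi>(1)])
      show "C i \<inter> C j = {}" if "i \<in> pverts T" "j \<in> pverts T" "i \<noteq> j" for i j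
        using Cdisj that by blast
      show "(\<phi> i x, \<phi> j x) \<in> parcs G" if a: "(i, j) \<in> parcs T" "x \<in> C r" for i j x
        using \<mu>Q[OF a(1) l \<phi>C[OF verts(1)[OF a(1)] a(2)]] \<phi>(2)[OF a] Q(1) by auto
    qed
    moreover have eq: "{{\<phi> i x, \<phi> j x} | i j x. (i, j) \<in> parcs T \<and> x \<in> C r} = (\<lambda>(x, y). {x, y}) ` O' l"
    proof (intro equalityI subsetI)
      fix e assume "e \<in> {{\<phi> i x, \<phi> j x} | i j x. (i, j) \<in> parcs T \<and> x \<in> C r}"
      then obtain i j x where a: "(i, j) \<in> parcs T" "x \<in> C r" "e = {\<phi> i x, \<phi> j x}" by blast
      then have "(\<phi> i x, \<mu> l i j (\<phi> i x)) \<in> O' l" using \<phi>C verts(1) unfolding O'_def by blast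
      then show "e \<in> (\<lambda>(x, y). {x, y}) ` O' l" using a \<phi>(2) by force
    next
      fix e assume "e \<in> (\<lambda>(x, y). {x, y}) ` O' l"
      then obtain i j y where a: "(i, j) \<in> parcs T" "y \<in> C i" "e = {y, \<mu> l i j y}" unfolding O'_def by auto
      have "y \<in> \<phi> i ` C r" using \<phi>(1)[OF verts(1)[OF a(1)]] a(2) by (simp add: bij_betw_def)
      then obtain x where x: "x \<in> C r" "\<phi> i x = y" by blast
      then have "e = {\<phi> i x, \<phi> j x}" using a(3) \<phi>(2)[OF a(1) x(1)] by simp
      then show "e \<in> {{\<phi> i x, \<phi> j x} | i j x. (i, j) \<in> parcs T \<and> x \<in> C r}" using a(1) x(1) by blast
    qed
    ultimately show ?thesis by (simp only: eq)
  qed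
  then obtain F where F: "\<And>l. l < k \<Longrightarrow> graph_factor T G (F l)"
    "\<And>l. l < k \<Longrightarrow> factor_edges (F l) = (\<lambda>(x, y). {x, y}) ` O' l"
    by metis
  have O_sub: "O' l \<subseteq> Q" if "l < k" for l using \<mu>Q that by (auto simp: O'_def)
  have O_sym: "sym (O' l)" if l: "l < k" for l
  proof (rule symI)
    fix x y assume "(x, y) \<in> O' l"
    then obtain i j where a: "(i, j) \<in> parcs T" "x \<in> C i" "y = \<mu> l i j x" by (auto simp: O'_def)
    then have "(j, i) \<in> parcs T" "y \<in> C j" "x = \<mu> l j i y"
      using \<mu>C[OF a(1) l a(2)] inv[OF a(1) l a(2)] T.arcs_symmetric[OF a(1)] by simp_all
    then show "(y, x) \<in> O' l" unfolding O'_def by blast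
  qed
  have O_disj: "O' l \<inter> O' l' = {}" if "l < k" "l' < k" "l \<noteq> l'" for l l'
  proof -
    have False if z: "(x, y) \<in> O' l" "(x, y) \<in> O' l'" for x y
    proof -
      obtain i j where a: "(i, j) \<in> parcs T" "x \<in> C i" "y = \<mu> l i j x" using z by (auto simp: O'_def)
      obtain i' j' where b: "(i', j') \<in> parcs T" "x \<in> C i'" "y = \<mu> l' i' j' x" using z by (auto simp: O'_def)
      have "i = i'" by (rule Cdisj[OF a(2) b(2) verts(1)[OF a(1)] verts(1)[OF b(1)]])
      moreover have "y \<in> C j" using \<mu>C[OF a(1) \<open>l < k\<close> a(2)] a(3) by simp
      moreover have "y \<in> C j'" using \<mu>C[OF b(1) \<open>l' < k\<close> b(2)] b(3) by simp
      moreover from calculation have "j = j'" using Cdisj verts(2)[OF a(1)] verts(2)[OF b(1)] by blast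
      ultimately show False using \<mu>ne[OF a(1) \<open>l < k\<close> \<open>l' < k\<close> \<open>l \<noteq> l'\<close> a(2)] a b by simp
    qed
    then show ?thesis by auto
  qed
  have O_card: "card (O' l) = card (parcs T) * m" if l: "l < k" for l
  proof -
    have "O' l = (\<lambda>((i, j), x). (x, \<mu> l i j x)) ` (SIGMA z:parcs T. C (fst z))" unfolding O'_def by force
    moreover have "inj_on (\<lambda>((i, j), x). (x, \<mu> l i j x)) (SIGMA z:parcs T. C (fst z))"
    proof (rule inj_onI)
      fix z z' assume z: "z \<in> (SIGMA z:parcs T. C (fst z))" "z' \<in> (SIGMA z:parcs T. C (fst z))"
        and eq: "(\<lambda>((i, j), x). (x, \<mu> l i j x)) z = (\<lambda>((i, j), x). (x, \<mu> l i j x)) z'"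
      obtain i j x i' j' x' where [simp]: "z = ((i, j), x)" "z' = ((i', j'), x')"
        by (cases z, cases z') auto
      have a: "(i, j) \<in> parcs T" "x \<in> C i" "(i', j') \<in> parcs T" "x' \<in> C i'" "x = x'" "\<mu> l i j x = \<mu> l i' j' x'"
        using z eq by auto
      have "i = i'" using Cdisj[of x i i'] a verts(1)[OF a(1)] verts(1)[OF a(3)] by simp
      moreover have "\<mu> l i j x \<in> C j" using \<mu>C[OF a(1) l a(2)] .
      moreover have "\<mu> l i j x \<in> C j'" using \<mu>C[OF a(3) l a(4)] a(6) by simp
      moreover from calculation have "j = j'" using Cdisj verts(2)[OF a(1)] verts(2)[OF a(3)] by blast
      ultimately show "z = z'" using a(5) by simp
    qed
    ultimately have "card (O' l) = card (SIGMA z:parcs T. C (fst z))" by (simp add: card_image)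
    also have "\<dots> = (\<Sum>z\<in>parcs T. card (C (fst z)))" using T.pair_finite_arcs finC by simp
    also have "\<dots> = (\<Sum>z\<in>parcs T. m)" by (intro sum.cong cardC refl) (metis prod.collapse verts(1))
    finally show ?thesis by simp
  qed
  show ?thesis
  proof (intro exI[of _ F] allI impI conjI)
    fix l assume l: "l < k"
    show "graph_factor T G (F l)" using F l by simp
    show "factor_edges (F l) \<subseteq> (\<lambda>(x, y). {x, y}) ` Q" using F(2)[OF l] O_sub[OF l] by auto
    have "O' l \<subseteq> parcs G" using O_sub[OF l] Q(1) by blast
    then have "finite (O' l)" "irrefl (O' l)"
      using sym_irrefl_parcs(2,3)[OF G] by (auto simp: irrefl_def finite_subset)
    then show "2 * card (factor_edges (F l)) = card (parcs T) * m"
      using card_sym_rel[OF _ O_sym[OF l]] F(2)[OF l] O_card[OF l] by simp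
    fix l' assume l': "l' < k" "l \<noteq> l'"
    show "factor_edges (F l) \<inter> factor_edges (F l') = {}"
    proof (rule ccontr)
      assume "\<not> ?thesis"
      then obtain e where "e \<in> factor_edges (F l)" "e \<in> factor_edges (F l')" by blast
      then obtain x y x' y' where *: "(x, y) \<in> O' l" "(x', y') \<in> O' l'" "{x, y} = {x', y'}"
        using F(2) l l' by auto
      then have "(x, y) \<in> O' l'" using O_sym[OF l'(1)] by (auto simp: doubleton_eq_iff dest: symD)
      then show False using O_disj[OF l l'] * by blast
    qed
  qed
qed

section \<open>Splitting the edges of a regular graph\<close>

text \<open>Randomness enters in two stages: first the labellings, then, with good labellings fixed,
  the choice \<open>\<sigma>\<close> of a labelling by each edge. It is a function of unordered
  pairs because both orientations must choose alike.\<close>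

lemma edge_splitting:
  fixes V :: "'a set" and E :: "('a \<times> 'a) set" and R :: "(nat \<times> nat) set" and \<epsilon> p \<rho> :: real
  assumes V: "finite V" "card V = t * m" and E: "E \<subseteq> V \<times> V" "sym E" "irrefl E"
    and t: "0 < t" and R: "R \<subseteq> {..<t} \<times> {..<t}" "sym R"
    and \<epsilon>: "0 < \<epsilon>" "\<epsilon> \<le> 1/10" and p: "0 < p" "p \<le> 1"
    and deg: "\<And>v. v \<in> V \<Longrightarrow> (1 - \<epsilon>) * real (card V) * p \<le> real (card {w. (v, w) \<in> E})"
    and codeg: "\<And>u v. u \<in> V \<Longrightarrow> v \<in> V \<Longrightarrow> u \<noteq> v \<Longrightarrow>
        real (card {w. (u, w) \<in> E \<and> (v, w) \<in> E}) \<le> (1 + \<epsilon>) * real (card V) * p\<^sup>2"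
    and \<rho>: "\<rho> = real r * real (card R) / (real t)\<^sup>2" "1 \<le> \<rho>"
    and n: "3 \<le> card V" "r \<le> card V" "t \<le> card V" and tp: "real t \<le> \<epsilon> * real (card V) * p"
    and log: "24 * ln (real (card V)) \<le> \<epsilon>\<^sup>2 * \<rho>" "24 * ln (real (card V)) \<le> \<epsilon>\<^sup>2 * (real m * p\<^sup>2 / (4 * \<rho>\<^sup>2))"
  obtains lab :: "nat \<Rightarrow> 'a \<Rightarrow> nat" and \<sigma> :: "'a set \<Rightarrow> nat" where
    "\<And>s v. lab s v < t" "\<And>s i. i < t \<Longrightarrow> card {v\<in>V. lab s v = i} = m"
    "\<And>s v j. s < r \<Longrightarrow> v \<in> V \<Longrightarrow> (lab s v, j) \<in> R \<Longrightarrow>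
       (1 - 10 * \<epsilon>) * real m * (p / \<rho>) \<le> real (card {w. (v, w) \<in> E \<and> lab s w = j \<and> \<sigma> {v, w} = s})"
    "\<And>s u v j. s < r \<Longrightarrow> u \<in> V \<Longrightarrow> v \<in> V \<Longrightarrow> u \<noteq> v \<Longrightarrow> (lab s u, j) \<in> R \<Longrightarrow> (lab s v, j) \<in> R \<Longrightarrow>
       real (card {w. (u, w) \<in> E \<and> (v, w) \<in> E \<and> lab s w = j \<and> \<sigma> {u, w} = s \<and> \<sigma> {v, w} = s})
         \<le> (1 + 10 * \<epsilon>) * real m * (p / \<rho>)\<^sup>2"
proof -
  define n where "n = card V"
  have "\<exists>\<beta>. bij_betw \<beta> V ({..<m} \<times> {..<t})"
    using V by (intro finite_same_card_bij) (auto simp: card_cartesian_product)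
  then obtain \<beta> where \<beta>: "bij_betw \<beta> V ({..<m} \<times> {..<t})" by blast
  interpret block_shifts V \<beta> m t using \<beta> t by unfold_locales
  \<comment> \<open>Neighbours outside the block of \<open>v\<close>. By \<open>tp\<close> this
    costs at most \<open>\<epsilon> * n * p\<close> of the degree.\<close>
  define N where "N v = {w. (v, w) \<in> E \<and> fst (\<beta> v) \<noteq> fst (\<beta> w)}" for v
  have NV: "N v \<subseteq> V" for v using E by (auto simp: N_def)
  have finN: "finite (N v)" for v using NV V finite_subset by blast
  have N_sym: "w \<in> N v \<longleftrightarrow> v \<in> N w" for v w using E(2) by (auto simp: N_def dest: symD)
  have N_irrefl: "v \<notin> N v" for v by (simp add: N_def)
  have nt: "real n = real t * real m" by (simp add: n_def V)
  have m: "0 < real m" using n V by (cases m) auto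
  have finE: "finite {w. (v, w) \<in> E}" for v using E V by (elim finite_subset[rotated]) auto
  define M1 where "M1 = (1 - 2 * \<epsilon>) * real m * p"
  define M2 where "M2 = (1 + \<epsilon>) * real m * p\<^sup>2"
  \<comment> \<open>A common lower bound for the means of all degree and co-degree counts in both
    stages; the factor 4 makes room for the error terms in \<open>\<epsilon>\<close>.\<close>
  define X where "X = real m * p\<^sup>2 / (4 * \<rho>\<^sup>2)"
  define D1 where "D1 = N ` V"
  define D2 where "D2 = (\<lambda>(u, v). N u \<inter> N v) ` {(u, v) \<in> V \<times> V. u \<noteq> v}"
  \<comment> \<open>With \<open>24 * ln n\<close> in the hypotheses, every Chernoff bound is at most
    \<open>n^(-6)\<close>, whereas each stage has at most \<open>4 n^4\<close> bad events.\<close>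
  define b where "b = exp (- 6 * ln (real n))"
  have b: "exp (- (\<epsilon>\<^sup>2 * M / 4)) \<le> b" if "X \<le> M \<or> \<rho> \<le> M" for M
  proof -
    have "\<epsilon>\<^sup>2 * X \<le> \<epsilon>\<^sup>2 * M \<or> \<epsilon>\<^sup>2 * \<rho> \<le> \<epsilon>\<^sup>2 * M" using that by (auto intro: mult_left_mono)
    then show ?thesis using log by (auto simp: b_def n_def X_def)
  qed
  have small: "(real r * real t * (x + y) + 2 * (real n)\<^sup>2) * b < 1"
    if "0 \<le> x" "x \<le> real n" "0 \<le> y" "y \<le> (real n)\<^sup>2" for x y
  proof -
    have n3: "3 \<le> real n" using n by (simp add: n_def)
    have "real n + (real n)\<^sup>2 \<le> 2 * (real n)\<^sup>2" using n3 by (simp add: power2_eq_square)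
    then have "x + y \<le> 2 * (real n)\<^sup>2" using that by linarith
    then have "real r * real t * (x + y) \<le> real n * real n * (2 * (real n)\<^sup>2)"
      using n that by (intro mult_mono) (auto simp: n_def)
    moreover have "2 * (real n)\<^sup>2 \<le> 2 * (real n)\<^sup>2 * (real n)\<^sup>2" using n3 one_le_power[of "real n" 2] by simp
    ultimately have "real r * real t * (x + y) + 2 * (real n)\<^sup>2 \<le> 4 * real n ^ 4"
      by (simp add: power2_eq_square power4_eq_xxxx)
    also have "\<dots> < real n ^ 2 * real n ^ 4"
      using n3 mult_mono[OF n3 n3] by (intro mult_strict_right_mono) (auto simp: power2_eq_square)
    finally have "real r * real t * (x + y) + 2 * (real n)\<^sup>2 < real n ^ 6"
      by (simp flip: power_add)
    moreover have "b = inverse (real n ^ 6)"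
    proof -
      have "exp (6 * ln (real n)) = exp (ln (real n)) ^ 6"
        by (metis exp_of_nat_mult of_nat_numeral)
      then have "exp (6 * ln (real n)) = real n ^ 6" using n3 by simp
      then show ?thesis by (simp add: b_def exp_minus)
    qed
    moreover have "0 < real n ^ 6" using n3 by simp
    ultimately show ?thesis by (simp add: divide_inverse[symmetric])
  qed
  have block: "card {w \<in> V. fst (\<beta> w) = c} \<le> t" for c
    using block_card_le[OF order_refl, of c] t by (simp add: divide_le_eq)
  have degN: "real t * M1 \<le> real (card (N v))" if v: "v \<in> V" for v
  proof -
    have "{w. (v, w) \<in> E} \<subseteq> N v \<union> {w \<in> V. fst (\<beta> w) = fst (\<beta> v)}" using E by (auto simp: N_def)
    then have "card {w. (v, w) \<in> E} \<le> card (N v \<union> {w \<in> V. fst (\<beta> w) = fst (\<beta> v)})"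
      using finN V by (intro card_mono) auto
    also have "\<dots> \<le> card (N v) + t" using card_Un_le block by (meson add_left_mono order_trans)
    finally have "real (card {w. (v, w) \<in> E}) \<le> real (card (N v)) + real t" by linarith
    then have "(1 - \<epsilon>) * real n * p - \<epsilon> * real n * p \<le> real (card (N v))"
      using deg[OF v] tp by (simp add: n_def)
    then show ?thesis by (simp add: M1_def nt algebra_simps)
  qed
  have codegN: "real (card (N u \<inter> N v)) \<le> real t * M2" if "u \<in> V" "v \<in> V" "u \<noteq> v" for u v
  proof -
    have "card (N u \<inter> N v) \<le> card {w. (u, w) \<in> E \<and> (v, w) \<in> E}"
      using finE[of u] by (intro card_mono) (auto simp: N_def)
    then show ?thesis using codeg[OF that] nt by (simp add: M2_def n_def algebra_simps)
  qed
  have p2: "p\<^sup>2 \<le> p" using p by (simp add: power2_eq_square mult_left_le)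
  have \<rho>2: "\<rho> \<le> \<rho>\<^sup>2" "1 \<le> \<rho>\<^sup>2" using \<rho>(2) by (simp_all add: self_le_power one_le_power)
  have M1X: "X \<le> M1"
  proof -
    have "X \<le> real m * p / (4 * 1)" unfolding X_def using m p p2 \<rho>2 by (intro frac_le mult_left_mono) auto
    also have "\<dots> = (1/4) * (real m * p)" by simp
    also have "\<dots> \<le> (1 - 2 * \<epsilon>) * (real m * p)" using \<epsilon> m p by (intro mult_right_mono) auto
    finally show ?thesis by (simp add: M1_def)
  qed
  have M2X: "X \<le> M2"
  proof -
    have "X \<le> real m * p\<^sup>2 / 1" unfolding X_def using m p \<rho>2 by (intro frac_le) auto
    also have "\<dots> \<le> (1 + \<epsilon>) * (real m * p\<^sup>2)" using \<epsilon> m p by simp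
    finally show ?thesis by (simp add: M2_def)
  qed
  have X0: "0 \<le> X" by (simp add: X_def)
  have D1c: "finite D1" "real (card D1) \<le> real n"
    using V(1) by (simp_all add: D1_def n_def card_image_le)
  have finVV: "finite {(u, v) \<in> V \<times> V. u \<noteq> v}" using V by (auto intro: finite_subset[of _ "V \<times> V"])
  have "card {(u, v) \<in> V \<times> V. u \<noteq> v} \<le> n * n"
    unfolding n_def card_cartesian_product[symmetric] using V by (intro card_mono) auto
  then have cVV: "real (card {(u, v) \<in> V \<times> V. u \<noteq> v}) \<le> (real n)\<^sup>2"
    by (simp add: power2_eq_square flip: of_nat_mult)
  have D2c: "finite D2" "real (card D2) \<le> (real n)\<^sup>2"
  proof -
    show "finite D2" using finVV by (simp add: D2_def)
    have "real (card D2) \<le> real (card {(u, v) \<in> V \<times> V. u \<noteq> v})"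
      unfolding D2_def by (intro of_nat_mono card_image_le finVV)
    with cVV show "real (card D2) \<le> (real n)\<^sup>2" by linarith
  qed

  \<comment> \<open>First random stage: the labellings\<close>
  obtain lab :: "nat \<Rightarrow> 'a \<Rightarrow> nat" where lab: "\<And>s v. lab s v < t" "\<And>s i. i < t \<Longrightarrow> card {v\<in>V. lab s v = i} = m"
    and lab1: "\<And>s i W. s < r \<Longrightarrow> i < t \<Longrightarrow> W \<in> D1 \<Longrightarrow> (1 - \<epsilon>) * M1 \<le> real (card {w\<in>W. lab s w = i})"
    and lab2: "\<And>s i W. s < r \<Longrightarrow> i < t \<Longrightarrow> W \<in> D2 \<Longrightarrow> real (card {w\<in>W. lab s w = i}) \<le> (1 + \<epsilon>) * M2"
    and lab3: "\<And>u v. u \<in> V \<Longrightarrow> v \<in> V \<Longrightarrow> fst (\<beta> u) \<noteq> fst (\<beta> v) \<Longrightarrow>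
        (1 - \<epsilon>) * \<rho> \<le> real (card {s\<in>{..<r}. (lab s u, lab s v) \<in> R}) \<and>
        real (card {s\<in>{..<r}. (lab s u, lab s v) \<in> R}) \<le> (1 + \<epsilon>) * \<rho>"
  proof -
    have small': "(real r * real t * (real (card D1) + real (card D2)) + 2 * (real (card V))\<^sup>2) * b < 1"
      using small[of "real (card D1)" "real (card D2)"] D1c D2c by (simp add: n_def)
    have D1: "W \<subseteq> V" "real t * M1 \<le> real (card W)" if "W \<in> D1" for W
      using that NV degN by (auto simp: D1_def)
    have D2: "W \<subseteq> V" "real (card W) \<le> real t * M2" if "W \<in> D2" for W
      using that NV codegN by (auto simp: D2_def)
    have "\<epsilon> \<le> 1" "0 \<le> M1" using \<epsilon> X0 M1X by linarith+
    from random_labellings[OF R(1) \<epsilon>(1) this(1) D1c(1) D1 D2c(1) D2 \<rho>(1) this(2) b[OF disjI1[OF M1X]]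
        b[OF disjI1[OF M2X]] b[OF disjI2[OF order_refl]] small']
    obtain lab :: "nat \<Rightarrow> 'a \<Rightarrow> nat" where
      "(\<forall>s v. lab s v < t) \<and> (\<forall>s. \<forall>i<t. card {v\<in>V. lab s v = i} = m) \<and>
     (\<forall>s<r. \<forall>i<t. \<forall>W\<in>D1. (1 - \<epsilon>) * M1 \<le> real (card {w\<in>W. lab s w = i})) \<and>
     (\<forall>s<r. \<forall>i<t. \<forall>W\<in>D2. real (card {w\<in>W. lab s w = i}) \<le> (1 + \<epsilon>) * M2) \<and>
     (\<forall>u\<in>V. \<forall>v\<in>V. fst (\<beta> u) \<noteq> fst (\<beta> v) \<longrightarrow>
        (1 - \<epsilon>) * \<rho> \<le> real (card {s\<in>{..<r}. (lab s u, lab s v) \<in> R}) \<and>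
        real (card {s\<in>{..<r}. (lab s u, lab s v) \<in> R}) \<le> (1 + \<epsilon>) * \<rho>)" ..
    then show ?thesis using that[of lab] by simp
  qed

  \<comment> \<open>Second random stage: the edges choose labellings\<close>
  define I where "I = {{u, v} | u v. u \<in> V \<and> v \<in> N u}"
  define S where "S e = {s\<in>{..<r}. \<exists>u v. e = {u, v} \<and> (lab s u, lab s v) \<in> R}" for e
  have S_eq: "S {u, v} = {s\<in>{..<r}. (lab s u, lab s v) \<in> R}" for u v
    using R(2) by (auto simp: S_def doubleton_eq_iff dest: symD)
  have finI: "finite I"
    using V NV by (intro finite_subset[of I "(\<lambda>(u, v). {u, v}) ` (V \<times> V)"]) (auto simp: I_def)
  have I_mem: "{u, v} \<in> I" if "v \<in> N u" for u v
    using that NV[of v] N_sym[of v u] by (auto simp: I_def)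
  define hi where "hi = (1 + \<epsilon>) * \<rho>"
  define lo where "lo = (1 - \<epsilon>) * \<rho>"
  have lohi: "0 < lo" "0 < hi" using \<rho>(2) \<epsilon> by (simp_all add: lo_def hi_def)
  have cardS: "lo \<le> real (card (S e))" "real (card (S e)) \<le> hi" if e: "e \<in> I" for e
  proof -
    obtain u v where "e = {u, v}" "u \<in> V" "v \<in> N u" using e by (auto simp: I_def)
    then show "lo \<le> real (card (S e))" "real (card (S e)) \<le> hi"
      using lab3[of u v] NV[of u] by (auto simp: S_eq lo_def hi_def N_def)
  qed
  define star where "star s v j = (\<lambda>w. {v, w}) ` {w \<in> N v. lab s w = j}" for s v j
  define cherry where "cherry s u v j = (\<lambda>w. ({u, w}, {v, w})) ` {w \<in> N u \<inter> N v. lab s w = j}" for s u v j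
  define L1 where "L1 = (\<lambda>(s, v, j). (s, star s v j)) ` {(s, v, j) \<in> {..<r} \<times> V \<times> {..<t}. (lab s v, j) \<in> R}"
  define L2 where "L2 = (\<lambda>(s, (u, v), j). (s, cherry s u v j)) `
    {(s, (u, v), j) \<in> {..<r} \<times> {(u, v) \<in> V \<times> V. u \<noteq> v} \<times> {..<t}. (lab s u, j) \<in> R \<and> (lab s v, j) \<in> R}"
  \<comment> \<open>Bounds for the expected numbers of surviving edges in a star and surviving pairs
    in a cherry: an edge picks a given admissible labelling with probability at least
    \<open>1 / hi\<close> and at most \<open>1 / lo\<close>.\<close>
  define M1' where "M1' = (1 - \<epsilon>) * M1 / hi"
  define M2' where "M2' = (1 + \<epsilon>) * M2 / lo\<^sup>2"
  have M1'X: "X \<le> M1'"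
  proof -
    have "X \<le> (1/4) * (real m * p / \<rho>)" unfolding X_def
      using m p p2 \<rho>2 \<rho>(2) by (simp add: frac_le mult_mono)
    also have "\<dots> \<le> ((1 - \<epsilon>) * (1 - 2 * \<epsilon>) / (1 + \<epsilon>)) * (real m * p / \<rho>)"
    proof (intro mult_right_mono)
      have "(1 + \<epsilon>) \<le> 4 * ((1 - \<epsilon>) * (1 - 2 * \<epsilon>))"
      proof -
        have "4 * ((1 - \<epsilon>) * (1 - 2 * \<epsilon>)) = 4 - 12 * \<epsilon> + 8 * (\<epsilon> * \<epsilon>)" by (simp add: algebra_simps)
        moreover have "0 \<le> \<epsilon> * \<epsilon>" by simp
        ultimately show ?thesis using \<epsilon> by linarith
      qed
      then show "1 / 4 \<le> (1 - \<epsilon>) * (1 - 2 * \<epsilon>) / (1 + \<epsilon>)" using \<epsilon> by (simp add: field_simps)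
    qed (use m p \<rho> in auto)
    finally show ?thesis by (simp add: M1'_def M1_def hi_def mult.assoc)
  qed
  have M2'X: "X \<le> M2'"
  proof -
    have "X \<le> real m * p\<^sup>2 / \<rho>\<^sup>2" unfolding X_def using m p \<rho>2 by (intro frac_le) auto
    also have "\<dots> \<le> ((1 + \<epsilon>) * (1 + \<epsilon>) / (1 - \<epsilon>)\<^sup>2) * (real m * p\<^sup>2 / \<rho>\<^sup>2)"
    proof -
      have "(1 - \<epsilon>)\<^sup>2 \<le> (1 + \<epsilon>) * (1 + \<epsilon>)" using \<epsilon> by (simp add: power2_eq_square mult_mono)
      then have "1 \<le> (1 + \<epsilon>) * (1 + \<epsilon>) / (1 - \<epsilon>)\<^sup>2" using \<epsilon> by simp
      from mult_right_mono[OF this, of "real m * p\<^sup>2 / \<rho>\<^sup>2"] show ?thesis using m by simp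
    qed
    finally show ?thesis by (simp add: M2'_def M2_def lo_def power_mult_distrib mult.assoc)
  qed
  have star_inj: "inj_on (\<lambda>w. {v, w}) (N v)" for v using N_irrefl by (auto simp: inj_on_def doubleton_eq_iff)
  have L1c: "finite L1" "real (card L1) \<le> real r * real t * real n"
  proof -
    have fin: "finite {(s, v, j) \<in> {..<r} \<times> V \<times> {..<t}. (lab s v, j) \<in> R}"
      using V by (auto intro: finite_subset[of _ "{..<r} \<times> V \<times> {..<t}"])
    then show "finite L1" by (simp add: L1_def)
    have "card L1 \<le> card {(s, v, j) \<in> {..<r} \<times> V \<times> {..<t}. (lab s v, j) \<in> R}"
      unfolding L1_def by (rule card_image_le[OF fin])
    also have "\<dots> \<le> card ({..<r} \<times> V \<times> {..<t})" using V by (intro card_mono) auto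
    finally have "real (card L1) \<le> real (r * (n * t))" by (simp only: of_nat_le_iff card_cartesian_product card_lessThan n_def)
    then show "real (card L1) \<le> real r * real t * real n" by (simp add: algebra_simps)
  qed
  have L2c: "finite L2" "real (card L2) \<le> real r * real t * (real n)\<^sup>2"
  proof -
    let ?Q = "{(u, v) \<in> V \<times> V. u \<noteq> v}"
    let ?Z = "{(s, (u, v), j) \<in> {..<r} \<times> ?Q \<times> {..<t}. (lab s u, j) \<in> R \<and> (lab s v, j) \<in> R}"
    have sub: "?Z \<subseteq> {..<r} \<times> ?Q \<times> {..<t}" by auto
    have finp: "finite ({..<r} \<times> ?Q \<times> {..<t})" using finVV by simp
    have fin: "finite ?Z" by (rule finite_subset[OF sub finp])
    then show "finite L2" unfolding L2_def by (rule finite_imageI)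
    have "card L2 \<le> card ?Z" unfolding L2_def by (rule card_image_le[OF fin])
    also have "\<dots> \<le> card ({..<r} \<times> ?Q \<times> {..<t})" by (rule card_mono[OF finp sub])
    finally have "real (card L2) \<le> real (r * (card ?Q * t))" by (simp only: of_nat_le_iff card_cartesian_product card_lessThan)
    also have "\<dots> = real r * real t * real (card ?Q)" by simp
    also have "\<dots> \<le> real r * real t * (real n)\<^sup>2" using cVV by (intro mult_left_mono) auto
    finally show "real (card L2) \<le> real r * real t * (real n)\<^sup>2" .
  qed
  have "\<exists>\<sigma>. (\<forall>e\<in>I. \<sigma> e \<in> S e) \<and>
     (\<forall>(s, D)\<in>L1. (1 - \<epsilon>) * M1' \<le> real (card {e\<in>D. \<sigma> e = s})) \<and>
     (\<forall>(s, F)\<in>L2. real (card {z\<in>F. \<sigma> (fst z) = s \<and> \<sigma> (snd z) = s}) \<le> (1 + \<epsilon>) * M2')"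
  proof (rule random_assignment[where I=I and S=S and lo=lo and hi=hi and b=b])
    show "finite (S e)" for e by (simp add: S_def)
    show "0 \<le> M1'" using M1'X X0 by linarith
    show "exp (- (\<epsilon>\<^sup>2 * M1' / 4)) \<le> b" "exp (- (\<epsilon>\<^sup>2 * M2' / 4)) \<le> b"
      using b M1'X M2'X by auto
    show "(real (card L1) + real (card L2)) * b < 1"
    proof -
      have "(real (card L1) + real (card L2)) * b \<le> (real r * real t * (real n + (real n)\<^sup>2) + 2 * (real n)\<^sup>2) * b"
      proof (rule mult_right_mono)
        show "real (card L1) + real (card L2) \<le> real r * real t * (real n + (real n)\<^sup>2) + 2 * (real n)\<^sup>2"
          unfolding distrib_left using L1c(2) L2c(2) zero_le_power2[of "real n"] by linarith
      qed (simp add: b_def)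
      also have "\<dots> < 1" by (rule small) auto
      finally show ?thesis .
    qed
  next
    fix s D assume "(s, D) \<in> L1"
    then obtain v j where *: "s < r" "v \<in> V" "j < t" "(lab s v, j) \<in> R" "D = star s v j" by (auto simp: L1_def)
    show "D \<subseteq> I" using * I_mem by (auto simp: star_def)
    show "s \<in> S e" if "e \<in> D" for e using that * by (auto simp: star_def S_eq)
    have "card D = card {w \<in> N v. lab s w = j}"
      unfolding * star_def by (intro card_image inj_on_subset[OF star_inj]) auto
    then show "M1' * hi \<le> real (card D)"
      using lab1[of s j "N v"] * lohi by (simp add: M1'_def D1_def)
  next
    fix s F assume "(s, F) \<in> L2"
    then obtain u v j where *: "s < r" "u \<in> V" "v \<in> V" "u \<noteq> v" "j < t" "(lab s u, j) \<in> R" "(lab s v, j) \<in> R"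
      "F = cherry s u v j" by (auto simp: L2_def)
    show "F \<subseteq> I \<times> I" using * I_mem by (auto simp: cherry_def)
    show "s \<in> S e \<and> s \<in> S e'" if "(e, e') \<in> F" for e e' using that * by (auto simp: cherry_def S_eq)
    \<comment> \<open>An edge in both projections would satisfy \<open>{u, w} = {v, w'}\<close>; as
      \<open>u \<noteq> v\<close> this forces \<open>w = v\<close>, although \<open>w\<close> is a
      neighbour of \<open>v\<close>.\<close>
    show "inj_on fst F \<and> inj_on snd F \<and> fst ` F \<inter> snd ` F = {}"
      using * N_irrefl by (auto simp: cherry_def inj_on_def doubleton_eq_iff)
    have "card F = card {w \<in> N u \<inter> N v. lab s w = j}"
      unfolding * cherry_def using N_irrefl by (intro card_image) (auto simp: inj_on_def doubleton_eq_iff)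
    moreover have "N u \<inter> N v \<in> D2" unfolding D2_def using * by force
    ultimately show "real (card F) \<le> M2' * lo\<^sup>2"
      using lab2[of s j "N u \<inter> N v"] * lohi by (simp add: M2'_def)
  qed (use finI cardS lohi \<epsilon> L1c L2c in auto)
  then obtain \<sigma> where \<sigma>S: "\<And>e. e \<in> I \<Longrightarrow> \<sigma> e \<in> S e"
    and \<sigma>1: "\<And>s D. (s, D) \<in> L1 \<Longrightarrow> (1 - \<epsilon>) * M1' \<le> real (card {e\<in>D. \<sigma> e = s})"
    and \<sigma>2: "\<And>s F. (s, F) \<in> L2 \<Longrightarrow> real (card {z\<in>F. \<sigma> (fst z) = s \<and> \<sigma> (snd z) = s}) \<le> (1 + \<epsilon>) * M2'"
    by blast
  \<comment> \<open>Pairs inside a block and non-edges get the value \<open>r\<close>, which is the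
    index of no labelling.\<close>
  define \<sigma>' where "\<sigma>' e = (if e \<in> I then \<sigma> e else r)" for e
  have inI: "(v, w) \<in> E \<and> \<sigma>' {v, w} = s \<longleftrightarrow> w \<in> N v \<and> \<sigma> {v, w} = s" if "s < r" for v w s
  proof
    assume "(v, w) \<in> E \<and> \<sigma>' {v, w} = s"
    then have "{v, w} \<in> I" "\<sigma> {v, w} = s" using that by (auto simp: \<sigma>'_def split: if_splits)
    moreover then have "w \<in> N v" using N_sym by (auto simp: I_def doubleton_eq_iff)
    ultimately show "w \<in> N v \<and> \<sigma> {v, w} = s" by simp
  next
    assume "w \<in> N v \<and> \<sigma> {v, w} = s"
    then show "(v, w) \<in> E \<and> \<sigma>' {v, w} = s" using I_mem[of w v] by (auto simp: \<sigma>'_def N_def)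
  qed
  \<comment> \<open>The errors multiply to
    \<open>(1 - \<epsilon>)^2 (1 - 2 \<epsilon>) / (1 + \<epsilon>)\<close>: two concentration
    steps, the degree bound with the block loss, and the uncertainty in the number of choices. The
    constant 10 covers this and the co-degrees alike.\<close>
  have low: "(1 - 10 * \<epsilon>) * real m * (p / \<rho>) \<le> (1 - \<epsilon>) * M1'"
  proof -
    have "(1 - 10 * \<epsilon>) * (1 + \<epsilon>) \<le> (1 - \<epsilon>) * (1 - \<epsilon>) * (1 - 2 * \<epsilon>)"
    proof -
      have "(1 - \<epsilon>) * (1 - \<epsilon>) * (1 - 2 * \<epsilon>) - (1 - 10 * \<epsilon>) * (1 + \<epsilon>) = \<epsilon> * (5 + 15 * \<epsilon> - 2 * \<epsilon>\<^sup>2)"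
        by (simp add: algebra_simps power2_eq_square)
      moreover have "\<epsilon>\<^sup>2 \<le> 1" using \<epsilon> by (simp add: power_le_one)
      then have "0 \<le> 5 + 15 * \<epsilon> - 2 * \<epsilon>\<^sup>2" using \<epsilon> by linarith
      then have "0 \<le> \<epsilon> * (5 + 15 * \<epsilon> - 2 * \<epsilon>\<^sup>2)" using \<epsilon> by simp
      ultimately show ?thesis by (metis diff_ge_0_iff_ge)
    qed
    then have "1 - 10 * \<epsilon> \<le> (1 - \<epsilon>) * (1 - \<epsilon>) * (1 - 2 * \<epsilon>) / (1 + \<epsilon>)" using \<epsilon> by (simp add: le_divide_eq)
    then have "(1 - 10 * \<epsilon>) * (real m * p / \<rho>) \<le> ((1 - \<epsilon>) * (1 - \<epsilon>) * (1 - 2 * \<epsilon>) / (1 + \<epsilon>)) * (real m * p / \<rho>)"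
      using m p \<rho> by (intro mult_right_mono) auto
    then show ?thesis by (simp add: M1'_def M1_def hi_def mult.assoc)
  qed
  \<comment> \<open>Two concentration steps and the co-degree bound give
    \<open>(1 + \<epsilon>)^3\<close>; the two edges of a pair give
    \<open>(1 - \<epsilon>)^2\<close> in the denominator.\<close>
  have high: "(1 + \<epsilon>) * M2' \<le> (1 + 10 * \<epsilon>) * real m * (p / \<rho>)\<^sup>2"
  proof -
    have "(1 + \<epsilon>) * (1 + \<epsilon>) * (1 + \<epsilon>) \<le> (1 + 10 * \<epsilon>) * (1 - \<epsilon>)\<^sup>2"
    proof -
      have "(1 + 10 * \<epsilon>) * (1 - \<epsilon>)\<^sup>2 - (1 + \<epsilon>) * (1 + \<epsilon>) * (1 + \<epsilon>) = \<epsilon> * (5 - 22 * \<epsilon> + 9 * \<epsilon>\<^sup>2)"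
        by (simp add: algebra_simps power2_eq_square)
      moreover have "0 \<le> 5 - 22 * \<epsilon> + 9 * \<epsilon>\<^sup>2" using \<epsilon> zero_le_power2[of \<epsilon>] by linarith
      then have "0 \<le> \<epsilon> * (5 - 22 * \<epsilon> + 9 * \<epsilon>\<^sup>2)" using \<epsilon> by simp
      ultimately show ?thesis by (metis diff_ge_0_iff_ge)
    qed
    then have "(1 + \<epsilon>) * (1 + \<epsilon>) * (1 + \<epsilon>) / (1 - \<epsilon>)\<^sup>2 \<le> 1 + 10 * \<epsilon>" using \<epsilon> by (simp add: divide_le_eq)
    then have "((1 + \<epsilon>) * (1 + \<epsilon>) * (1 + \<epsilon>) / (1 - \<epsilon>)\<^sup>2) * (real m * p\<^sup>2 / \<rho>\<^sup>2) \<le> (1 + 10 * \<epsilon>) * (real m * p\<^sup>2 / \<rho>\<^sup>2)"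
      using m by (intro mult_right_mono) auto
    then show ?thesis by (simp add: M2'_def M2_def lo_def power_mult_distrib power_divide mult.assoc)
  qed
  have R_less: "j < t" if "(i, j) \<in> R" for i j using R(1) that by auto
  show thesis
  proof (rule that[of lab \<sigma>'])
    show "lab s v < t" for s v by (rule lab)
    show "card {v \<in> V. lab s v = i} = m" if "i < t" for s i by (rule lab(2)[OF that])
  next
    fix s v j assume *: "s < r" "v \<in> V" "(lab s v, j) \<in> R"
    then have "(s, star s v j) \<in> L1" unfolding L1_def using R_less by force
    from \<sigma>1[OF this] low have "(1 - 10 * \<epsilon>) * real m * (p / \<rho>) \<le> real (card {e \<in> star s v j. \<sigma> e = s})" by linarith
    also have "{e \<in> star s v j. \<sigma> e = s} = (\<lambda>w. {v, w}) ` {w. (v, w) \<in> E \<and> lab s w = j \<and> \<sigma>' {v, w} = s}"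
      using inI[OF *(1)] by (auto simp: star_def)
    also have "card \<dots> = card {w. (v, w) \<in> E \<and> lab s w = j \<and> \<sigma>' {v, w} = s}"
      using inI[OF *(1)] by (intro card_image inj_on_subset[OF star_inj[of v]]) blast
    finally show "(1 - 10 * \<epsilon>) * real m * (p / \<rho>) \<le> real (card {w. (v, w) \<in> E \<and> lab s w = j \<and> \<sigma>' {v, w} = s})" .
  next
    fix s u v j assume *: "s < r" "u \<in> V" "v \<in> V" "u \<noteq> v" "(lab s u, j) \<in> R" "(lab s v, j) \<in> R"
    have "(s, cherry s u v j) \<in> L2"
      unfolding L2_def using * R_less by (intro image_eqI[of _ _ "(s, (u, v), j)"]) auto
    from \<sigma>2[OF this] high have "real (card {z \<in> cherry s u v j. \<sigma> (fst z) = s \<and> \<sigma> (snd z) = s}) \<le> (1 + 10 * \<epsilon>) * real m * (p / \<rho>)\<^sup>2"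
      by linarith
    moreover have "{z \<in> cherry s u v j. \<sigma> (fst z) = s \<and> \<sigma> (snd z) = s}
      = (\<lambda>w. ({u, w}, {v, w})) ` {w. (u, w) \<in> E \<and> (v, w) \<in> E \<and> lab s w = j \<and> \<sigma>' {u, w} = s \<and> \<sigma>' {v, w} = s}"
    proof -
      have "{w. (u, w) \<in> E \<and> (v, w) \<in> E \<and> lab s w = j \<and> \<sigma>' {u, w} = s \<and> \<sigma>' {v, w} = s}
        = {w. w \<in> N u \<inter> N v \<and> lab s w = j \<and> \<sigma> {u, w} = s \<and> \<sigma> {v, w} = s}"
        using inI[OF *(1), of u] inI[OF *(1), of v] by blast
      then show ?thesis by (auto simp: cherry_def)
    qed
    moreover have "inj_on (\<lambda>w. ({u, w}, {v, w}))
        {w. (u, w) \<in> E \<and> (v, w) \<in> E \<and> lab s w = j \<and> \<sigma>' {u, w} = s \<and> \<sigma>' {v, w} = s}"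
      using E(3) by (auto simp: inj_on_def doubleton_eq_iff irrefl_def)
    ultimately show "real (card {w. (u, w) \<in> E \<and> (v, w) \<in> E \<and> lab s w = j \<and> \<sigma>' {u, w} = s \<and> \<sigma>' {v, w} = s})
         \<le> (1 + 10 * \<epsilon>) * real m * (p / \<rho>)\<^sup>2"
      by (simp add: card_image)
  qed
qed

section \<open>The packing\<close>

text \<open>Here \<open>a\<close> stands for the number of arcs of the tree. The choice of
  \<open>r\<close> makes \<open>\<rho> \<ge> r / t^2 \<ge> 24 * ln n / \<epsilon>^2\<close>, as the
  concentration over labellings requires; \<open>big\<close> then supplies all other
  inequalities.\<close>

lemma packing_parameters:
  fixes t n m :: nat and a \<epsilon> p :: real
  assumes t: "1 \<le> t" and n: "n = t * m" "3 \<le> n" and a: "1 \<le> a" "a \<le> (real t)\<^sup>2"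
    and \<epsilon>: "0 < \<epsilon>" "\<epsilon> \<le> 1" and p: "0 < p" "p \<le> 1"
    and big: "10 ^ 6 * real t ^ 5 * ln (real n) ^ 3 \<le> \<epsilon> ^ 6 * real n * p ^ 4"
  defines "r \<equiv> nat \<lceil>24 * (real t)\<^sup>2 * ln (real n) / \<epsilon>\<^sup>2\<rceil>"
  defines "\<rho> \<equiv> real r * a / (real t)\<^sup>2"
  shows "1 \<le> \<rho>" "r \<le> n" "t \<le> n" "real t \<le> \<epsilon> * real n * p"
    "24 * ln (real n) \<le> \<epsilon>\<^sup>2 * \<rho>" "24 * ln (real n) \<le> \<epsilon>\<^sup>2 * (real m * p\<^sup>2 / (4 * \<rho>\<^sup>2))"
    "1 \<le> real m * (p / \<rho>)\<^sup>2 * (10 * \<epsilon>)\<^sup>2" "1 + real r * real t \<le> 2 * \<epsilon> * real n * p"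
proof -
  define L where "L = ln (real n)"
  define H where "H = \<epsilon> ^ 6 * real n * p ^ 4"
  define x where "x = (real t)\<^sup>2 * L / \<epsilon>\<^sup>2"
  have L: "1 \<le> L"
  proof -
    have "exp 1 \<le> real n" using exp_le n(2) by linarith
    then show ?thesis unfolding L_def using n(2) by (subst ln_ge_iff) auto
  qed
  have t1: "1 \<le> real t" using t by simp
  have LL: "L \<le> L ^ 3" using L by (simp add: self_le_power)
  have H: "10 ^ 6 * real t ^ 5 * L ^ 3 \<le> H" using big by (simp add: H_def L_def)
  have tL: "25 * real t ^ j * L \<le> H" if j: "j \<le> 5" for j
  proof -
    have "real t ^ j \<le> real t ^ 5" using t1 j by (intro power_increasing) auto
    then have "25 * real t ^ j * L \<le> 10 ^ 6 * real t ^ 5 * L ^ 3"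
      using LL L t1 by (intro mult_mono) auto
    then show ?thesis using H by linarith
  qed
  have x1: "1 \<le> x"
  proof -
    have "1 * 1 \<le> (real t)\<^sup>2 * L" using L t1 by (intro mult_mono) (auto simp: one_le_power)
    moreover have "\<epsilon>\<^sup>2 \<le> 1" using \<epsilon> by (simp add: power_le_one)
    ultimately show ?thesis using \<epsilon> by (simp add: x_def le_divide_eq)
  qed
  have r_ge: "24 * x \<le> real r"
    unfolding r_def x_def L_def using real_nat_ceiling_ge[of "24 * (real t)\<^sup>2 * ln (real n) / \<epsilon>\<^sup>2"] by (simp add: mult.assoc)
  have r_le: "real r \<le> 25 * x"
  proof -
    have "r = nat \<lceil>24 * x\<rceil>" by (simp add: r_def x_def L_def mult.assoc)
    \<comment> \<open>Since \<open>x \<ge> 1\<close>, rounding up is absorbed in the constant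
      25.\<close>
    then have "real r \<le> 24 * x + 1" using x1 by linarith
    then show ?thesis using x1 by simp
  qed
  have \<rho>_le: "\<rho> \<le> real r" unfolding \<rho>_def using a t1 by (simp add: divide_le_eq mult_left_mono)
  have \<rho>_ge: "real r / (real t)\<^sup>2 \<le> \<rho>" unfolding \<rho>_def using a by (intro divide_right_mono) (auto simp: mult_le_cancel_left1)
  have "24 * L / \<epsilon>\<^sup>2 = 24 * x / (real t)\<^sup>2" using t1 by (simp add: x_def)
  also have "\<dots> \<le> real r / (real t)\<^sup>2" using r_ge by (intro divide_right_mono) auto
  finally have \<rho>L: "24 * L / \<epsilon>\<^sup>2 \<le> \<rho>" using \<rho>_ge by linarith
  then show \<rho>_log: "24 * ln (real n) \<le> \<epsilon>\<^sup>2 * \<rho>" using \<epsilon> by (simp add: L_def divide_le_eq mult.commute)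
  have \<epsilon>_pow: "\<epsilon> ^ 6 \<le> \<epsilon> ^ k" if "k \<le> 6" for k using \<epsilon> that by (intro power_decreasing) auto
  have "\<epsilon>\<^sup>2 * \<rho> \<le> 1 * \<rho>" using \<epsilon> \<rho>_ge by (intro mult_right_mono power_le_one) (auto intro: order_trans[rotated])
  then show \<rho>1: "1 \<le> \<rho>" using \<rho>_log L by (simp add: L_def)
  have p_pow: "p ^ 4 \<le> p ^ k" if "k \<le> 4" for k using p that by (intro power_decreasing) auto
  \<comment> \<open>As \<open>\<epsilon>\<close> and \<open>p\<close> are at most 1, lowering their
    exponents only enlarges \<open>H\<close>.\<close>
  have Hle: "H \<le> \<epsilon> ^ j * real n * p ^ k" if "j \<le> 6" "k \<le> 4" for j k
    unfolding H_def using \<epsilon> p \<epsilon>_pow[OF that(1)] p_pow[OF that(2)] by (intro mult_mono) auto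
  show "r \<le> n"
  proof -
    have "25 * ((real t)\<^sup>2 * L) \<le> \<epsilon>\<^sup>2 * real n" using tL[of 2] Hle[of 2 0] by simp
    then have "25 * x \<le> real n" using \<epsilon> by (simp add: x_def divide_le_eq mult.commute)
    then show ?thesis using r_le by linarith
  qed
  have "real t * 1 \<le> 25 * real t ^ 1 * L" using L t1 by (intro mult_mono) auto
  then have "real t \<le> H" using tL[of 1] by simp
  then show "real t \<le> \<epsilon> * real n * p" using Hle[of 1 1] by simp
  show "t \<le> n" using n by (cases m) auto
  \<comment> \<open>With \<open>m = n / t\<close> and
    \<open>\<rho> \<le> 25 * t^2 * L / \<epsilon>^2\<close>, the right side is at least
    \<open>\<epsilon>^6 n p^2 / (625 t^5 L^2)\<close>. This accounts for the powers in
    \<open>big\<close> and for \<open>10 ^ 6 = 1600 * 625\<close>.\<close>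
  have key: "1600 * L \<le> \<epsilon>\<^sup>2 * (real m * p\<^sup>2 / \<rho>\<^sup>2)"
  proof -
    have "1600 * L * (625 * real t ^ 5 * L\<^sup>2) = 10 ^ 6 * real t ^ 5 * L ^ 3"
      by (simp add: power2_eq_square power3_eq_cube)
    also have "\<dots> \<le> \<epsilon> ^ 6 * real n * p\<^sup>2" using H Hle[of 6 2] by linarith
    finally have "1600 * L \<le> \<epsilon> ^ 6 * real n * p\<^sup>2 / (625 * real t ^ 5 * L\<^sup>2)"
      using L t1 by (subst le_divide_eq) auto
    also have "\<dots> = \<epsilon>\<^sup>2 * (real m * p\<^sup>2 / (25 * x)\<^sup>2)"
      using L t1 \<epsilon> n by (simp add: x_def field_simps power2_eq_square) (simp add: eval_nat_numeral)
    also have "\<dots> \<le> \<epsilon>\<^sup>2 * (real m * p\<^sup>2 / \<rho>\<^sup>2)"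
      using \<rho>1 \<rho>_le r_le \<epsilon> by (intro mult_left_mono divide_left_mono power_mono) auto
    finally show ?thesis .
  qed
  have quarter_le: "24 * L \<le> y / 4" if "1600 * L \<le> y" for y using that L by linarith
  have quarter: "\<epsilon>\<^sup>2 * (real m * p\<^sup>2 / (4 * \<rho>\<^sup>2)) = \<epsilon>\<^sup>2 * (real m * p\<^sup>2 / \<rho>\<^sup>2) / 4" by simp
  show "24 * ln (real n) \<le> \<epsilon>\<^sup>2 * (real m * p\<^sup>2 / (4 * \<rho>\<^sup>2))"
    unfolding quarter using quarter_le[OF key] by (simp only: L_def)
  have "real m * (p / \<rho>)\<^sup>2 * (10 * \<epsilon>)\<^sup>2 = 100 * (\<epsilon>\<^sup>2 * (real m * p\<^sup>2 / \<rho>\<^sup>2))" by (simp add: power_divide power_mult_distrib)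
  then show "1 \<le> real m * (p / \<rho>)\<^sup>2 * (10 * \<epsilon>)\<^sup>2" using key L by linarith
  \<comment> \<open>The 1 comes from the upper bound on the number of edges, \<open>r * t\<close>
    from rounding down the number of factors of each labelling.\<close>
  show "1 + real r * real t \<le> 2 * \<epsilon> * real n * p"
  proof -
    have "real r * real t \<le> 25 * x * real t" using r_le t1 by (intro mult_right_mono) auto
    also have "\<dots> = 25 * real t ^ 3 * L / \<epsilon>\<^sup>2" by (simp add: x_def power2_eq_square power3_eq_cube)
    also have "\<dots> \<le> \<epsilon> ^ 3 * real n * p ^ 1 / \<epsilon>\<^sup>2" using tL[of 3] Hle[of 3 1] by (intro divide_right_mono) auto
    also have "\<dots> = \<epsilon> * real n * p" using \<epsilon> by (simp add: power2_eq_square power3_eq_cube)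
    finally have "real r * real t \<le> \<epsilon> * real n * p" .
    moreover have "1 \<le> \<epsilon> * real n * p" using \<open>real t \<le> H\<close> t1 Hle[of 1 1] by simp
    ultimately show ?thesis by simp
  qed
qed

lemma degree_eq_card: "Defs.degree G v = card {w. (v, w) \<in> parcs G}"
proof -
  have "out_arcs (with_proj G) v = Pair v ` {w. (v, w) \<in> parcs G}" by (auto simp: out_arcs_def)
  then show ?thesis by (simp add: Defs.degree_def out_degree_def card_image inj_on_def)
qed

text \<open>The upper bound is not immediate, as regularity allows single large degrees. Counting
  paths of length two by their ends bounds the sum of squared degrees through the co-degrees, and
  Cauchy--Schwarz gives a quadratic inequality for the degree sum.\<close>

lemma card_edges_bounds:
  fixes G :: "'a pair_pre_digraph" and \<epsilon> p :: real
  assumes G: "pair_graph G" and reg: "eps_p_regular \<epsilon> p G" and n: "card (pverts G) = n" "0 < n"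
    and \<epsilon>: "0 \<le> \<epsilon>" and p: "0 \<le> p"
  shows "(1 - \<epsilon>) * (real n)\<^sup>2 * p \<le> 2 * real (card (edges G))"
    and "2 * real (card (edges G)) \<le> real n * (1 + (1 + \<epsilon>) * real n * p)"
proof -
  interpret pair_graph G by fact
  define V where "V = pverts G"
  have fin: "finite V" "finite (parcs G)" using pair_finite_verts pair_finite_arcs by (auto simp: V_def)
  define d where "d v = card {w. (v, w) \<in> parcs G}" for v
  have sub: "{w. (v, w) \<in> parcs G} \<subseteq> V" for v by (auto simp: V_def dest: wellformed')
  have finN: "finite {w. (v, w) \<in> parcs G}" for v using sub fin(1) finite_subset by blast
  have deg: "(1 - \<epsilon>) * real n * p \<le> real (d v)" if "v \<in> V" for v
    using reg that n unfolding eps_p_regular_def V_def by (auto simp: degree_eq_card d_def)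
  have codeg: "real (card {w \<in> V. (u, w) \<in> parcs G \<and> (v, w) \<in> parcs G}) \<le> (1 + \<epsilon>) * real n * p\<^sup>2"
    if "u \<in> V" "v \<in> V" "u \<noteq> v" for u v
    using reg that n unfolding eps_p_regular_def codegree_def V_def by auto
  have cardP: "card (parcs G) = 2 * card (edges G)"
    using card_sym_rel[OF sym_irrefl_parcs(3,1,2)[OF G]] by (simp add: edges_eq_image)
  have "parcs G = (SIGMA v:V. {w. (v, w) \<in> parcs G})" by (auto simp: V_def dest: wellformed')
  then have "card (parcs G) = (\<Sum>v\<in>V. d v)"
    unfolding d_def using fin(1) finN by (metis card_SigmaI)
  then have sumd: "2 * real (card (edges G)) = (\<Sum>v\<in>V. real (d v))" using cardP by (simp flip: of_nat_sum)
  have "(\<Sum>v\<in>V. (1 - \<epsilon>) * real n * p) \<le> (\<Sum>v\<in>V. real (d v))" by (rule sum_mono[OF deg])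
  then show "(1 - \<epsilon>) * (real n)\<^sup>2 * p \<le> 2 * real (card (edges G))"
    using n sumd by (simp add: V_def power2_eq_square mult_ac)
  define A where "A = (\<Sum>v\<in>V. real (d v))"
  have sq: "(\<Sum>w\<in>V. (real (d w))\<^sup>2) \<le> A + (real n)\<^sup>2 * ((1 + \<epsilon>) * real n * p\<^sup>2)"
  proof -
    define \<xi> :: "'a \<Rightarrow> 'a \<Rightarrow> real" where "\<xi> v w = of_bool ((v, w) \<in> parcs G)" for v w
    have \<xi>_sym: "\<xi> v w = \<xi> w v" for v w using arcs_symmetric by (auto simp: \<xi>_def)
    have dsum: "real (d v) = (\<Sum>w\<in>V. \<xi> v w)" for v
    proof -
      have "V \<inter> {w. (v, w) \<in> parcs G} = {w. (v, w) \<in> parcs G}" using sub by auto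
      then show ?thesis using fin(1) by (simp add: \<xi>_def d_def)
    qed
    have "(\<Sum>w\<in>V. (real (d w))\<^sup>2) = (\<Sum>w\<in>V. \<Sum>u\<in>V. \<Sum>v\<in>V. \<xi> u w * \<xi> v w)"
      unfolding dsum power2_eq_square sum_product by (subst (1 2) \<xi>_sym) (rule refl)
    also have "\<dots> = (\<Sum>u\<in>V. \<Sum>v\<in>V. \<Sum>w\<in>V. \<xi> u w * \<xi> v w)"
      by (subst sum.swap, intro sum.cong refl sum.swap)
    also have "\<dots> \<le> (\<Sum>u\<in>V. \<Sum>v\<in>V. (if v = u then real (d u) else 0) + (1 + \<epsilon>) * real n * p\<^sup>2)"
    proof (intro sum_mono)
      fix u v assume uv: "u \<in> V" "v \<in> V"
      show "(\<Sum>w\<in>V. \<xi> u w * \<xi> v w) \<le> (if v = u then real (d u) else 0) + (1 + \<epsilon>) * real n * p\<^sup>2"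
      proof (cases "v = u")
        case True
        have "(\<Sum>w\<in>V. \<xi> u w * \<xi> u w) = (\<Sum>w\<in>V. \<xi> u w)" by (intro sum.cong) (auto simp: \<xi>_def)
        then show ?thesis using True \<epsilon> by (simp add: dsum)
      next
        case False
        have "(\<Sum>w\<in>V. \<xi> u w * \<xi> v w) = (\<Sum>w\<in>V. of_bool ((u, w) \<in> parcs G \<and> (v, w) \<in> parcs G))"
          by (intro sum.cong) (auto simp: \<xi>_def)
        also have "\<dots> = real (card {w \<in> V. (u, w) \<in> parcs G \<and> (v, w) \<in> parcs G})"
          using fin(1) by (simp add: Int_def)
        finally show ?thesis using codeg[of u v] uv False by simp
      qed
    qed
    also have "\<dots> = A + (real n)\<^sup>2 * ((1 + \<epsilon>) * real n * p\<^sup>2)"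
      using fin(1) n by (simp add: sum.distrib A_def V_def power2_eq_square)
    finally show ?thesis .
  qed
  have "A\<^sup>2 \<le> real n * (\<Sum>w\<in>V. (real (d w))\<^sup>2)"
    unfolding A_def using sum_squared_le_sum_of_squares[of "\<lambda>v. real (d v)" V] n by (simp add: V_def mult.commute)
  also have "\<dots> \<le> real n * (A + (real n)\<^sup>2 * ((1 + \<epsilon>) * real n * p\<^sup>2))" using sq by (intro mult_left_mono) auto
  finally have A2: "A * (A - real n) \<le> (real n)\<^sup>2 * ((1 + \<epsilon>) * (real n * p)\<^sup>2)"
    by (simp add: algebra_simps power2_eq_square)
  \<comment> \<open>With \<open>y = (1 + \<epsilon>) n p\<close>, an \<open>A\<close> beyond
    \<open>n (1 + y)\<close> would make \<open>A (A - n)\<close> exceed \<open>n^2 y^2\<close>,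
    against \<open>A2\<close>.\<close>
  have "A \<le> real n * (1 + (1 + \<epsilon>) * real n * p)"
  proof (rule ccontr)
    define y where "y = (1 + \<epsilon>) * real n * p"
    assume "\<not> ?thesis"
    then have A: "real n * (1 + y) < A" by (simp add: y_def)
    have y: "0 \<le> y" using \<epsilon> p by (simp add: y_def)
    have "(1 + \<epsilon>) * (real n * p)\<^sup>2 \<le> (1 + \<epsilon>)\<^sup>2 * (real n * p)\<^sup>2"
      using \<epsilon> by (intro mult_right_mono) (auto simp: self_le_power)
    also have "\<dots> = y * y" by (simp add: y_def power2_eq_square)
    finally have "(real n)\<^sup>2 * ((1 + \<epsilon>) * (real n * p)\<^sup>2) \<le> (real n)\<^sup>2 * (y * y)" by (intro mult_left_mono) auto
    also have "\<dots> = (real n * y) * (real n * y)" by (simp add: power2_eq_square)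
    also have "\<dots> \<le> A * (real n * y)" using A y n by (intro mult_right_mono) (auto simp: algebra_simps)
    also have "\<dots> < A * (A - real n)"
    proof (intro mult_strict_left_mono)
      show "real n * y < A - real n" using A by (simp add: algebra_simps)
      show "0 < A" using A y n by (meson add_nonneg_nonneg le_less_trans mult_nonneg_nonneg of_nat_0_le_iff zero_le_one)
    qed
    finally show False using A2 by simp
  qed
  then show "2 * real (card (edges G)) \<le> real n * (1 + (1 + \<epsilon>) * real n * p)" using sumd by (simp add: A_def)
qed

text \<open>In terms of \<open>z = \<epsilon> powr (1/6)\<close> the matching loss is at most
  \<open>13 z^3\<close>, because \<open>4 * sqrt 10 \<le> 13\<close>, and the allowance is about
  \<open>2 z^2\<close>. The bound \<open>z \<le> 1/13\<close> makes the loss at most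
  \<open>z^2\<close>, leaving the other \<open>z^2\<close> for the terms linear in
  \<open>\<epsilon>\<close>; this is the origin of \<open>(1/13) ^ 6\<close>.\<close>

lemma small_loss:
  fixes \<epsilon> :: real
  assumes \<epsilon>: "0 < \<epsilon>" "\<epsilon> \<le> (1/13) ^ 6"
  shows "4 * sqrt (10 * \<epsilon>) \<le> 1/3" "3 * \<epsilon> + 4 * sqrt (10 * \<epsilon>) \<le> 2 * \<epsilon> powr (1/3) * (1 - \<epsilon>)"
proof -
  define z where "z = \<epsilon> powr (1/6)"
  have z: "0 < z" using \<epsilon> by (simp add: z_def)
  have z6: "z ^ 6 = \<epsilon>" unfolding z_def using \<epsilon> by (simp add: powr_powr flip: powr_numeral)
  have z2: "\<epsilon> powr (1/3) = z\<^sup>2" unfolding z_def using \<epsilon> by (simp add: powr_powr flip: powr_numeral)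
  have z13: "z \<le> 1/13" using \<epsilon>(2) z power_le_imp_le_base[of z 5 "1/13"] by (simp add: z6)
  have "sqrt (10 * \<epsilon>) = sqrt 10 * z ^ 3"
    using z real_sqrt_power[of "z\<^sup>2" 3] by (simp add: z6[symmetric] real_sqrt_mult flip: power_mult)
  moreover have "sqrt 10 \<le> 13/4" by (rule real_le_lsqrt) (simp_all add: power2_eq_square)
  ultimately have "4 * sqrt (10 * \<epsilon>) \<le> 13 * z ^ 3" using z by (simp add: mult_right_mono)
  also have "\<dots> = (13 * z) * z\<^sup>2" by (simp add: power2_eq_square power3_eq_cube)
  also have "\<dots> \<le> 1 * z\<^sup>2" using z z13 by (intro mult_right_mono) auto
  finally have eta: "4 * sqrt (10 * \<epsilon>) \<le> z\<^sup>2" by simp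
  have "z\<^sup>2 \<le> (1/13)\<^sup>2" using z z13 by (intro power_mono) auto
  then have z2_le: "z\<^sup>2 \<le> 1/169" by (simp add: power2_eq_square)
  then show "4 * sqrt (10 * \<epsilon>) \<le> 1/3" using eta by linarith
  have "\<epsilon> = z\<^sup>2 * (z\<^sup>2 * z\<^sup>2)" by (simp add: z6[symmetric] flip: power_add)
  also have "\<dots> \<le> z\<^sup>2 * (1/169 * (1/169))" using z2_le by (intro mult_left_mono mult_mono) auto
  finally have \<epsilon>z: "5 * \<epsilon> \<le> z\<^sup>2" using zero_le_power2[of z] by linarith
  have "z\<^sup>2 * \<epsilon> \<le> 1 * \<epsilon>" using z2_le \<epsilon> by (intro mult_right_mono) auto
  then have "2 * z\<^sup>2 * (1 - \<epsilon>) \<ge> 2 * z\<^sup>2 - 2 * \<epsilon>" by (simp add: algebra_simps)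
  then show "3 * \<epsilon> + 4 * sqrt (10 * \<epsilon>) \<le> 2 * \<epsilon> powr (1/3) * (1 - \<epsilon>)"
    unfolding z2 using eta \<epsilon>z by linarith
qed

lemma tree_factor_packing:
  fixes T :: "'b pair_pre_digraph" and G :: "'a pair_pre_digraph" and \<epsilon> p :: real
  assumes tree: "undirected_tree T" and t: "card (pverts T) = t" "2 \<le> t"
    and G: "pair_graph G" and n: "card (pverts G) = n" "t dvd n" "3 \<le> n"
    and reg: "eps_p_regular \<epsilon> p G"
    and \<epsilon>: "0 < \<epsilon>" "\<epsilon> \<le> (1/13) ^ 6" and p: "0 < p" "p \<le> 1"
    and big: "10 ^ 6 * real t ^ 5 * ln (real n) ^ 3 \<le> \<epsilon> ^ 6 * real n * p ^ 4"
  shows "\<exists>\<F>. (\<forall>F\<in>\<F>. graph_factor T G F) \<and>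
    (\<forall>F\<in>\<F>. \<forall>F'\<in>\<F>. F \<noteq> F' \<longrightarrow> factor_edges F \<inter> factor_edges F' = {}) \<and>
    real (card (edges G - (\<Union>F\<in>\<F>. factor_edges F))) \<le> 2 * \<epsilon> powr (1/3) * real (card (edges G))"
proof -
  have pgT: "pair_graph T" using tree by (simp add: undirected_tree_def)
  interpret T: pair_graph T by fact
  interpret G: pair_graph G by fact
  obtain m where m: "n = t * m" using n(2) by auto
  obtain h where h: "bij_betw h (pverts T) {..<t}"
    using ex_bij_betw_finite_nat[OF T.pair_finite_verts] t by (auto simp: atLeast0LessThan)
  define R where "R = (\<lambda>(i, j). (h i, h j)) ` parcs T"
  define a where "a = card (parcs T)"
  have R_sub: "R \<subseteq> {..<t} \<times> {..<t}"
    using bij_betwE[OF h] by (auto simp: R_def dest: T.wellformed')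
  have R_sym: "sym R" unfolding R_def by (auto intro!: symI dest: T.arcs_symmetric)
  have "inj_on (\<lambda>(i, j). (h i, h j)) (parcs T)"
    using bij_betw_imp_inj_on[OF h] by (auto simp: inj_on_def dest: T.wellformed')
  then have R_card: "card R = a" by (simp add: R_def a_def card_image)
  have RI: "(h i, h j) \<in> R" if "(i, j) \<in> parcs T" for i j using that by (auto simp: R_def)
  have "parcs T \<noteq> {}" using tree_arc_exists[OF tree] t by simp
  then have a1: "1 \<le> real a" using T.pair_finite_arcs by (simp add: a_def Suc_le_eq card_gt_0_iff)
  have "card R \<le> t * t" using card_mono[OF _ R_sub] by (simp add: card_cartesian_product)
  then have a2: "real a \<le> (real t)\<^sup>2" by (simp add: R_card power2_eq_square flip: of_nat_mult)
  have \<epsilon>': "\<epsilon> \<le> 1/10" "\<epsilon> \<le> 1" using \<epsilon>(2) by (simp_all add: power_one_over)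
  define r where "r = nat \<lceil>24 * (real t)\<^sup>2 * ln (real n) / \<epsilon>\<^sup>2\<rceil>"
  define \<rho> where "\<rho> = real r * real a / (real t)\<^sup>2"
  have t1: "1 \<le> t" using t by simp
  note par = packing_parameters[OF t1 m n(3) a1 a2 \<epsilon>(1) \<epsilon>'(2) p big, folded r_def, folded \<rho>_def]
  have deg: "(1 - \<epsilon>) * real (card (pverts G)) * p \<le> real (card {w. (v, w) \<in> parcs G})" if "v \<in> pverts G" for v
    using reg that unfolding eps_p_regular_def by (auto simp: degree_eq_card)
  have codeg: "real (card {w. (u, w) \<in> parcs G \<and> (v, w) \<in> parcs G}) \<le> (1 + \<epsilon>) * real (card (pverts G)) * p\<^sup>2"
    if "u \<in> pverts G" "v \<in> pverts G" "u \<noteq> v" for u v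
  proof -
    have "{w. (u, w) \<in> parcs G \<and> (v, w) \<in> parcs G} = {w \<in> pverts G. (u, w) \<in> parcs G \<and> (v, w) \<in> parcs G}"
      by (auto dest: G.wellformed')
    then show ?thesis using reg that unfolding eps_p_regular_def codegree_def by auto
  qed
  have \<rho>': "\<rho> = real r * real (card R) / (real t)\<^sup>2" by (simp add: \<rho>_def R_card)
  have size: "card (pverts G) = t * m" "0 < t" "3 \<le> card (pverts G)" "r \<le> card (pverts G)" "t \<le> card (pverts G)"
    "real t \<le> \<epsilon> * real (card (pverts G)) * p" "24 * ln (real (card (pverts G))) \<le> \<epsilon>\<^sup>2 * \<rho>"
    "24 * ln (real (card (pverts G))) \<le> \<epsilon>\<^sup>2 * (real m * p\<^sup>2 / (4 * \<rho>\<^sup>2))"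
    using n m t1 par by auto
  note symG = sym_irrefl_parcs[OF G]
  obtain lab :: "nat \<Rightarrow> 'a \<Rightarrow> nat" and \<sigma> :: "'a set \<Rightarrow> nat" where
    lab: "\<And>s v. lab s v < t" "\<And>s i. i < t \<Longrightarrow> card {v\<in>pverts G. lab s v = i} = m" and
    low: "\<And>s v j. s < r \<Longrightarrow> v \<in> pverts G \<Longrightarrow> (lab s v, j) \<in> R \<Longrightarrow>
       (1 - 10 * \<epsilon>) * real m * (p / \<rho>) \<le> real (card {w. (v, w) \<in> parcs G \<and> lab s w = j \<and> \<sigma> {v, w} = s})" and
    high: "\<And>s u v j. s < r \<Longrightarrow> u \<in> pverts G \<Longrightarrow> v \<in> pverts G \<Longrightarrow> u \<noteq> v \<Longrightarrow> (lab s u, j) \<in> R \<Longrightarrow> (lab s v, j) \<in> R \<Longrightarrow>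
       real (card {w. (u, w) \<in> parcs G \<and> (v, w) \<in> parcs G \<and> lab s w = j \<and> \<sigma> {u, w} = s \<and> \<sigma> {v, w} = s})
         \<le> (1 + 10 * \<epsilon>) * real m * (p / \<rho>)\<^sup>2"
    by (rule edge_splitting[OF G.pair_finite_verts size(1) symG(4,1,2) size(2) R_sub R_sym \<epsilon>(1) \<epsilon>'(1) p deg codeg
        \<rho>' par(1) size(3-8)]) (assumption | rule that)+
  define \<eta> where "\<eta> = 4 * sqrt (10 * \<epsilon>)"
  \<comment> \<open>The number of factors from each labelling; rounding down loses less than one
    factor per labelling.\<close>
  define k where "k = nat \<lfloor>(1 - \<eta>) * real m * (p / \<rho>)\<rfloor>"
  define Q where "Q s = {(x, y). (x, y) \<in> parcs G \<and> \<sigma> {x, y} = s}" for s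
  have \<rho>0: "0 < \<rho>" using par(1) by simp
  have k_arg: "0 \<le> (1 - \<eta>) * real m * (p / \<rho>)" using small_loss(1)[OF \<epsilon>] p \<rho>0 by (simp add: \<eta>_def)
  then have k_le: "real k \<le> (1 - \<eta>) * real m * (p / \<rho>)" by (simp add: k_def)
  have k_ge: "(1 - \<eta>) * real m * (p / \<rho>) - 1 \<le> real k" unfolding k_def using k_arg by linarith
  define good where "good s F \<longleftrightarrow> (\<forall>l<k. graph_factor T G (F l) \<and> factor_edges (F l) \<subseteq> (\<lambda>(x, y). {x, y}) ` Q s \<and>
     2 * card (factor_edges (F l)) = card (parcs T) * m \<and>
     (\<forall>l'<k. l \<noteq> l' \<longrightarrow> factor_edges (F l) \<inter> factor_edges (F l') = {}))" for s F
  have ex: "\<exists>F. good s F" if s: "s < r" for s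
    unfolding good_def
  proof (rule tree_factors_of_labelling[OF tree h size(2) G lab])
    show "Q s \<subseteq> parcs G" by (auto simp: Q_def)
    show "sym (Q s)" by (auto simp: Q_def insert_commute intro!: symI dest: G.arcs_symmetric)
    show "0 < p / \<rho>" "0 < 10 * \<epsilon>" using p \<rho>0 \<epsilon> by simp_all
    show "4 * sqrt (10 * \<epsilon>) \<le> 1/3" by (rule small_loss(1)[OF \<epsilon>])
    show "1 \<le> real m * (p / \<rho>)\<^sup>2 * (10 * \<epsilon>)\<^sup>2" by (rule par(7))
    show "real k \<le> (1 - 4 * sqrt (10 * \<epsilon>)) * real m * (p / \<rho>)" using k_le by (simp add: \<eta>_def)
  next
    fix i j v assume ij: "(i, j) \<in> parcs T" and v: "v \<in> pverts G" "lab s v = h i"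
    have "{w. (v, w) \<in> Q s \<and> lab s w = h j} = {w. (v, w) \<in> parcs G \<and> lab s w = h j \<and> \<sigma> {v, w} = s}"
      by (auto simp: Q_def)
    then show "(1 - 10 * \<epsilon>) * real m * (p / \<rho>) \<le> real (card {w. (v, w) \<in> Q s \<and> lab s w = h j})"
      using low[OF s v(1), of "h j"] RI[OF ij] v by simp
  next
    fix i j u v assume ij: "(i, j) \<in> parcs T" and uv: "u \<in> pverts G" "v \<in> pverts G" "lab s u = h i" "lab s v = h i" "u \<noteq> v"
    have "{w. (u, w) \<in> Q s \<and> (v, w) \<in> Q s \<and> lab s w = h j}
      = {w. (u, w) \<in> parcs G \<and> (v, w) \<in> parcs G \<and> lab s w = h j \<and> \<sigma> {u, w} = s \<and> \<sigma> {v, w} = s}"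
      by (auto simp: Q_def)
    then show "real (card {w. (u, w) \<in> Q s \<and> (v, w) \<in> Q s \<and> lab s w = h j}) \<le> (1 + 10 * \<epsilon>) * real m * (p / \<rho>)\<^sup>2"
      using high[OF s uv(1,2,5), of "h j"] RI[OF ij] uv by simp
  qed
  define F where "F s = (SOME F. good s F)" for s
  have "good s (F s)" if "s < r" for s
    unfolding F_def using ex[OF that] by (rule someI_ex)
  then have F: "graph_factor T G (F s l)" "factor_edges (F s l) \<subseteq> (\<lambda>(x, y). {x, y}) ` Q s"
    "2 * card (factor_edges (F s l)) = a * m"
    "\<And>l'. l' < k \<Longrightarrow> l \<noteq> l' \<Longrightarrow> factor_edges (F s l) \<inter> factor_edges (F s l') = {}"
    if "s < r" "l < k" for s l
    using that by (simp_all add: good_def a_def)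

  \<comment> \<open>Disjointness of the factors\<close>
  define J where "J = {..<r} \<times> {..<k}"
  define f where "f z = factor_edges (F (fst z) (snd z))" for z
  define \<F> where "\<F> = (\<lambda>z. F (fst z) (snd z)) ` J"
  \<comment> \<open>\<open>\<sigma>\<close> tells from which labelling an edge of a factor stems, so
    factors of different labellings share no edge.\<close>
  have \<sigma>_f: "\<sigma> e = fst z" if "z \<in> J" "e \<in> f z" for e z
    using F(2)[of "fst z" "snd z"] that by (auto simp: J_def f_def Q_def)
  have f_disj: "f z \<inter> f z' = {}" if z: "z \<in> J" "z' \<in> J" "z \<noteq> z'" for z z'
  proof (cases "fst z = fst z'")
    case True
    then have "snd z \<noteq> snd z'" using z(3) by (simp add: prod_eq_iff)
    then show ?thesis using F(4)[of "fst z" "snd z" "snd z'"] z True by (auto simp: J_def f_def)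
  next
    case False
    then have "e \<notin> f z'" if "e \<in> f z" for e using \<sigma>_f[OF z(1) that] \<sigma>_f[OF z(2), of e] by auto
    then show ?thesis by auto
  qed
  have f_sub: "f z \<subseteq> edges G" if "z \<in> J" for z
  proof -
    have "f z \<subseteq> (\<lambda>(x, y). {x, y}) ` Q (fst z)"
      unfolding f_def using that by (intro F(2)) (auto simp: J_def)
    also have "\<dots> \<subseteq> edges G" unfolding edges_eq_image by (rule image_mono) (auto simp: Q_def)
    finally show ?thesis .
  qed
  have fin_edges: "finite (edges G)" using G.pair_finite_arcs by (simp add: edges_eq_image)
  define U where "U = (\<Union>z\<in>J. f z)"
  have U_eq: "(\<Union>F\<in>\<F>. factor_edges F) = U" by (auto simp: U_def \<F>_def f_def)
  have U_sub: "U \<subseteq> edges G" using f_sub by (auto simp: U_def)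

  \<comment> \<open>Counting the uncovered edges\<close>
  have "card U = (\<Sum>z\<in>J. card (f z))"
    unfolding U_def
  proof (rule card_UN_disjoint)
    show "finite J" by (simp add: J_def)
    show "\<forall>z\<in>J. finite (f z)" by (auto intro: finite_subset[OF f_sub fin_edges])
  qed (use f_disj in blast)
  then have "2 * card U = (\<Sum>z\<in>J. 2 * card (f z))" by (simp add: sum_distrib_left)
  also have "\<dots> = (\<Sum>z\<in>J. a * m)" using F(3) by (intro sum.cong) (auto simp: J_def f_def)
  also have "\<dots> = (r * k) * (a * m)" by (simp add: J_def card_cartesian_product)
  finally have U_card: "2 * real (card U) = real r * real a * real m * real k"
    by (metis (no_types) mult.assoc mult.commute of_nat_mult of_nat_numeral)
  have n0: "0 < n" using n by simp
  note E = card_edges_bounds[OF G reg n(1) n0 less_imp_le[OF \<epsilon>(1)] less_imp_le[OF p(1)]]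
  have rpos: "0 < real r * real a" using \<rho>0 t1 unfolding \<rho>_def by (simp add: zero_less_divide_iff)
  have "real r * real a * real m * ((1 - \<eta>) * real m * (p / \<rho>) - 1) \<le> 2 * real (card U)"
    unfolding U_card using k_ge by (intro mult_left_mono) auto
  \<comment> \<open>By definition \<open>r * a / \<rho> = t^2\<close>, and \<open>t * m = n\<close>:
    up to rounding, the factors lose only the proportion \<open>\<eta>\<close> of
    \<open>n^2 p\<close>.\<close>
  moreover have "real r * real a * real m * ((1 - \<eta>) * real m * (p / \<rho>)) = (1 - \<eta>) * (real n)\<^sup>2 * p"
  proof -
    have "0 < r" "0 < a" using rpos by (simp_all add: zero_less_mult_iff)
    then show ?thesis using t1 by (simp add: \<rho>_def m power2_eq_square)
  qed
  moreover have "real r * real a * real m \<le> real n * (real r * real t)"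
  proof -
    have "real r * real m * real a \<le> real r * real m * (real t)\<^sup>2" using a2 by (intro mult_left_mono) auto
    then show ?thesis by (simp add: m power2_eq_square algebra_simps)
  qed
  ultimately have U_ge: "(1 - \<eta>) * (real n)\<^sup>2 * p - real n * (real r * real t) \<le> 2 * real (card U)"
    by (simp add: right_diff_distrib)
  have "real n * (1 + real r * real t) \<le> real n * (2 * \<epsilon> * real n * p)" using par(8) by (intro mult_left_mono) auto
  \<comment> \<open>The \<open>3 * \<epsilon>\<close> consists of \<open>\<epsilon>\<close> from the
    upper bound on the number of edges and \<open>2 * \<epsilon>\<close> from the rounding
    terms.\<close>
  then have "2 * (real (card (edges G)) - real (card U)) \<le> (3 * \<epsilon> + \<eta>) * ((real n)\<^sup>2 * p)"
    using U_ge E(2) by (simp add: algebra_simps power2_eq_square)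
  also have "\<dots> \<le> (2 * \<epsilon> powr (1/3) * (1 - \<epsilon>)) * ((real n)\<^sup>2 * p)"
    using small_loss(2)[OF \<epsilon>] p by (intro mult_right_mono) (auto simp: \<eta>_def)
  also have "\<dots> = 2 * \<epsilon> powr (1/3) * ((1 - \<epsilon>) * (real n)\<^sup>2 * p)" by simp
  \<comment> \<open>The factor \<open>1 - \<epsilon>\<close> reserved in \<open>small_loss\<close>
    pays for replacing \<open>n^2 p\<close> by the number of edges.\<close>
  also have "\<dots> \<le> 2 * \<epsilon> powr (1/3) * (2 * real (card (edges G)))" using E(1) by (intro mult_left_mono) auto
  finally have "real (card (edges G)) - real (card U) \<le> 2 * \<epsilon> powr (1/3) * real (card (edges G))" by simp
  moreover have "real (card (edges G - U)) = real (card (edges G)) - real (card U)"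
    using U_sub fin_edges card_mono[OF fin_edges U_sub] by (simp add: card_Diff_subset finite_subset of_nat_diff)
  ultimately have "real (card (edges G - (\<Union>F\<in>\<F>. factor_edges F))) \<le> 2 * \<epsilon> powr (1/3) * real (card (edges G))"
    unfolding U_eq by simp
  moreover have "\<forall>F\<in>\<F>. graph_factor T G F" using F(1) by (auto simp: \<F>_def J_def)
  moreover have "\<forall>F\<in>\<F>. \<forall>F'\<in>\<F>. F \<noteq> F' \<longrightarrow> factor_edges F \<inter> factor_edges F' = {}"
  proof (intro ballI impI)
    fix X Y assume XY: "X \<in> \<F>" "Y \<in> \<F>" "X \<noteq> Y"
    then obtain z z' where "z \<in> J" "z' \<in> J" "X = F (fst z) (snd z)" "Y = F (fst z') (snd z')" by (auto simp: \<F>_def)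
    then show "factor_edges X \<inter> factor_edges Y = {}" using f_disj[of z z'] XY(3) by (auto simp: f_def)
  qed
  ultimately show ?thesis by blast
qed

theorem theorem1:
  fixes T :: "'b pair_pre_digraph"
  assumes "undirected_tree T" and "card (pverts T) \<ge> 2"
  shows "\<exists>\<epsilon>0 > 0. \<forall>(\<epsilon> :: nat \<Rightarrow> real) (p :: nat \<Rightarrow> real).
           (\<forall>n. 0 < \<epsilon> n \<and> \<epsilon> n \<le> \<epsilon>0) \<longrightarrow>
           (\<forall>n. 0 < p n \<and> p n \<le> 1) \<longrightarrow>
           filterlim (\<lambda>n. (\<epsilon> n ^ 6 * real n * p n ^ 4) / ln (real n) ^ 3) at_top sequentially \<longrightarrow>
           (\<forall>\<^sub>F n in sequentially. card (pverts T) dvd n \<longrightarrow>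
              (\<forall>G :: 'a pair_pre_digraph.
                 pair_graph G \<and> card (pverts G) = n \<and> eps_p_regular (\<epsilon> n) (p n) G \<longrightarrow>
                 (\<exists>\<F>. (\<forall>F \<in> \<F>. graph_factor T G F) \<and>
                      (\<forall>F \<in> \<F>. \<forall>F' \<in> \<F>. F \<noteq> F' \<longrightarrow> factor_edges F \<inter> factor_edges F' = {}) \<and>
                      real (card (edges G - (\<Union>F \<in> \<F>. factor_edges F)))
                        \<le> 2 * \<epsilon> n powr (1/3) * real (card (edges G)))))"
proof (intro exI[of _ "(1/13) ^ 6"] conjI allI impI)
  fix \<epsilon> p :: "nat \<Rightarrow> real"
  assume \<epsilon>: "\<forall>n. 0 < \<epsilon> n \<and> \<epsilon> n \<le> (1/13) ^ 6" and p: "\<forall>n. 0 < p n \<and> p n \<le> 1"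
    and lim: "filterlim (\<lambda>n. (\<epsilon> n ^ 6 * real n * p n ^ 4) / ln (real n) ^ 3) at_top sequentially"
  define t where "t = card (pverts T)"
  \<comment> \<open>The threshold depends on \<open>T\<close> only, so divergence of the quotient
    passes it eventually, before any \<open>G\<close> is chosen.\<close>
  have "\<forall>\<^sub>F n in sequentially. 10 ^ 6 * real t ^ 5 \<le> (\<epsilon> n ^ 6 * real n * p n ^ 4) / ln (real n) ^ 3"
    using lim by (simp add: filterlim_at_top)
  then show "\<forall>\<^sub>F n in sequentially. card (pverts T) dvd n \<longrightarrow>
              (\<forall>G :: 'a pair_pre_digraph.
                 pair_graph G \<and> card (pverts G) = n \<and> eps_p_regular (\<epsilon> n) (p n) G \<longrightarrow>
                 (\<exists>\<F>. (\<forall>F \<in> \<F>. graph_factor T G F) \<and>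
                      (\<forall>F \<in> \<F>. \<forall>F' \<in> \<F>. F \<noteq> F' \<longrightarrow> factor_edges F \<inter> factor_edges F' = {}) \<and>
                      real (card (edges G - (\<Union>F \<in> \<F>. factor_edges F)))
                        \<le> 2 * \<epsilon> n powr (1/3) * real (card (edges G))))"
    using eventually_ge_at_top[of 3]
  proof eventually_elim
    case (elim n)
    have "0 < ln (real n) ^ 3" using elim(2) by simp
    then have big: "10 ^ 6 * real t ^ 5 * ln (real n) ^ 3 \<le> \<epsilon> n ^ 6 * real n * p n ^ 4"
      using elim(1) by (simp add: le_divide_eq)
    show ?case
      using tree_factor_packing[OF assms(1) t_def[symmetric] _ _ _ _ elim(2) _ _ _ _ _ big] assms(2) \<epsilon> p
      unfolding t_def by blast
  qed
qed simp

end
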